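(* Let $Q_0$ be a cube in $\mathbb{R}^n$, let $\mu$ be the Lebesgue measure, let $0<\alpha<n$, and let $p$ be a log-Hölder continuous exponent on $Q_0$ such that $1<p_*\le p(x)\le p^*<n/\alpha$ for all $x\in Q_0$. Define $q$ by $1/q(x)=1/p(x)-\alpha/n$. Let $w_1,w_2$ be two weights in $A_1(Q_0)$, each of which (playing the role of $v$) satisfies: (i) $v(x)\ge1$ for almost every $x\in Q_0$; (ii) $v$ has finitely many singularities $x_1,\dots,x_m$ in $Q_0$; (iii) there exist positive numbers $\theta$ and $r$ such that $v(x)\le|x-x_i|^{-\theta}$ for almost every $x\in Q(x_i,r)\cap\overline{Q_0}$ and each $i=1,\dots,m$ (the number $m$, the points $x_i$ and the constants $\theta,r$ may depend on the weight). For $0<\epsilon<\min\{\alpha,\ n-\alpha,\ n/q^*,\ n(1/p^*-1/q_* )\}$ let $$\frac1{q_\epsilon^{-}(x)}=\frac1{p(x)}-\frac{\alpha-\epsilon}{n},\qquad s_\epsilon^{-}(x)=1+\frac{q_\epsilon^{-}(x)}{p'(x)},$$ and let $w$ be the weight $$w=w_1^{1/q_\epsilon^{-}}\,w_2^{(1/q_\epsilon^{-})\left(1-(s_\epsilon^{-})_*\right)}.$$ Then, for every such $\epsilon$ small enough, there exists a positive constant $C$ such that $$\|w\,I_\alpha f\|_{q(\cdot),Q_0}\le C\,\|w f\|_{p(\cdot),Q_0}$$ for every function $f$ such that $wf\in L^{p(\cdot)}(Q_0)$.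
   Context: $Q(x,l)$ denotes a cube in $\mathbb{R}^n$ centered at $x$ with side length $l$ and sides parallel to the coordinate axes. An exponent is a measurable function $p:Q_0\to[1,\infty)$. For a function $t$ on $Q_0$ write $t_*=\inf_{Q_0}t$, $t^*=\sup_{Q_0}t$. When $p_*>1$, $p'$ is defined by $1/p(x)+1/p'(x)=1$. An exponent $p$ is log-Hölder continuous if there is $C>0$ with $|p(x)-p(y)|\le C/\log(1/|x-y|)$ for all $x,y\in Q_0$ with $|x-y|\le1/2$. For measurable $f$, $\rho_{p(\cdot),Q_0}(f)=\int_{Q_0}|f(x)|^{p(x)}\,d\mu(x)$ and $\|f\|_{p(\cdot),Q_0}=\inf\{\lambda>0:\rho_{p(\cdot),Q_0}(f/\lambda)\le1\}$. $L^{p(\cdot)}(Q_0)$ is the set of measurable $f$ supported in $Q_0$ with $\|f\|_{p(\cdot),Q_0}<\infty$. The fractional integral operator is $$I_\alpha f(x)=\int_{Q_0}\frac{f(y)\,|x-y|^{\alpha}}{\mu(Q(x,2|x-y|))}\,d\mu(y).$$ A weight on $Q_0$ is a measurable function with values in $(0,\infty)$ a.e. A weight $v$ belongs to $A_1(Q_0)$ if there is $C>0$ such that $\frac1{\mu(Q)}\int_{Q\cap Q_0}v\,d\mu\le C\,v(x)$ for a.e. $x\in Q\cap Q_0$ and every cube $Q$ (sides parallel to the axes) centered at a point of $Q_0$. A singularity of $v$ is a point $x\in\overline{Q_0}$ such that $v$ is not essentially bounded on $U\cap Q_0$ for any neighbourhood $U$ of $x$; condition (ii) means that the set of singularities of $v$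 is the finite set $\{x_1,\dots,x_m\}$, contained in $Q_0$. "For every such $\epsilon$ small enough" means: there is $\epsilon_0>0$ (depending on $w_1,w_2$ and the other data) such that the assertion holds for all $\epsilon<\epsilon_0$ in the stated range. *)

theory Defs
  imports "HOL-Analysis.Analysis"
begin

text \<open>
  Functions on a set \<open>Q0\<close> are represented by total functions on \<open>real ^ 'n\<close> of which only the
  values on \<open>Q0\<close> matter; measurability and "almost everywhere" on \<open>Q0\<close> refer to \<open>lebesgue_on Q0\<close>.
\<close>

definition cube :: "real ^ 'n \<Rightarrow> real \<Rightarrow> (real ^ 'n) set" where
  "cube x l = {y. \<forall>i. \<bar>y $ i - x $ i\<bar> \<le> l / 2}"

text \<open>
  The domain may be an open or a closed cube. For all other cubes below the choice is immaterial,
  since the boundary is a null set.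
\<close>

definition is_cube :: "(real ^ 'n) set \<Rightarrow> bool" where
  "is_cube Q \<longleftrightarrow> (\<exists>x l. 0 < l \<and> (Q = cube x l \<or> Q = interior (cube x l)))"

definition exponent :: "(real ^ 'n) set \<Rightarrow> (real ^ 'n \<Rightarrow> real) \<Rightarrow> bool" where
  "exponent Q0 p \<longleftrightarrow> p \<in> borel_measurable (lebesgue_on Q0) \<and> (\<forall>x\<in>Q0. 1 \<le> p x)"

definition log_Holder :: "(real ^ 'n) set \<Rightarrow> (real ^ 'n \<Rightarrow> real) \<Rightarrow> bool" where
  "log_Holder Q0 p \<longleftrightarrow>
     (\<exists>C>0. \<forall>x\<in>Q0. \<forall>y\<in>Q0. x \<noteq> y \<and> norm (x - y) \<le> 1 / 2 \<longrightarrow>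
        \<bar>p x - p y\<bar> \<le> C / ln (1 / norm (x - y)))"

definition lower :: "(real ^ 'n) set \<Rightarrow> (real ^ 'n \<Rightarrow> real) \<Rightarrow> real" where
  "lower Q0 t = (INF x\<in>Q0. t x)"

definition upper :: "(real ^ 'n) set \<Rightarrow> (real ^ 'n \<Rightarrow> real) \<Rightarrow> real" where
  "upper Q0 t = (SUP x\<in>Q0. t x)"

text \<open>The exponent \<open>p'\<close> with \<open>1 / p x + 1 / p' x = 1\<close>.\<close>

definition conj_exp :: "(real ^ 'n \<Rightarrow> real) \<Rightarrow> real ^ 'n \<Rightarrow> real" where
  "conj_exp p x = 1 / (1 - 1 / p x)"

text \<open>
  The exponent \<open>q\<close> with \<open>1 / q x = 1 / p x - a / n\<close>; \<open>q\<^sub>\<epsilon>\<^sup>-\<close> is the case \<open>a = \<alpha> - \<epsilon>\<close>, and the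
  exponent \<open>s\<^sub>\<epsilon>\<^sup>-\<close> and the weight \<open>product_weight\<close> below are used with the same \<open>a\<close>.
\<close>

definition sobolev_exp :: "real \<Rightarrow> (real ^ 'n \<Rightarrow> real) \<Rightarrow> real ^ 'n \<Rightarrow> real" where
  "sobolev_exp a p x = 1 / (1 / p x - a / real CARD('n))"

definition s_exp :: "real \<Rightarrow> (real ^ 'n \<Rightarrow> real) \<Rightarrow> real ^ 'n \<Rightarrow> real" where
  "s_exp a p x = 1 + sobolev_exp a p x / conj_exp p x"

definition modular :: "(real ^ 'n \<Rightarrow> real) \<Rightarrow> (real ^ 'n) set \<Rightarrow> (real ^ 'n \<Rightarrow> real) \<Rightarrow> ennreal" where
  "modular p Q0 f = (\<integral>\<^sup>+ x. ennreal (\<bar>f x\<bar> powr p x) \<partial>lebesgue_on Q0)"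

text \<open>Valued in \<open>ennreal\<close>, so that the infimum of the empty set is \<open>\<infinity>\<close>.\<close>

definition Lp_norm :: "(real ^ 'n \<Rightarrow> real) \<Rightarrow> (real ^ 'n) set \<Rightarrow> (real ^ 'n \<Rightarrow> real) \<Rightarrow> ennreal" where
  "Lp_norm p Q0 f = Inf {ennreal t | t. 0 < t \<and> modular p Q0 (\<lambda>x. f x / t) \<le> 1}"

definition Lp_space :: "(real ^ 'n \<Rightarrow> real) \<Rightarrow> (real ^ 'n) set \<Rightarrow> (real ^ 'n \<Rightarrow> real) set" where
  "Lp_space p Q0 = {f. f \<in> borel_measurable (lebesgue_on Q0) \<and> Lp_norm p Q0 f < \<infinity>}"

definition frac_kernel :: "real \<Rightarrow> real ^ 'n \<Rightarrow> real ^ 'n \<Rightarrow> real" where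
  "frac_kernel \<alpha> x y = norm (x - y) powr \<alpha> / measure lebesgue (cube x (2 * norm (x - y)))"

text \<open>
  The Bochner integral is \<open>0\<close> by convention where the integrand is not integrable, so an estimate
  for \<open>frac_int\<close> is only meaningful together with \<open>frac_int_defined\<close>.
\<close>

definition frac_int :: "real \<Rightarrow> (real ^ 'n) set \<Rightarrow> (real ^ 'n \<Rightarrow> real) \<Rightarrow> real ^ 'n \<Rightarrow> real" where
  "frac_int \<alpha> Q0 f x = (LINT y|lebesgue_on Q0. f y * frac_kernel \<alpha> x y)"

definition frac_int_defined ::
    "real \<Rightarrow> (real ^ 'n) set \<Rightarrow> (real ^ 'n \<Rightarrow> real) \<Rightarrow> bool" where
  "frac_int_defined \<alpha> Q0 f \<longleftrightarrow>
     (AE x in lebesgue_on Q0. integrable (lebesgue_on Q0) (\<lambda>y. f y * frac_kernel \<alpha> x y))"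

definition weight :: "(real ^ 'n) set \<Rightarrow> (real ^ 'n \<Rightarrow> real) \<Rightarrow> bool" where
  "weight Q0 v \<longleftrightarrow> v \<in> borel_measurable (lebesgue_on Q0) \<and> (AE x in lebesgue_on Q0. 0 < v x)"

definition A1 :: "(real ^ 'n) set \<Rightarrow> (real ^ 'n \<Rightarrow> real) set" where
  "A1 Q0 = {v. weight Q0 v \<and>
     (\<exists>C>0. \<forall>z\<in>Q0. \<forall>l>0. AE x in lebesgue_on (cube z l \<inter> Q0).
        (\<integral>\<^sup>+ y. ennreal (v y) \<partial>lebesgue_on (cube z l \<inter> Q0)) / emeasure lebesgue (cube z l)
          \<le> ennreal (C * v x))}"

definition ess_bounded_on :: "(real ^ 'n) set \<Rightarrow> (real ^ 'n \<Rightarrow> real) \<Rightarrow> bool" where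
  "ess_bounded_on A v \<longleftrightarrow> (\<exists>M. AE x in lebesgue_on A. \<bar>v x\<bar> \<le> M)"

definition singularities :: "(real ^ 'n) set \<Rightarrow> (real ^ 'n \<Rightarrow> real) \<Rightarrow> (real ^ 'n) set" where
  "singularities Q0 v =
     {x \<in> closure Q0. \<forall>U. open U \<and> x \<in> U \<longrightarrow> \<not> ess_bounded_on (U \<inter> Q0) v}"

definition admissible :: "(real ^ 'n) set \<Rightarrow> (real ^ 'n \<Rightarrow> real) \<Rightarrow> bool" where
  "admissible Q0 v \<longleftrightarrow>
     (AE x in lebesgue_on Q0. 1 \<le> v x) \<and>
     finite (singularities Q0 v) \<and> singularities Q0 v \<subseteq> Q0 \<and>
     (\<exists>\<theta>>0. \<exists>r>0. \<forall>z\<in>singularities Q0 v.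
        AE x in lebesgue_on (cube z r \<inter> closure Q0). v x \<le> norm (x - z) powr (- \<theta>))"

definition product_weight :: "real \<Rightarrow> (real ^ 'n \<Rightarrow> real) \<Rightarrow> (real ^ 'n) set \<Rightarrow>
    (real ^ 'n \<Rightarrow> real) \<Rightarrow> (real ^ 'n \<Rightarrow> real) \<Rightarrow> real ^ 'n \<Rightarrow> real" where
  "product_weight a p Q0 w1 w2 x =
     w1 x powr (1 / sobolev_exp a p x) *
     w2 x powr ((1 / sobolev_exp a p x) * (1 - lower Q0 (s_exp a p)))"

end

theory Submission
  imports Defs
begin

text \<open>
  Write \<open>n\<close> for the dimension. The case of a constant exponent \<open>p\<close>, with \<open>1 / q = 1 / p - \<beta> / n\<close>, shows why
  the theorem holds. There the weight has the form \<open>w = u\<^bsup>1/q\<^esup> \<sigma>\<^bsup>-1/p'\<^esup>\<close> with \<open>u, \<sigma>\<close> in \<open>A\<^sub>1\<close>, and an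
  \<open>A\<^sub>1\<close> weight dominates its average over a ball almost everywhere on that ball. Let \<open>g = w f\<close> have
  norm at most \<open>1\<close>, and let \<open>B\<close> be a ball of radius \<open>r\<close> around \<open>x\<close>. One can pull \<open>u\<close> out of the
  average of \<open>g / w\<close> over \<open>B\<close>, and the rest is an average of \<open>h = g \<sigma>\<^bsup>-1/p\<^esup>\<close> with respect to the measure
  \<open>\<sigma> dx\<close>. In the \<open>q\<close>-th power of \<open>w(x) r\<^bsup>\<beta>\<^esup>\<close> times the average of \<open>g / w\<close> all powers of \<open>r\<close> cancel, and
  what remains is at most a multiple of \<open>u(x)\<close> times \<open>\<sigma>(B) / u(B)\<close> times the \<open>p\<close>-th power of the \<open>\<sigma>\<close>-average of
  \<open>h\<close>. Since \<open>u\<close> and \<open>\<sigma>\<close> dominate their averages on \<open>B\<close>, this is at most a multiple of \<open>u(x)\<close> times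
  the \<open>p\<close>-th power of an iterated maximal function, formed first with respect to \<open>\<sigma> dx\<close> and then with
  respect to \<open>u dx\<close>; both measures are doubling, so both maximal operators are bounded on \<open>L\<^bsup>p\<^esup>\<close>. This
  bounds the weighted fractional maximal operator of order \<open>\<beta>\<close> from \<open>L\<^bsup>p\<^esup>\<close> to \<open>L\<^bsup>q\<^esup>\<close>.

  A variable exponent changes two things. The averages have to be raised to powers which vary over
  the ball. Averages over a ball of radius \<open>r\<close> lie between a positive constant and a multiple of
  \<open>r\<^bsup>-n\<^esup>\<close>, and \<open>p\<close> varies by \<open>O(1 / log (1 / r))\<close> there, so that replacing \<open>p(y)\<close> by \<open>p(x)\<close> costs only
  a constant factor (\<open>powr_variation_bounded\<close>, \<open>variable_Jensen_pointwise\<close>). The iterated maximal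
  function is taken with the constant exponent \<open>inf p\<close>. The result is
  \<open>two_weights.weighted_maximal_bound\<close>.
  Secondly, \<open>u\<close> and \<open>\<sigma>\<close> are now powers \<open>w\<^sub>1\<^bsup>t(x)\<^esup>\<close>, \<open>w\<^sub>2\<^bsup>\<tau>(x)\<^esup>\<close> with log-Hoelder continuous exponents, and it has
  to be seen that they are \<open>A\<^sub>1\<close> weights. Near a singularity \<open>z\<close> the bound \<open>v(x) \<le> |x - z|\<^bsup>-\<theta>\<^esup>\<close>
  makes \<open>v\<^bsup>t(x)\<^esup>\<close> comparable to \<open>v\<^bsup>t(z)\<^esup>\<close>, and away from the singularities \<open>v\<close> is bounded above and below
  (\<open>A1_on_variable_powr\<close>).

  Finally the fractional integral of order \<open>\<alpha>\<close> is dominated pointwise by the fractional maximal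
  functions of the orders \<open>\<alpha> - \<epsilon>\<close> and \<open>\<alpha> + \<epsilon>\<close>: sum the averages over dyadic balls up to a radius
  \<open>\<rho>\<close> against the first, those over larger balls against the second, and choose the best \<open>\<rho>\<close>
  (\<open>potential_le_maximal\<close>). The weight of the theorem is adapted to the order \<open>\<alpha> - \<epsilon>\<close>, where \<open>u = w\<^sub>1\<close>. For
  the order \<open>\<alpha> + \<epsilon>\<close> the same \<open>w\<close> requires a power of \<open>w\<^sub>1\<close> slightly above \<open>1\<close>. This is where \<open>\<epsilon>\<close> has to be
  small: an \<open>A\<^sub>1\<close> weight has a power above \<open>1\<close> which is again \<open>A\<^sub>1\<close> (\<open>self_improvement\<close>), by the
  reverse Hoelder inequality.
\<close>

section \<open>Regular sets, ball averages and \<open>A\<^sub>1\<close> weights\<close>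

text \<open>
  The geometry of the domain enters only through this lower bound on the measure of balls around
  points of \<open>S\<close>. A ball of radius \<open>D\<close> contains all of \<open>S\<close>, so larger balls bring nothing new. The bound will
  be applied to the domain itself and to its intersections with cubes, with the same \<open>c\<close>.
\<close>

definition regular_set :: "'a::euclidean_space set \<Rightarrow> real \<Rightarrow> real \<Rightarrow> bool" where
  "regular_set S c D \<longleftrightarrow> S \<in> sets lebesgue \<and> S \<noteq> {} \<and> 0 < c \<and> 0 < D \<and> (\<forall>x\<in>S. S \<subseteq> ball x D) \<and>
     (\<forall>x\<in>S. \<forall>r. 0 < r \<and> r \<le> D \<longrightarrow> ennreal (c * r ^ DIM('a)) \<le> emeasure (lebesgue_on S) (S \<inter> ball x r))"

definition ball_mass :: "'a::euclidean_space set \<Rightarrow> ('a \<Rightarrow> real) \<Rightarrow> 'a \<Rightarrow> real \<Rightarrow> ennreal" where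
  "ball_mass S v z r = (\<integral>\<^sup>+x\<in>ball z r. ennreal (v x) \<partial>lebesgue_on S)"

text \<open>
  The \<open>A\<^sub>1\<close> condition for balls, together with the normalisation \<open>v \<ge> 1\<close>. The exceptional null set does
  not depend on the ball, and the ball may be centred away from \<open>y\<close>; both points allow the condition to
  be used at a fixed \<open>y\<close> for all balls at once.
\<close>

definition A1_on :: "'a::euclidean_space set \<Rightarrow> real \<Rightarrow> ('a \<Rightarrow> real) \<Rightarrow> bool" where
  "A1_on S C v \<longleftrightarrow> 0 < C \<and> v \<in> borel_measurable (lebesgue_on S) \<and> (AE y in lebesgue_on S. 1 \<le> v y) \<and>
     (AE y in lebesgue_on S. \<forall>z\<in>S. \<forall>r>0. y \<in> ball z r \<longrightarrow>
        ball_mass S v z r \<le> ennreal (C * r ^ DIM('a) * v y))"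


lemma sets_Int_ball [simp, intro]:
  fixes S :: "'a::euclidean_space set"
  shows "S \<in> sets lebesgue \<Longrightarrow> S \<inter> ball z r \<in> sets (lebesgue_on S)"
  by (auto simp: sets_restrict_space_iff)

lemma regular_setD:
  fixes S :: "'a::euclidean_space set"
  assumes "regular_set S c D"
  shows "S \<in> sets lebesgue" "S \<noteq> {}" "0 < c" "0 < D" "\<And>x. x \<in> S \<Longrightarrow> S \<subseteq> ball x D"
    "\<And>x r. x \<in> S \<Longrightarrow> 0 < r \<Longrightarrow> r \<le> D \<Longrightarrow> ennreal (c * r ^ DIM('a)) \<le> emeasure (lebesgue_on S) (S \<inter> ball x r)"
  using assms by (auto simp: regular_set_def)

lemma A1_onD:
  fixes S :: "'a::euclidean_space set"
  assumes "A1_on S C v"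
  shows "0 < C" "v \<in> borel_measurable (lebesgue_on S)" "AE y in lebesgue_on S. 1 \<le> v y"
    "AE y in lebesgue_on S. \<forall>z\<in>S. \<forall>r>0. y \<in> ball z r \<longrightarrow> ball_mass S v z r \<le> ennreal (C * r ^ DIM('a) * v y)"
  using assms by (auto simp: A1_on_def)

lemma regular_set_finite_measure:
  fixes S :: "'a::euclidean_space set"
  assumes "regular_set S c D"
  shows "S \<in> lmeasurable" "finite_measure (lebesgue_on S)" "emeasure (lebesgue_on S) S \<noteq> 0"
proof -
  note R = regular_setD[OF assms]
  obtain x where x: "x \<in> S" using R by auto
  have "bounded S" using R(5)[OF x] bounded_subset by blast
  then show L: "S \<in> lmeasurable" using R(1) by (simp add: bounded_set_imp_lmeasurable)
  show "finite_measure (lebesgue_on S)" using L by (simp add: finite_measure_lebesgue_on)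
  have "0 < ennreal (c * D ^ DIM('a))" using R by simp
  also have "\<dots> \<le> emeasure (lebesgue_on S) (S \<inter> ball x D)" using R x by auto
  also have "\<dots> \<le> emeasure (lebesgue_on S) S" using R by (intro emeasure_mono) (auto simp: sets_restrict_space_iff)
  finally show "emeasure (lebesgue_on S) S \<noteq> 0" by auto
qed

lemma regular_set_AE_ex:
  assumes "regular_set S c D" "AE y in lebesgue_on S. P y"
  shows "\<exists>y\<in>S. P y"
proof (rule ccontr)
  assume neg: "\<not> ?thesis"
  have "AE y in lebesgue_on S. False" using assms(2) AE_space
    by eventually_elim (use neg in \<open>auto simp: space_restrict_space\<close>)
  then show False using regular_set_finite_measure(3)[OF assms(1)] by (auto simp: AE_iff_null null_sets_def)
qed

text \<open>
  The ball of radius \<open>D\<close> exhausts \<open>S\<close>, so the condition at a single good point \<open>y\<close> already bounds the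
  total mass.
\<close>

lemma A1_on_total:
  fixes S :: "'a::euclidean_space set"
  assumes R: "regular_set S c D" and A: "A1_on S C v"
  obtains T where "0 < T" "(\<integral>\<^sup>+x. ennreal (v x) \<partial>lebesgue_on S) = ennreal T"
    "AE y in lebesgue_on S. T \<le> C * D ^ DIM('a) * v y"
proof -
  note R' = regular_setD[OF R] note A' = A1_onD[OF A]
  obtain z where z: "z \<in> S" using R' by auto
  have eq: "(\<integral>\<^sup>+x. ennreal (v x) \<partial>lebesgue_on S) = ball_mass S v z D"
    unfolding ball_mass_def using R'(5)[OF z]
    by (intro nn_integral_cong) (auto simp: indicator_def space_restrict_space)
  have ae: "AE y in lebesgue_on S. ball_mass S v z D \<le> ennreal (C * D ^ DIM('a) * v y) \<and> 1 \<le> v y"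
    using A'(3,4) AE_space
  proof eventually_elim
    case (elim y)
    then show ?case using R'(4) R'(5)[OF z] z by (auto simp: space_restrict_space)
  qed
  then obtain y where "ball_mass S v z D \<le> ennreal (C * D ^ DIM('a) * v y)"
    using regular_set_AE_ex[OF R] by blast
  then have fin: "ball_mass S v z D < \<infinity>" by (auto simp: le_less_trans)
  define T where "T = enn2real (ball_mass S v z D)"
  have T: "ball_mass S v z D = ennreal T" using fin by (simp add: T_def less_top)
  have "ennreal (c * D ^ DIM('a)) \<le> emeasure (lebesgue_on S) (S \<inter> ball z D)" using R' z by auto
  also have "\<dots> = (\<integral>\<^sup>+x. indicator (S \<inter> ball z D) x \<partial>lebesgue_on S)"
    using R'(1) by (subst nn_integral_indicator) auto
  also have "\<dots> \<le> ball_mass S v z D" unfolding ball_mass_def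
    using A'(3) by (intro nn_integral_mono_AE) (auto elim!: eventually_mono simp: indicator_def)
  finally have cT: "c * D ^ DIM('a) \<le> T"
    unfolding T using R' by (subst (asm) ennreal_le_iff) (auto simp: T_def)
  show ?thesis
  proof (rule that[of T])
    show "0 < T" using cT R' by (smt (verit) zero_less_mult_iff zero_less_power)
    show "AE y in lebesgue_on S. T \<le> C * D ^ DIM('a) * v y"
      using ae
    proof eventually_elim
      case (elim y)
      then have "0 \<le> v y" by auto
      then show ?case using elim unfolding T using A'(1) R'(4)
        by (subst (asm) ennreal_le_iff) (auto intro!: mult_nonneg_nonneg)
    qed
  qed (use eq T in auto)
qed

section \<open>Self-improvement of \<open>A\<^sub>1\<close> weights\<close>

text \<open>
  How Vitali coverings are used throughout: the \<open>B i\<close> are the disjoint balls and the \<open>A i\<close> their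
  enlargements, which cover \<open>E\<close>.
\<close>

lemma emeasure_cover_le:
  assumes "countable I" and A: "\<And>i. i \<in> I \<Longrightarrow> A i \<in> sets M" and B: "\<And>i. i \<in> I \<Longrightarrow> B i \<in> sets N"
    and disj: "disjoint_family_on B I"
    and le: "\<And>i. i \<in> I \<Longrightarrow> emeasure M (A i) \<le> k * emeasure N (B i)"
    and U: "(\<Union>i\<in>I. B i) \<subseteq> U" "U \<in> sets N" and E: "E \<subseteq> (\<Union>i\<in>I. A i)"
  shows "emeasure M E \<le> k * emeasure N U"
proof -
  define e where "e = to_nat_on I"
  have inj: "inj_on e I" using assms(1) by (simp add: e_def inj_on_to_nat_on)
  define A' where "A' n = (if n \<in> e ` I then A (the_inv_into I e n) else {})" for n
  define B' where "B' n = (if n \<in> e ` I then B (the_inv_into I e n) else {})" for n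
  have A'e: "A' (e i) = A i" and B'e: "B' (e i) = B i" if "i \<in> I" for i
    using that inj by (auto simp: A'_def B'_def the_inv_into_f_f)
  have A's: "range A' \<subseteq> sets M"
    using A inj by (auto simp: A'_def the_inv_into_f_f)
  have B's: "range B' \<subseteq> sets N"
    using B inj by (auto simp: B'_def the_inv_into_f_f)
  have UA: "(\<Union>i\<in>I. A i) = (\<Union>n. A' n)"
    using A'e by (force simp: A'_def inj the_inv_into_f_f split: if_splits)
  have UB: "(\<Union>i\<in>I. B i) = (\<Union>n. B' n)"
    using B'e by (force simp: B'_def inj the_inv_into_f_f split: if_splits)
  have dB: "disjoint_family B'"
    unfolding disjoint_family_on_def
  proof (intro ballI impI)
    fix m n :: nat assume "m \<noteq> n"
    show "B' m \<inter> B' n = {}"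
    proof (cases "m \<in> e ` I \<and> n \<in> e ` I")
      case True
      then obtain i j where ij: "i \<in> I" "j \<in> I" "m = e i" "n = e j" by auto
      then have "i \<noteq> j" using \<open>m \<noteq> n\<close> by auto
      then show ?thesis using ij disj B'e by (auto simp: disjoint_family_on_def)
    qed (auto simp: B'_def)
  qed
  have "emeasure M E \<le> emeasure M (\<Union>n. A' n)"
    using E UA A's by (intro emeasure_mono) auto
  also have "\<dots> \<le> (\<Sum>n. emeasure M (A' n))"
    using A's by (rule emeasure_subadditive_countably)
  also have "\<dots> \<le> (\<Sum>n. k * emeasure N (B' n))"
  proof (rule suminf_le)
    show "emeasure M (A' n) \<le> k * emeasure N (B' n)" for n
      using le A'e B'e by (cases "n \<in> e ` I") (auto simp: A'_def)
  qed auto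
  also have "\<dots> = k * (\<Sum>n. emeasure N (B' n))" by simp
  also have "\<dots> = k * emeasure N (\<Union>n. B' n)"
    using suminf_emeasure[OF B's dB] by simp
  also have "\<dots> \<le> k * emeasure N U"
    using U UB B's by (intro mult_left_mono emeasure_mono) auto
  finally show ?thesis .
qed

lemma ball_mass_eq_density:
  fixes S :: "'a::euclidean_space set"
  assumes "v \<in> borel_measurable (lebesgue_on S)" "S \<in> sets lebesgue"
  shows "ball_mass S v z r = emeasure (density (lebesgue_on S) (\<lambda>x. ennreal (v x))) (S \<inter> ball z r)"
proof -
  have "S \<inter> ball z r \<in> sets (lebesgue_on S)"
    using assms by (auto simp: sets_restrict_space_iff)
  then show ?thesis using assms
    by (subst emeasure_density) (auto simp: ball_mass_def indicator_def intro!: nn_integral_cong)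
qed

text \<open>
  A weak form of the Lebesgue differentiation theorem. If \<open>E\<close> had positive measure, it would have an
  open neighbourhood \<open>U\<close> of measure less than \<open>2 |E|\<close>, and almost all of \<open>E\<close> could be packed with
  disjoint balls inside \<open>U\<close>; the mass of \<open>f\<close> on them is at most \<open>l |U| / 2 < l |E|\<close>, while \<open>f > l\<close> on \<open>E\<close>.
\<close>

lemma null_if_small_averages:
  fixes S :: "'a::euclidean_space set"
  assumes S: "S \<in> sets lebesgue" and f: "f \<in> borel_measurable (lebesgue_on S)"
    and E: "E \<in> lmeasurable" "E \<subseteq> S" and l: "0 < l" and fE: "\<And>x. x \<in> E \<Longrightarrow> l < f x"
    and small: "\<And>x r. x \<in> E \<Longrightarrow> 0 < r \<Longrightarrow> ball_mass S f x r \<le> ennreal (l / 2) * emeasure lebesgue (ball x r)"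
  shows "E \<in> null_sets lebesgue"
proof (rule ccontr)
  assume "E \<notin> null_sets lebesgue"
  define m where "m = measure lebesgue E"
  have Es: "E \<in> sets lebesgue" using E by auto
  have mE: "emeasure lebesgue E = ennreal m"
    using E by (simp add: m_def emeasure_eq_measure2)
  have m0: "0 < m"
    using \<open>E \<notin> null_sets lebesgue\<close> Es mE unfolding m_def
    by (metis ennreal_0 measure_nonneg null_setsI order_le_imp_less_or_eq)
  obtain U where U: "open U" "E \<subseteq> U" "U - E \<in> lmeasurable" "emeasure lebesgue (U - E) < ennreal m"
    using sets_lebesgue_outer_open[OF Es m0] by blast
  have Um: "U \<in> sets lebesgue" using U(1) by (simp add: borel_open)
  let ?K = "{(x, r). x \<in> E \<and> 0 < r \<and> ball x r \<subseteq> U}"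
  have "\<exists>i. i \<in> ?K \<and> x \<in> ball (fst i) (snd i) \<and> snd i < d" if "x \<in> E" "0 < d" for x d
  proof -
    have "x \<in> U" using U that by auto
    then obtain e where "0 < e" "ball x e \<subseteq> U" using U(1) unfolding open_contains_ball by blast
    moreover have "ball x (min e (d/2)) \<subseteq> ball x e" by (simp add: subset_ball)
    ultimately have "(x, min e (d/2)) \<in> ?K" using that by auto
    moreover have "x \<in> ball x (min e (d/2))" "min e (d/2) < d" using that \<open>0 < e\<close> by auto
    ultimately show ?thesis by (intro exI[of _ "(x, min e (d/2))"] conjI) (simp_all only: fst_conv snd_conv)
  qed
  then obtain I where I: "countable I" "I \<subseteq> ?K"
    "pairwise (\<lambda>i j. disjnt (ball (fst i) (snd i)) (ball (fst j) (snd j))) I"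
    and neg: "negligible (E - (\<Union>i\<in>I. ball (fst i) (snd i)))"
    by (rule Vitali_covering_theorem_balls[of E ?K fst snd])
  let ?M = "lebesgue_on S"
  let ?nu = "density ?M (\<lambda>x. ennreal (f x))"
  let ?W = "(\<Union>i\<in>I. S \<inter> ball (fst i) (snd i))"
  have bs: "S \<inter> ball z r \<in> sets ?M" for z r using S by (auto simp: sets_restrict_space_iff)
  have Ws: "?W \<in> sets ?M" using I(1) bs by (intro sets.countable_UN') auto
  have EM: "E \<in> sets ?M" using Es E S by (simp add: sets_restrict_space_iff)
  have 1: "emeasure ?nu ?W \<le> ennreal (l / 2) * emeasure lebesgue U"
  proof (rule emeasure_cover_le[of I "\<lambda>i. S \<inter> ball (fst i) (snd i)" _ "\<lambda>i. ball (fst i) (snd i)"])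
    show "disjoint_family_on (\<lambda>i. ball (fst i) (snd i)) I"
      using I(3) by (auto simp: disjoint_family_on_def pairwise_def disjnt_def)
    show "emeasure ?nu (S \<inter> ball (fst i) (snd i)) \<le> ennreal (l / 2) * emeasure lebesgue (ball (fst i) (snd i))"
      if "i \<in> I" for i
      using small[of "fst i" "snd i"] that I(2) ball_mass_eq_density[OF f S] by auto
    show "(\<Union>i\<in>I. ball (fst i) (snd i)) \<subseteq> U"
    proof
      fix x assume "x \<in> (\<Union>i\<in>I. ball (fst i) (snd i))"
      then obtain i where "i \<in> I" "x \<in> ball (fst i) (snd i)" by blast
      then show "x \<in> U" using subsetD[OF I(2), of i] by (cases i) auto
    qed
  qed (use I(1) bs Um in auto)
  have EW: "emeasure ?M (E - ?W) = 0"
  proof -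
    have "E - ?W = E - (\<Union>i\<in>I. ball (fst i) (snd i))" using E by auto
    then have "emeasure lebesgue (E - ?W) = 0" using neg negligible_iff_emeasure0 Es
      by (metis negligible_imp_sets)
    then show ?thesis using E S by (subst emeasure_restrict_space) auto
  qed
  have "ennreal l * emeasure ?M E \<le> ennreal l * emeasure ?M (E \<inter> ?W)"
  proof -
    have "emeasure ?M E \<le> emeasure ?M (E \<inter> ?W) + emeasure ?M (E - ?W)"
      using EM Ws by (subst plus_emeasure) (auto intro!: emeasure_mono)
    then show ?thesis using EW by (simp add: mult_left_mono)
  qed
  also have "\<dots> = (\<integral>\<^sup>+x. ennreal l * indicator (E \<inter> ?W) x \<partial>?M)"
    using EM Ws by (subst nn_integral_cmult_indicator) auto
  also have "\<dots> \<le> (\<integral>\<^sup>+x. ennreal (f x) * indicator ?W x \<partial>?M)"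
    using fE by (intro nn_integral_mono) (auto simp: indicator_def less_imp_le intro!: ennreal_leI)
  also have "\<dots> = emeasure ?nu ?W" using f Ws by (subst emeasure_density) auto
  also note 1
  also have "emeasure lebesgue U < ennreal (2 * m)"
  proof -
    have "emeasure lebesgue U = emeasure lebesgue E + emeasure lebesgue (U - E)"
      using U Es Um by (subst plus_emeasure) (auto simp: Un_absorb1 intro!: arg_cong[where f="emeasure lebesgue"])
    also have "\<dots> < ennreal m + ennreal m"
      unfolding mE using U(4) by (intro ennreal_add_left_cancel_less[THEN iffD2]) auto
    finally show ?thesis using m0 by (simp flip: ennreal_plus)
  qed
  then have "ennreal (l / 2) * emeasure lebesgue U < ennreal (l/2) * ennreal (2 * m)"
    using l by (intro ennreal_mult_strict_left_mono) auto
  finally show False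
    using mE E S Es l m0 by (simp add: emeasure_restrict_space flip: ennreal_mult)
qed

text \<open>
  A Calderon-Zygmund stopping argument. Almost every point with \<open>f > l\<close> lies in a ball on which the
  average of \<open>f\<close> is at least of the order of \<open>l\<close>. Among the dyadic enlargements of such a ball take the
  last one with this property: the average over any further enlargement is at most of the order of
  \<open>l\<close>, which bounds the mass of \<open>f\<close> on the Vitali enlargement, and by the \<open>A\<^sub>1\<close> condition \<open>C f\<close> exceeds
  a multiple of \<open>l\<close> almost everywhere on the ball itself. The condition on \<open>T\<close> keeps the radii below
  \<open>D\<close>.
\<close>

lemma reverse_weak_type:
  fixes S :: "'a::euclidean_space set"
  defines "b \<equiv> unit_ball_vol (DIM('a)) / 2"
  assumes R: "regular_set S c D" and A: "A1_on S C f"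
    and T: "(\<integral>\<^sup>+x. ennreal (f x) \<partial>lebesgue_on S) = ennreal T"
    and l: "0 < l" "T < b * l * D ^ DIM('a)"
  shows "(\<integral>\<^sup>+x\<in>{x. l < f x}. ennreal (f x) \<partial>lebesgue_on S)
    \<le> ennreal (8 ^ DIM('a) * b / c * l) * emeasure (lebesgue_on S) {x\<in>S. b * l < C * f x}"
proof -
  let ?n = "DIM('a)"
  let ?M = "lebesgue_on S"
  let ?nu = "density ?M (\<lambda>x. ennreal (f x))"
  note R' = regular_setD[OF R] note A' = A1_onD[OF A]
  have S: "S \<in> sets lebesgue" by (rule R')
  have f[measurable]: "f \<in> borel_measurable ?M" by (rule A')
  have b: "0 < b" unfolding b_def by simp
  \<comment> \<open>\<open>Om\<close> collects the balls with large average; \<open>b * l\<close> is \<open>l / 2\<close> times the volume of the unit ball,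
    as required by the differentiation argument.\<close>
  define good where "good z r \<longleftrightarrow> z \<in> S \<and> 0 < r \<and> ennreal (b * l * r ^ ?n) < ball_mass S f z r" for z r
  define Om where "Om = (\<Union>(z, r)\<in>{(z, r). good z r}. ball z r)"
  have Om: "open Om" unfolding Om_def by auto
  let ?E = "{x\<in>S. l < f x}"
  have E: "?E \<in> sets ?M"
  proof -
    have "{x\<in>space ?M. l < f x} \<in> sets ?M" by measurable
    then show ?thesis using S by (simp add: space_restrict_space)
  qed
  have "?E - Om \<in> null_sets lebesgue"
  proof (rule null_if_small_averages[OF S f _ _ l(1)])
    have "?E \<in> sets lebesgue" using E S by (simp add: sets_restrict_space_iff)
    then have "?E - Om \<in> sets lebesgue" using Om by auto
    then show "?E - Om \<in> lmeasurable"
      using regular_set_finite_measure(1)[OF R] by (auto intro: lmeasurable_iff_has_integral fmeasurable.Diff fmeasurableI2)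
    fix x and r :: real assume x: "x \<in> ?E - Om" and r: "0 < r"
    have "x \<in> Om" if "good x r"
      unfolding Om_def by (rule UN_I[of "(x, r)"]) (use that r in auto)
    then have "\<not> good x r" using x by auto
    then have "ball_mass S f x r \<le> ennreal (b * l * r ^ ?n)" using x r by (auto simp: good_def)
    also have "\<dots> = ennreal (l / 2) * emeasure lebesgue (ball x r)"
      using r l by (simp add: emeasure_ball b_def ennreal_mult[symmetric] mult_ac)
    finally show "ball_mass S f x r \<le> ennreal (l / 2) * emeasure lebesgue (ball x r)" .
  qed auto
  then have nullM: "?E - Om \<in> null_sets ?M"
    using S by (auto simp: null_sets_restrict_space)
  have goodD: "r < D" if "good z r" for z r
  proof -
    have "ennreal (b * l * r ^ ?n) < ball_mass S f z r" using that by (simp add: good_def)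
    also have "\<dots> \<le> ennreal T"
      unfolding T[symmetric] ball_mass_def by (intro nn_integral_mono) (auto simp: indicator_def)
    finally have "b * l * r ^ ?n < T" using b l that by (auto simp: good_def ennreal_less_iff)
    then have "b * l * r ^ ?n < b * l * D ^ ?n" using l by linarith
    then have "r ^ ?n < D ^ ?n" using b l by simp
    then show ?thesis using R'(4) by (meson power_less_imp_less_base less_imp_le)
  qed
  \<comment> \<open>Stopping balls. The factor \<open>8\<close> is the first power of \<open>2\<close> beyond the Vitali factor \<open>5\<close>.\<close>
  let ?K = "{(z, r). good z r \<and> ball_mass S f z (8 * r) \<le> ennreal (b * l * (8 * r) ^ ?n)}"
  have stop: "\<exists>r'\<ge>r. (z, r') \<in> ?K" if "good z r" for z r
  proof -
    let ?J = "{k. good z (2 ^ k * r)}"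
    have r0: "0 < r" using that by (simp add: good_def)
    obtain N :: nat where N: "D / r < 2 ^ N" using real_arch_pow[of 2 "D / r"] by auto
    have "?J \<subseteq> {..N}"
    proof
      fix k assume "k \<in> ?J"
      then have "2 ^ k * r < D" using goodD by auto
      then have "2 ^ k < D / r" using r0 by (simp add: field_simps)
      then have "(2::real) ^ k < 2 ^ N" using N by linarith
      then show "k \<in> {..N}" by simp
    qed
    then have finJ: "finite ?J" using finite_subset by blast
    have "0 \<in> ?J" using that by simp
    define k where "k = Max ?J"
    have kJ: "k \<in> ?J" unfolding k_def by (rule Max_in[OF finJ]) (use \<open>0 \<in> ?J\<close> in blast)
    have "k + 3 \<notin> ?J" using Max_ge[OF finJ] unfolding k_def[symmetric] by fastforce
    then have "\<not> good z (8 * (2 ^ k * r))" by (simp add: power_add mult_ac)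
    then have "ball_mass S f z (8 * (2 ^ k * r)) \<le> ennreal (b * l * (8 * (2 ^ k * r)) ^ ?n)"
      using r0 kJ by (auto simp: good_def not_less)
    moreover have "r \<le> 2 ^ k * r" using r0 by simp
    ultimately show ?thesis using kJ by (intro exI[of _ "2 ^ k * r"]) auto
  qed
  have "Om \<subseteq> (\<Union>i\<in>?K. ball (fst i) (snd i))"
  proof
    fix x assume "x \<in> Om"
    then obtain z r where zr: "good z r" "x \<in> ball z r" by (auto simp: Om_def)
    then obtain r' where "r' \<ge> r" "(z, r') \<in> ?K" using stop by blast
    then show "x \<in> (\<Union>i\<in>?K. ball (fst i) (snd i))" using zr by force
  qed
  moreover have "0 < snd i \<and> snd i \<le> D" if "i \<in> ?K" for i
    using that goodD by (auto simp: good_def intro: less_imp_le)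
  ultimately obtain I where I: "countable I" "I \<subseteq> ?K"
    "pairwise (\<lambda>i j. disjnt (ball (fst i) (snd i)) (ball (fst j) (snd j))) I"
    "Om \<subseteq> (\<Union>i\<in>I. ball (fst i) (5 * snd i))"
    by (rule Vitali_covering_lemma_balls)
  let ?k = "ennreal (8 ^ ?n * b / c * l)"
  let ?U = "{x\<in>S. b * l < C * f x}"
  have U: "?U \<in> sets ?M"
  proof -
    have "{x\<in>space ?M. b * l < C * f x} \<in> sets ?M" by measurable
    then show ?thesis using S by (simp add: space_restrict_space)
  qed
  have "emeasure ?nu (?E \<inter> Om) \<le> ?k * emeasure ?M ?U"
  proof (rule emeasure_cover_le[of I "\<lambda>i. S \<inter> ball (fst i) (5 * snd i)" _ "\<lambda>i. ?U \<inter> ball (fst i) (snd i)"])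
    show "disjoint_family_on (\<lambda>i. ?U \<inter> ball (fst i) (snd i)) I"
      using I(3) by (force simp: disjoint_family_on_def pairwise_def disjnt_def)
    show "S \<inter> ball (fst i) (5 * snd i) \<in> sets ?nu" for i using S by auto
    show Ui: "?U \<inter> ball (fst i) (snd i) \<in> sets ?M" for i
      using sets.Int[OF U sets_Int_ball[OF S, of "fst i" "snd i"]] by (rule back_subst[of "\<lambda>A. A \<in> sets ?M"]) auto
    show "?E \<inter> Om \<subseteq> (\<Union>i\<in>I. S \<inter> ball (fst i) (5 * snd i))" using I(4) by auto
    fix i assume i: "i \<in> I"
    obtain z r where zr: "i = (z, r)" by (cases i)
    have g: "good z r" and m: "ball_mass S f z (8 * r) \<le> ennreal (b * l * (8 * r) ^ ?n)"
      using i I(2) zr by auto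
    have r0: "0 < r" and z: "z \<in> S" using g by (auto simp: good_def)
    have "emeasure ?nu (S \<inter> ball z (5 * r)) = ball_mass S f z (5 * r)"
      using ball_mass_eq_density[OF f S] by simp
    also have "\<dots> \<le> ball_mass S f z (8 * r)"
      unfolding ball_mass_def using r0 by (intro nn_integral_mono) (auto simp: indicator_def)
    also note m
    also have "ennreal (b * l * (8 * r) ^ ?n) = ?k * ennreal (c * r ^ ?n)"
      using b l R' r0 by (simp add: ennreal_mult[symmetric] power_mult_distrib)
    also have "ennreal (c * r ^ ?n) \<le> emeasure ?M (S \<inter> ball z r)"
      using R' z r0 goodD[OF g] by auto
    also have "emeasure ?M (S \<inter> ball z r) = emeasure ?M (?U \<inter> ball z r)"
    proof (rule emeasure_eq_AE)
      show "AE x in ?M. (x \<in> S \<inter> ball z r) = (x \<in> ?U \<inter> ball z r)"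
        using A'(3,4) AE_space
      proof eventually_elim
        case (elim y)
        have "b * l < C * f y" if "y \<in> ball z r"
        proof -
          have "ennreal (b * l * r ^ ?n) < ball_mass S f z r" using g by (simp add: good_def)
          also have "\<dots> \<le> ennreal (C * r ^ ?n * f y)" using elim z r0 that by auto
          finally have "b * l * r ^ ?n < C * r ^ ?n * f y" using b l r0 by (simp add: ennreal_less_iff)
          then have "r ^ ?n * (b * l) < r ^ ?n * (C * f y)" by (simp add: mult_ac)
          then show ?thesis using r0 by simp
        qed
        then show ?case by auto
      qed
      show "S \<inter> ball z r \<in> sets ?M" using S by auto
      show "?U \<inter> ball z r \<in> sets ?M" using Ui[of "(z, r)"] by simp
    qed
    finally show "emeasure ?nu (S \<inter> ball (fst i) (5 * snd i)) \<le> ?k * emeasure ?M (?U \<inter> ball (fst i) (snd i))"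
      by (simp add: zr mult_left_mono)
  qed (use I(1) U in auto)
  also have "emeasure ?nu (?E \<inter> Om) = (\<integral>\<^sup>+x\<in>?E \<inter> Om. ennreal (f x) \<partial>?M)"
  proof (rule emeasure_density)
    have "S \<inter> Om \<in> sets ?M" using Om S by (auto simp: sets_restrict_space_iff)
    then have "?E \<inter> (S \<inter> Om) \<in> sets ?M" using E by auto
    then show "?E \<inter> Om \<in> sets ?M" by (rule back_subst[of "\<lambda>A. A \<in> sets ?M"]) auto
  qed auto
  also have "\<dots> = (\<integral>\<^sup>+x\<in>{x. l < f x}. ennreal (f x) \<partial>?M)"
    using AE_not_in[OF nullM] AE_space
    by (intro nn_integral_cong_AE) (auto elim!: eventually_rev_mp simp: indicator_def space_restrict_space)
  finally show ?thesis .
qed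

text \<open>
  The sum is geometric and its last term is below \<open>t powr g\<close>. Truncation at \<open>2 ^ K\<close> keeps all integrals
  finite in the absorption argument of \<open>self_improvement\<close>.
\<close>

lemma dyadic_sum_le:
  fixes g t :: real
  assumes g: "0 < g" and t: "0 \<le> t"
  shows "(\<Sum>k<K. if 2 ^ k < t then (2 ^ k) powr g else 0)
    \<le> 2 powr g / (2 powr g - 1) * min t (2 ^ K) powr g"
proof (induction K)
  case 0
  have "1 < 2 powr g" using g by simp
  then show ?case by simp
next
  case (Suc K)
  let ?q = "2 powr g"
  have q: "1 < ?q" using g by simp
  have qk: "(2 ^ k) powr g = ?q ^ k" for k :: nat
    by (simp add: powr_powr powr_realpow[symmetric] mult.commute)
  show ?case
  proof (cases "2 ^ K < t")
    case True
    have "(\<Sum>k<Suc K. if 2 ^ k < t then (2 ^ k) powr g else 0) \<le> (\<Sum>k<Suc K. ?q ^ k)"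
      by (intro sum_mono) (auto simp: qk)
    also have "\<dots> = (?q ^ Suc K - 1) / (?q - 1)"
      using q by (subst geometric_sum) auto
    also have "\<dots> \<le> ?q / (?q - 1) * ?q ^ K"
      using q by (simp add: field_simps)
    also have "\<dots> \<le> ?q / (?q - 1) * min t (2 ^ Suc K) powr g"
    proof (rule mult_left_mono)
      show "?q ^ K \<le> min t (2 ^ Suc K) powr g"
        unfolding qk[symmetric] using True g by (intro powr_mono2) auto
      show "0 \<le> ?q / (?q - 1)" using q by (intro divide_nonneg_nonneg) linarith+
    qed
    finally show ?thesis .
  next
    case False
    moreover have "(2::real) ^ K \<le> 2 ^ Suc K" by simp
    ultimately have "min t (2 ^ K) = t" "min t (2 ^ Suc K) = t" by linarith+
    then show ?thesis using Suc False by simp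
  qed
qed

text \<open>
  The sum telescopes: each term is the increment of \<open>s powr d\<close> over one dyadic interval. The factor
  \<open>2 powr d - 1\<close>, which tends to \<open>0\<close> with \<open>d\<close>, is what makes absorption possible.
\<close>

lemma min_powr_le_dyadic_sum:
  fixes d s :: real
  assumes d: "0 < d" and s: "0 \<le> s"
  shows "min s (2 ^ K) powr d \<le> 1 + (2 powr d - 1) * (\<Sum>k<K. if 2 ^ k < s then (2 ^ k) powr d else 0)"
proof (induction K)
  case 0
  then show ?case using d s by (simp add: powr_le1)
next
  case (Suc K)
  show ?case
  proof (cases "2 ^ K < s")
    case True
    have "min s (2 ^ Suc K) powr d \<le> (2 ^ Suc K) powr d" using d s by (intro powr_mono2) auto
    also have "\<dots> = (2 ^ K) powr d + (2 powr d - 1) * (2 ^ K) powr d"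
      by (simp add: powr_mult algebra_simps)
    also have "(2 ^ K) powr d = min s (2 ^ K) powr d" using True by simp
    also have "min s (2 ^ K) powr d + (2 powr d - 1) * min s (2 ^ K) powr d
      \<le> 1 + (2 powr d - 1) * (\<Sum>k<K. if 2 ^ k < s then (2 ^ k) powr d else 0) + (2 powr d - 1) * (2 ^ K) powr d"
      using Suc True by simp
    finally show ?thesis using True by (simp add: algebra_simps)
  next
    case False
    moreover have "(2::real) ^ K \<le> 2 ^ Suc K" by simp
    ultimately have "min s (2 ^ K) = s" "min s (2 ^ Suc K) = s" by linarith+
    then show ?thesis using Suc False by simp
  qed
qed

text \<open>
  Gehring's argument. Multiply the reverse weak type inequality at the dyadic levels \<open>2 ^ k * l0\<close> by
  \<open>(2 ^ k) powr d\<close> and sum: the integral of \<open>f * f powr d\<close> is bounded by a multiple of \<open>l0 powr d\<close> times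
  the integral of \<open>f\<close>, plus \<open>2 powr d - 1\<close> times a constant times the integral of \<open>f powr (1 + d)\<close>. For
  small \<open>d\<close> the last term is absorbed, after a truncation that makes it finite. The level \<open>l0\<close> is a
  multiple of the average of \<open>f\<close> over \<open>S\<close>, and this average is at most \<open>C * f y\<close>.
\<close>

lemma self_improvement:
  fixes S :: "'a::euclidean_space set"
  defines "b \<equiv> unit_ball_vol (DIM('a)) / 2"
  assumes R: "regular_set S c D" and A: "A1_on S C f"
    and d: "0 < d" "d \<le> 1"
    and C2: "C / b \<le> C2" "1 \<le> C2"
    and small: "(2 powr d - 1) * (8 ^ DIM('a) * b / c) * (2 * C2\<^sup>2) \<le> 1 / 2"
  shows "AE y in lebesgue_on S. (\<integral>\<^sup>+x. ennreal (f x powr (1 + d)) \<partial>lebesgue_on S)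
    \<le> ennreal (2 * C * (2 * C / b) powr d * D ^ DIM('a) * f y powr (1 + d))"
proof -
  let ?n = "DIM('a)"
  let ?M = "lebesgue_on S"
  note R' = regular_setD[OF R] note A' = A1_onD[OF A]
  have f[measurable]: "f \<in> borel_measurable ?M" by (rule A')
  have b: "0 < b" unfolding b_def by simp
  obtain T where T: "0 < T" "(\<integral>\<^sup>+x. ennreal (f x) \<partial>?M) = ennreal T"
    "AE y in ?M. T \<le> C * D ^ ?n * f y"
    using A1_on_total[OF R A] by metis
  \<comment> \<open>Twice the critical level of the reverse weak type inequality, which is strict.\<close>
  define l0 where "l0 = 2 * T / (b * D ^ ?n)"
  have l0: "0 < l0" using T b R' by (simp add: l0_def)
  define a where "a = 2 powr d - 1"
  have a: "0 < a" using d by (simp add: a_def)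
  define K1 where "K1 = 8 ^ ?n * b / c"
  have K1: "0 < K1" using b R' by (simp add: K1_def)
  define Y where "Y K = (\<integral>\<^sup>+x. ennreal (f x * min (f x / l0) (2 ^ K) powr d) \<partial>?M)" for K :: nat
  have Yfin: "Y K < \<infinity>" for K
  proof -
    have "Y K \<le> (\<integral>\<^sup>+x. ennreal ((2 ^ K) powr d) * ennreal (f x) \<partial>?M)"
      unfolding Y_def
    proof (intro nn_integral_mono_AE)
      show "AE x in ?M. ennreal (f x * min (f x / l0) (2 ^ K) powr d) \<le> ennreal ((2 ^ K) powr d) * ennreal (f x)"
        using A'(3)
      proof eventually_elim
        case (elim x)
        have "min (f x / l0) (2 ^ K) powr d \<le> (2 ^ K) powr d"
          using elim l0 d by (intro powr_mono2) auto
        then show ?case using elim by (simp add: ennreal_mult[symmetric] mult.commute)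
      qed
    qed
    also have "\<dots> = ennreal ((2 ^ K) powr d) * ennreal T" using T(2) by (simp add: nn_integral_cmult)
    also have "\<dots> < \<infinity>" by (simp add: ennreal_mult_less_top)
    finally show ?thesis .
  qed
  have Ybd: "Y K \<le> ennreal (2 * T)" for K
  proof -
    let ?G = "\<lambda>k x. if 2 ^ k < f x / l0 then (2 ^ k) powr d * f x else 0"
    let ?H = "\<lambda>k x. if 2 ^ k < C2 * (f x / l0) then (2 ^ k) powr (1 + d) else 0"
    have "Y K \<le> (\<integral>\<^sup>+x. ennreal (f x) + (\<Sum>k<K. ennreal (a * ?G k x)) \<partial>?M)"
      unfolding Y_def
    proof (intro nn_integral_mono_AE)
      show "AE x in ?M. ennreal (f x * min (f x / l0) (2 ^ K) powr d) \<le> ennreal (f x) + (\<Sum>k<K. ennreal (a * ?G k x))"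
        using A'(3)
      proof eventually_elim
        case (elim x)
        have "min (f x / l0) (2 ^ K) powr d \<le> 1 + a * (\<Sum>k<K. if 2 ^ k < f x / l0 then (2 ^ k) powr d else 0)"
          unfolding a_def using elim l0 d by (intro min_powr_le_dyadic_sum) auto
        then have "f x * min (f x / l0) (2 ^ K) powr d \<le> f x * (1 + a * (\<Sum>k<K. if 2 ^ k < f x / l0 then (2 ^ k) powr d else 0))"
          using elim by (intro mult_left_mono) auto
        also have "\<dots> = f x + (\<Sum>k<K. a * ?G k x)"
          by (simp add: sum_distrib_left algebra_simps if_distrib cong: if_cong)
        finally have "ennreal (f x * min (f x / l0) (2 ^ K) powr d) \<le> ennreal (f x + (\<Sum>k<K. a * ?G k x))"
          by (rule ennreal_leI)
        also have "\<dots> = ennreal (f x) + (\<Sum>k<K. ennreal (a * ?G k x))"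
          using elim a by (subst ennreal_plus) (auto intro!: sum_nonneg simp: sum_ennreal)
        finally show ?case .
      qed
    qed
    also have "\<dots> = ennreal T + (\<Sum>k<K. \<integral>\<^sup>+x. ennreal (a * ?G k x) \<partial>?M)"
      by (subst nn_integral_add) (auto simp: T(2) nn_integral_sum)
    also have "\<dots> \<le> ennreal T + (\<Sum>k<K. \<integral>\<^sup>+x. ennreal (a * K1 * l0 * ?H k x) \<partial>?M)"
    proof (intro add_left_mono sum_mono)
      fix k
      have lk: "0 < 2 ^ k * l0" using l0 by simp
      have Tk: "T < b * (2 ^ k * l0) * D ^ ?n"
      proof -
        have "b * (2 ^ k * l0) * D ^ ?n = 2 ^ k * (2 * T)" using b R' by (simp add: l0_def field_simps)
        moreover have "1 * (2 * T) \<le> 2 ^ k * (2 * T)" using T(1) by (intro mult_right_mono) auto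
        ultimately show ?thesis using T(1) by linarith
      qed
      have "(\<integral>\<^sup>+x. ennreal (a * ?G k x) \<partial>?M)
          = (\<integral>\<^sup>+x. ennreal (a * (2 ^ k) powr d) * (ennreal (f x) * indicator {x. 2 ^ k * l0 < f x} x) \<partial>?M)"
      proof (intro nn_integral_cong)
        fix x
        have "2 ^ k < f x / l0 \<longleftrightarrow> 2 ^ k * l0 < f x" using l0 by (simp add: field_simps)
        then show "ennreal (a * ?G k x) = ennreal (a * (2 ^ k) powr d) * (ennreal (f x) * indicator {x. 2 ^ k * l0 < f x} x)"
          using a by (auto simp: indicator_def ennreal_mult''[symmetric] ennreal_mult'[symmetric] mult_ac)
      qed
      also have "\<dots> = ennreal (a * (2 ^ k) powr d) * (\<integral>\<^sup>+x\<in>{x. 2 ^ k * l0 < f x}. ennreal (f x) \<partial>?M)"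
        by (rule nn_integral_cmult) measurable
      also have "\<dots> \<le> ennreal (a * (2 ^ k) powr d) * (ennreal (K1 * (2 ^ k * l0)) * emeasure ?M {x\<in>S. b * (2 ^ k * l0) < C * f x})"
        unfolding K1_def b_def
        by (intro mult_left_mono reverse_weak_type[OF R A T(2) lk]) (use Tk in \<open>auto simp: b_def\<close>)
      also have "\<dots> = ennreal (a * K1 * l0 * (2 ^ k) powr (1 + d)) * emeasure ?M {x\<in>S. b * (2 ^ k * l0) < C * f x}"
        using a K1 l0 by (simp add: mult.assoc[symmetric] ennreal_mult[symmetric]) (simp add: powr_add mult_ac)
      also have "\<dots> = (\<integral>\<^sup>+x. ennreal (a * K1 * l0 * (2 ^ k) powr (1 + d)) * indicator {x\<in>S. b * (2 ^ k * l0) < C * f x} x \<partial>?M)"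
      proof (rule nn_integral_cmult_indicator[symmetric])
        have "{x\<in>space ?M. b * (2 ^ k * l0) < C * f x} \<in> sets ?M" by measurable
        then show "{x\<in>S. b * (2 ^ k * l0) < C * f x} \<in> sets ?M" using R'(1) by (simp add: space_restrict_space)
      qed
      also have "\<dots> \<le> (\<integral>\<^sup>+x. ennreal (a * K1 * l0 * ?H k x) \<partial>?M)"
      proof (intro nn_integral_mono_AE)
        show "AE x in ?M. ennreal (a * K1 * l0 * (2 ^ k) powr (1 + d)) * indicator {x\<in>S. b * (2 ^ k * l0) < C * f x} x
          \<le> ennreal (a * K1 * l0 * ?H k x)"
          using A'(3)
        proof eventually_elim
          case (elim x)
          have "2 ^ k < C2 * (f x / l0)" if "b * (2 ^ k * l0) < C * f x"
          proof -
            have "2 ^ k * l0 < C / b * f x" using that b by (simp add: field_simps)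
            also have "\<dots> \<le> C2 * f x" using C2 elim by (intro mult_right_mono) auto
            finally show ?thesis using l0 by (simp add: field_simps)
          qed
          then show ?case by (auto simp: indicator_def)
        qed
      qed
      finally show "(\<integral>\<^sup>+x. ennreal (a * ?G k x) \<partial>?M) \<le> (\<integral>\<^sup>+x. ennreal (a * K1 * l0 * ?H k x) \<partial>?M)" .
    qed
    also have "(\<Sum>k<K. \<integral>\<^sup>+x. ennreal (a * K1 * l0 * ?H k x) \<partial>?M) = (\<integral>\<^sup>+x. (\<Sum>k<K. ennreal (a * K1 * l0 * ?H k x)) \<partial>?M)"
      by (rule nn_integral_sum[symmetric]) measurable
    also have "\<dots> \<le> (\<integral>\<^sup>+x. ennreal (1 / 2) * ennreal (f x * min (f x / l0) (2 ^ K) powr d) \<partial>?M)"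
    proof (intro nn_integral_mono_AE)
      show "AE x in ?M. (\<Sum>k<K. ennreal (a * K1 * l0 * ?H k x)) \<le> ennreal (1 / 2) * ennreal (f x * min (f x / l0) (2 ^ K) powr d)"
        using A'(3)
      proof eventually_elim
        case (elim x)
        let ?s = "f x / l0"
        have s: "0 \<le> ?s" using elim l0 by simp
        have q: "2 powr (1 + d) / (2 powr (1 + d) - 1) \<le> (2::real)"
        proof -
          have "2 powr 1 \<le> 2 powr (1 + d)" using d by (intro powr_mono) auto
          then show ?thesis by (simp add: field_simps)
        qed
        have "(\<Sum>k<K. ?H k x) \<le> 2 powr (1 + d) / (2 powr (1 + d) - 1) * min (C2 * ?s) (2 ^ K) powr (1 + d)"
          using d s C2 by (intro dyadic_sum_le mult_nonneg_nonneg) auto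
        also have "\<dots> \<le> 2 * (C2\<^sup>2 * (?s * min ?s (2 ^ K) powr d))"
        proof (intro mult_mono q)
          have m: "0 \<le> min ?s (2 ^ K)" using s by simp
          have "min (C2 * ?s) (2 ^ K) \<le> C2 * min ?s (2 ^ K)"
          proof -
            have "2 ^ K \<le> C2 * 2 ^ K" using C2(2) by simp
            moreover have "C2 * min ?s (2 ^ K) = min (C2 * ?s) (C2 * 2 ^ K)"
              using C2(2) by (simp add: min_mult_distrib_left)
            ultimately show ?thesis by linarith
          qed
          moreover have "0 \<le> C2 * ?s" using s C2 by (intro mult_nonneg_nonneg) auto
          ultimately have "min (C2 * ?s) (2 ^ K) powr (1 + d) \<le> (C2 * min ?s (2 ^ K)) powr (1 + d)"
            using d by (intro powr_mono2) auto
          also have "\<dots> = C2 powr (1 + d) * (min ?s (2 ^ K) * min ?s (2 ^ K) powr d)"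
            using C2 m by (simp add: powr_mult powr_add)
          also have "\<dots> \<le> C2\<^sup>2 * (?s * min ?s (2 ^ K) powr d)"
          proof (intro mult_mono mult_right_mono)
            have "C2 powr (1 + d) \<le> C2 powr 2" using C2 d by (intro powr_mono) auto
            then show "C2 powr (1 + d) \<le> C2\<^sup>2" using C2 by simp
          qed (use s in auto)
          finally show "min (C2 * ?s) (2 ^ K) powr (1 + d) \<le> C2\<^sup>2 * (?s * min ?s (2 ^ K) powr d)" .
        qed auto
        finally have "a * K1 * l0 * (\<Sum>k<K. ?H k x) \<le> a * K1 * l0 * (2 * (C2\<^sup>2 * (?s * min ?s (2 ^ K) powr d)))"
          using a K1 l0 by (intro mult_left_mono) auto
        also have "\<dots> = (a * K1 * (2 * C2\<^sup>2)) * (f x * min ?s (2 ^ K) powr d)"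
          using l0 by simp
        also have "\<dots> \<le> 1 / 2 * (f x * min ?s (2 ^ K) powr d)"
          using small elim unfolding a_def K1_def by (intro mult_right_mono) auto
        finally have "ennreal (a * K1 * l0 * (\<Sum>k<K. ?H k x)) \<le> ennreal (1 / 2 * (f x * min ?s (2 ^ K) powr d))"
          by (rule ennreal_leI)
        moreover have "(\<Sum>k<K. ennreal (a * K1 * l0 * ?H k x)) = ennreal (a * K1 * l0 * (\<Sum>k<K. ?H k x))"
          using a K1 l0 by (subst sum_ennreal) (auto simp: sum_distrib_left)
        ultimately show ?case using elim by (simp only: ennreal_mult'[symmetric] ennreal_mult''[symmetric])
      qed
    qed
    also have "\<dots> = ennreal (1 / 2) * Y K" unfolding Y_def by (rule nn_integral_cmult) measurable
    finally have le: "Y K \<le> ennreal T + ennreal (1 / 2) * Y K" by simp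
    obtain y where y: "Y K = ennreal y" "0 \<le> y" using Yfin[of K] by (cases "Y K") auto
    have "ennreal (1 / 2) * ennreal y = ennreal (1 / 2 * y)"
      by (rule ennreal_mult[symmetric]) (use y in auto)
    moreover have "ennreal T + ennreal (1 / 2 * y) = ennreal (T + 1 / 2 * y)"
      by (rule ennreal_plus[symmetric]) (use y T(1) in auto)
    ultimately have "ennreal y \<le> ennreal (T + 1 / 2 * y)" using le y by simp
    then have "y \<le> T + 1 / 2 * y" using y T(1) by (subst (asm) ennreal_le_iff) auto
    then show ?thesis using y by (simp add: ennreal_leI)
  qed
  have lim: "(\<integral>\<^sup>+x. ennreal (f x * (f x / l0) powr d) \<partial>?M) \<le> ennreal (2 * T)"
  proof -
    have "(\<integral>\<^sup>+x. ennreal (f x * (f x / l0) powr d) \<partial>?M)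
      \<le> (\<integral>\<^sup>+x. (SUP K. ennreal (f x * min (f x / l0) (2 ^ K) powr d)) \<partial>?M)"
    proof (intro nn_integral_mono)
      fix x
      obtain K :: nat where "f x / l0 < 2 ^ K" using real_arch_pow[of 2 "f x / l0"] by auto
      then have "min (f x / l0) (2 ^ K) = f x / l0" by simp
      then show "ennreal (f x * (f x / l0) powr d) \<le> (SUP K. ennreal (f x * min (f x / l0) (2 ^ K) powr d))"
        by (metis (no_types, lifting) SUP_upper UNIV_I)
    qed
    also have "\<dots> = (SUP K. Y K)"
      unfolding Y_def
    proof (rule nn_integral_monotone_convergence_SUP_AE)
      fix K
      show "AE x in ?M. ennreal (f x * min (f x / l0) (2 ^ K) powr d) \<le> ennreal (f x * min (f x / l0) (2 ^ Suc K) powr d)"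
        using A'(3)
      proof eventually_elim
        case (elim x)
        have "min (f x / l0) (2 ^ K) powr d \<le> min (f x / l0) (2 ^ Suc K) powr d"
          using elim l0 d by (intro powr_mono2 min.mono) auto
        then show ?case using elim by (intro ennreal_leI mult_left_mono) auto
      qed
    qed measurable
    also have "\<dots> \<le> ennreal (2 * T)" by (intro SUP_least Ybd)
    finally show ?thesis .
  qed
  have main: "(\<integral>\<^sup>+x. ennreal (f x powr (1 + d)) \<partial>?M) \<le> ennreal (l0 powr d * (2 * T))"
  proof -
    have "(\<integral>\<^sup>+x. ennreal (f x powr (1 + d)) \<partial>?M) = (\<integral>\<^sup>+x. ennreal (l0 powr d) * ennreal (f x * (f x / l0) powr d) \<partial>?M)"
    proof (intro nn_integral_cong_AE)
      show "AE x in ?M. ennreal (f x powr (1 + d)) = ennreal (l0 powr d) * ennreal (f x * (f x / l0) powr d)"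
        using A'(3)
      proof eventually_elim
        case (elim x)
        have "f x powr (1 + d) = l0 powr d * (f x * (f x / l0) powr d)"
          using elim l0 by (simp add: powr_add powr_divide)
        then show ?case using elim by (simp add: ennreal_mult)
      qed
    qed
    also have "\<dots> = ennreal (l0 powr d) * (\<integral>\<^sup>+x. ennreal (f x * (f x / l0) powr d) \<partial>?M)"
      by (rule nn_integral_cmult) measurable
    also have "\<dots> \<le> ennreal (l0 powr d) * ennreal (2 * T)" by (intro mult_left_mono lim) auto
    finally show ?thesis using T(1) by (simp add: ennreal_mult)
  qed
  show ?thesis using T(3) A'(3)
  proof eventually_elim
    case (elim y)
    have "l0 powr d * (2 * T) \<le> (2 * C / b * f y) powr d * (2 * (C * D ^ ?n * f y))"
    proof (intro mult_mono powr_mono2)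
      show "l0 \<le> 2 * C / b * f y" unfolding l0_def using elim b R' by (simp add: field_simps)
    qed (use elim l0 d T(1) in auto)
    also have "\<dots> = 2 * C * (2 * C / b) powr d * D ^ ?n * f y powr (1 + d)"
      using elim b A'(1) by (simp add: powr_mult powr_add powr_divide)
    finally show ?case using main by (meson ennreal_leI order_trans)
  qed
qed

section \<open>The maximal function of an \<open>A\<^sub>1\<close> measure\<close>

lemma borel_measurable_indicator_ball [measurable, simp]:
  "(indicator (ball z r) :: 'a::euclidean_space \<Rightarrow> ennreal) \<in> borel_measurable (lebesgue_on S)"
  by (intro measurable_restrict_space1 borel_measurable_indicator) auto

lemma ball_mass_lower:
  fixes S :: "'a::euclidean_space set"
  assumes R: "regular_set S c D" and z: "z \<in> S" and r: "0 < r" "r \<le> D" and B: "0 \<le> B"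
    and g: "AE y in lebesgue_on S. y \<in> ball z r \<longrightarrow> B \<le> g y"
  shows "ennreal (B * (c * r ^ DIM('a))) \<le> ball_mass S g z r"
proof -
  note R' = regular_setD[OF R]
  have "ennreal (B * (c * r ^ DIM('a))) = ennreal B * ennreal (c * r ^ DIM('a))"
    using B R' r by (intro ennreal_mult) auto
  also have "\<dots> \<le> ennreal B * emeasure (lebesgue_on S) (S \<inter> ball z r)"
    using R' z r by (intro mult_left_mono) auto
  also have "\<dots> = (\<integral>\<^sup>+x. ennreal B * indicator (S \<inter> ball z r) x \<partial>lebesgue_on S)"
    using R'(1) by (intro nn_integral_cmult_indicator[symmetric]) auto
  also have "\<dots> \<le> ball_mass S g z r"
    unfolding ball_mass_def
  proof (intro nn_integral_mono_AE)
    show "AE x in lebesgue_on S. ennreal B * indicator (S \<inter> ball z r) x \<le> ennreal (g x) * indicator (ball z r) x"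
      using g by eventually_elim (auto simp: indicator_def ennreal_leI)
  qed
  finally show ?thesis .
qed

lemma ball_mass_large:
  fixes S :: "'a::euclidean_space set"
  assumes R: "regular_set S c D" and z: "z \<in> S" and r: "D \<le> r"
  shows "ball_mass S v z r = (\<integral>\<^sup>+x. ennreal (v x) \<partial>lebesgue_on S)"
  unfolding ball_mass_def
proof (intro nn_integral_cong)
  fix x assume "x \<in> space (lebesgue_on S)"
  then have "x \<in> ball z r" using regular_setD(5)[OF R z] r by (auto simp: space_restrict_space)
  then show "ennreal (v x) * indicator (ball z r) x = ennreal (v x)" by simp
qed

lemma ball_mass_le_total: "ball_mass S v z r \<le> (\<integral>\<^sup>+x. ennreal (v x) \<partial>lebesgue_on S)"
  unfolding ball_mass_def by (intro nn_integral_mono) (auto simp: indicator_def)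

lemma ball_mass_finite:
  assumes "regular_set S c D" "A1_on S C v"
  shows "ball_mass S v z r < \<infinity>"
proof -
  obtain T where "(\<integral>\<^sup>+x. ennreal (v x) \<partial>lebesgue_on S) = ennreal T"
    using A1_on_total[OF assms] by metis
  then show ?thesis using ball_mass_le_total[of S v z r] by (simp add: le_less_trans)
qed

text \<open>
  By the \<open>A\<^sub>1\<close> condition \<open>v\<close> dominates, on the small ball, its average over the large one.
\<close>

lemma A1_on_doubling:
  fixes S :: "'a::euclidean_space set"
  assumes R: "regular_set S c D" and A: "A1_on S C v" and z: "z \<in> S" and r: "0 < r" "r \<le> D"
  shows "ball_mass S v z (5 * r) \<le> ennreal (C * 5 ^ DIM('a) / c) * ball_mass S v z r"
proof -
  let ?n = "DIM('a)"
  note R' = regular_setD[OF R] note A' = A1_onD[OF A]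
  obtain B where B: "ball_mass S v z (5 * r) = ennreal B" "0 \<le> B"
    using ball_mass_finite[OF R A, of z "5 * r"] by (cases "ball_mass S v z (5 * r)") auto
  have "AE y in lebesgue_on S. y \<in> ball z r \<longrightarrow> B / (C * (5 * r) ^ ?n) \<le> v y"
    using A'(3,4)
  proof eventually_elim
    case (elim y)
    show ?case
    proof
      assume "y \<in> ball z r"
      then have "y \<in> ball z (5 * r)" using r by auto
      then have "ennreal B \<le> ennreal (C * (5 * r) ^ ?n * v y)"
        using elim(2)[rule_format, of z "5 * r"] z r unfolding B(1) by auto
      then have "B \<le> C * (5 * r) ^ ?n * v y" using elim A'(1) r by (subst (asm) ennreal_le_iff) auto
      then show "B / (C * (5 * r) ^ ?n) \<le> v y" using A'(1) r by (simp add: field_simps)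
    qed
  qed
  then have *: "ennreal (B / (C * (5 * r) ^ ?n) * (c * r ^ ?n)) \<le> ball_mass S v z r"
    using B A'(1) r by (intro ball_mass_lower[OF R z]) auto
  have "ennreal B = ennreal (C * 5 ^ ?n / c) * ennreal (B / (C * (5 * r) ^ ?n) * (c * r ^ ?n))"
    using B A'(1) r R' by (subst ennreal_mult[symmetric]) (auto simp: power_mult_distrib field_simps)
  also have "\<dots> \<le> ennreal (C * 5 ^ ?n / c) * ball_mass S v z r"
    by (intro mult_left_mono *) auto
  finally show ?thesis using B by simp
qed

text \<open>
  The set on which the uncentred maximal function of \<open>F\<close> with respect to the measure \<open>v dx\<close> exceeds
  \<open>l\<close>. Being a union of open balls it is measurable.
\<close>

definition maximal_level :: "'a::euclidean_space set \<Rightarrow> real \<Rightarrow> ('a \<Rightarrow> real) \<Rightarrow> ('a \<Rightarrow> real) \<Rightarrow> real \<Rightarrow> 'a set" where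
  "maximal_level S D v F l = (\<Union>(z, r)\<in>{(z, r). z \<in> S \<and> 0 < r \<and> r \<le> D \<and>
     ennreal l * ball_mass S v z r < ball_mass S (\<lambda>x. F x * v x) z r}. ball z r)"

lemma open_maximal_level [simp]: "open (maximal_level S D v F l)"
  unfolding maximal_level_def by auto

lemma weak_type:
  fixes S :: "'a::euclidean_space set"
  assumes R: "regular_set S c D" and A: "A1_on S C v" and l: "0 < l"
    and F: "F \<in> borel_measurable (lebesgue_on S)"
  shows "emeasure (density (lebesgue_on S) (\<lambda>x. ennreal (v x))) (S \<inter> maximal_level S D v F l)
    \<le> ennreal (C * 5 ^ DIM('a) / c / l) * (\<integral>\<^sup>+x. ennreal (F x * v x) \<partial>lebesgue_on S)"
proof -
  let ?M = "lebesgue_on S"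
  let ?nu = "density ?M (\<lambda>x. ennreal (v x))"
  let ?N = "density ?M (\<lambda>x. ennreal (F x * v x))"
  note R' = regular_setD[OF R] note A' = A1_onD[OF A]
  have S: "S \<in> sets lebesgue" by (rule R')
  have v[measurable]: "v \<in> borel_measurable ?M" by (rule A')
  note F[measurable]
  let ?K = "{(z, r). z \<in> S \<and> 0 < r \<and> r \<le> D \<and> ennreal l * ball_mass S v z r < ball_mass S (\<lambda>x. F x * v x) z r}"
  have "maximal_level S D v F l \<subseteq> (\<Union>i\<in>?K. ball (fst i) (snd i))"
    by (auto simp: maximal_level_def)
  moreover have "0 < snd i \<and> snd i \<le> D" if "i \<in> ?K" for i using that by auto
  ultimately obtain I where I: "countable I" "I \<subseteq> ?K"
    "pairwise (\<lambda>i j. disjnt (ball (fst i) (snd i)) (ball (fst j) (snd j))) I"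
    "maximal_level S D v F l \<subseteq> (\<Union>i\<in>I. ball (fst i) (5 * snd i))"
    by (rule Vitali_covering_lemma_balls)
  have "emeasure ?nu (S \<inter> maximal_level S D v F l) \<le> ennreal (C * 5 ^ DIM('a) / c / l) * emeasure ?N S"
  proof (rule emeasure_cover_le[of I "\<lambda>i. S \<inter> ball (fst i) (5 * snd i)" _ "\<lambda>i. S \<inter> ball (fst i) (snd i)"])
    show "disjoint_family_on (\<lambda>i. S \<inter> ball (fst i) (snd i)) I"
      using I(3) by (force simp: disjoint_family_on_def pairwise_def disjnt_def)
    show "S \<inter> maximal_level S D v F l \<subseteq> (\<Union>i\<in>I. S \<inter> ball (fst i) (5 * snd i))" using I(4) by auto
    show "S \<in> sets ?N" using S by (simp add: sets_restrict_space_iff)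
    fix i assume "i \<in> I"
    then have i: "i \<in> ?K" using I(2) by blast
    obtain z r where zr: "i = (z, r)" by (cases i)
    have z: "z \<in> S" "0 < r" "r \<le> D" and less: "ennreal l * ball_mass S v z r < ball_mass S (\<lambda>x. F x * v x) z r"
      using i zr by auto
    have "ball_mass S v z (5 * r) \<le> ennreal (C * 5 ^ DIM('a) / c) * ball_mass S v z r"
      using A1_on_doubling[OF R A] z by auto
    also have "\<dots> = ennreal (C * 5 ^ DIM('a) / c / l) * (ennreal l * ball_mass S v z r)"
      using l A'(1) R' by (simp add: mult.assoc[symmetric] ennreal_mult[symmetric])
    also have "\<dots> \<le> ennreal (C * 5 ^ DIM('a) / c / l) * ball_mass S (\<lambda>x. F x * v x) z r"
      using less by (intro mult_left_mono) auto
    finally show "emeasure ?nu (S \<inter> ball (fst i) (5 * snd i))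
       \<le> ennreal (C * 5 ^ DIM('a) / c / l) * emeasure ?N (S \<inter> ball (fst i) (snd i))"
      using zr S by (simp add: ball_mass_eq_density)
  qed (use I(1) S in auto)
  also have "emeasure ?N S = (\<integral>\<^sup>+x. ennreal (F x * v x) \<partial>?M)"
    using S by (subst emeasure_density) (auto simp: sets_restrict_space_iff indicator_def space_restrict_space intro!: nn_integral_cong)
  finally show ?thesis .
qed

text \<open>
  Values of \<open>F\<close> below \<open>l / 2\<close> contribute at most \<open>l / 2\<close> to an average, so they can be dropped at the
  price of halving the level. This localised form yields the strong type inequality.
\<close>

lemma weak_type_truncated:
  fixes S :: "'a::euclidean_space set"
  assumes R: "regular_set S c D" and A: "A1_on S C v" and l: "0 < l"
    and F: "F \<in> borel_measurable (lebesgue_on S)" "\<And>x. 0 \<le> F x"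
  shows "emeasure (density (lebesgue_on S) (\<lambda>x. ennreal (v x))) (S \<inter> maximal_level S D v F l)
    \<le> ennreal (2 * C * 5 ^ DIM('a) / c / l) * (\<integral>\<^sup>+x. ennreal ((if l < 2 * F x then F x else 0) * v x) \<partial>lebesgue_on S)"
proof -
  let ?M = "lebesgue_on S"
  let ?F = "\<lambda>x. if l < 2 * F x then F x else 0"
  note A' = A1_onD[OF A]
  have v[measurable]: "v \<in> borel_measurable ?M" by (rule A')
  note F(1)[measurable]
  have "maximal_level S D v F l \<subseteq> maximal_level S D v ?F (l / 2)"
  proof -
    have "ennreal (l / 2) * ball_mass S v z r < ball_mass S (\<lambda>x. ?F x * v x) z r"
      if "ennreal l * ball_mass S v z r < ball_mass S (\<lambda>x. F x * v x) z r" for z r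
    proof -
      obtain B where B: "ball_mass S v z r = ennreal B" "0 \<le> B"
        using ball_mass_finite[OF R A, of z r] by (cases "ball_mass S v z r") auto
      have "ball_mass S (\<lambda>x. F x * v x) z r \<le> (\<integral>\<^sup>+x. ennreal (?F x * v x) * indicator (ball z r) x
          + ennreal (l / 2) * (ennreal (v x) * indicator (ball z r) x) \<partial>?M)"
        unfolding ball_mass_def
      proof (intro nn_integral_mono_AE)
        show "AE x in ?M. ennreal (F x * v x) * indicator (ball z r) x \<le> ennreal (?F x * v x) * indicator (ball z r) x
          + ennreal (l / 2) * (ennreal (v x) * indicator (ball z r) x)"
          using A'(3)
        proof eventually_elim
          case (elim x)
          have "F x * v x \<le> (?F x + l / 2) * v x" using elim l by (intro mult_right_mono) auto
          then have "ennreal (F x * v x) \<le> ennreal (?F x * v x + l / 2 * v x)"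
            by (intro ennreal_leI) (simp add: algebra_simps)
          also have "\<dots> = ennreal (?F x * v x) + ennreal (l / 2 * v x)"
            using elim l F(2)[of x] by (intro ennreal_plus) auto
          also have "ennreal (l / 2 * v x) = ennreal (l / 2) * ennreal (v x)"
            using elim l by (intro ennreal_mult) auto
          finally show ?case by (auto simp: indicator_def)
        qed
      qed
      also have "\<dots> = ball_mass S (\<lambda>x. ?F x * v x) z r + ennreal (l / 2) * ball_mass S v z r"
        unfolding ball_mass_def
        by (subst nn_integral_add, measurable) (subst nn_integral_cmult, measurable)
      finally have "ennreal l * ennreal B < ball_mass S (\<lambda>x. ?F x * v x) z r + ennreal (l / 2) * ennreal B"
        using that B by (simp add: less_le_trans)
      moreover have "ennreal l * ennreal B = ennreal (l / 2) * ennreal B + ennreal (l / 2) * ennreal B"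
        using l B by (simp add: ennreal_mult[symmetric] ennreal_plus[symmetric] del: ennreal_plus)
      ultimately have "ennreal (l / 2) * ennreal B + ennreal (l / 2) * ennreal B
          < ennreal (l / 2) * ennreal B + ball_mass S (\<lambda>x. ?F x * v x) z r" by (simp add: add.commute)
      then show ?thesis unfolding B by (meson add_left_mono not_le)
    qed
    then show ?thesis unfolding maximal_level_def by (intro UN_mono) auto
  qed
  then have "emeasure (density ?M (\<lambda>x. ennreal (v x))) (S \<inter> maximal_level S D v F l)
      \<le> emeasure (density ?M (\<lambda>x. ennreal (v x))) (S \<inter> maximal_level S D v ?F (l / 2))"
    using regular_setD(1)[OF R] by (intro emeasure_mono) (auto simp: sets_restrict_space_iff borel_open)
  also have "\<dots> \<le> ennreal (C * 5 ^ DIM('a) / c / (l / 2)) * (\<integral>\<^sup>+x. ennreal (?F x * v x) \<partial>?M)"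
    using l by (intro weak_type[OF R A]) auto
  finally show ?thesis by (simp add: mult_ac)
qed

lemma powr_diff_1: "0 \<le> (x::real) \<Longrightarrow> x * x powr (k - 1) = x powr k"
  by (cases "x = 0") (simp_all add: powr_diff)

text \<open>
  Boundedness of the maximal operator on \<open>L\<^bsup>\<kappa>\<^esup>(v dx)\<close>, phrased with a real-valued majorant \<open>G\<close> of the
  maximal function instead of the extended real supremum. The majorant takes the values \<open>2 ^ j\<close>, so that
  the Marcinkiewicz argument becomes a sum over dyadic levels; levels below \<open>1\<close> are not resolved,
  which costs the summand \<open>T\<close>.
\<close>

proposition maximal_majorant:
  fixes S :: "'a::euclidean_space set"
  assumes R: "regular_set S c D" and A: "A1_on S C v" and k: "1 < \<kappa>"
    and T: "(\<integral>\<^sup>+x. ennreal (v x) \<partial>lebesgue_on S) = ennreal T"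
    and F: "F \<in> borel_measurable (lebesgue_on S)" "\<And>x. 0 \<le> F x"
    and Fint: "(\<integral>\<^sup>+x. ennreal (F x powr \<kappa> * v x) \<partial>lebesgue_on S) < \<infinity>"
  obtains G where "G \<in> borel_measurable (lebesgue_on S)" "\<And>x. 0 \<le> G x"
    "AE y in lebesgue_on S. \<forall>z\<in>S. \<forall>r>0. y \<in> ball z r \<longrightarrow>
       ball_mass S (\<lambda>x. F x * v x) z r \<le> ennreal (G y) * ball_mass S v z r"
    "(\<integral>\<^sup>+x. ennreal (G x powr \<kappa> * v x) \<partial>lebesgue_on S)
      \<le> ennreal T + ennreal (2 powr \<kappa> * (2 * C * 5 ^ DIM('a) / c) * (2 powr (\<kappa> - 1) / (2 powr (\<kappa> - 1) - 1)) * 2 powr (\<kappa> - 1)) *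
        (\<integral>\<^sup>+x. ennreal (F x powr \<kappa> * v x) \<partial>lebesgue_on S)"
proof -
  let ?n = "DIM('a)"
  let ?M = "lebesgue_on S"
  let ?nu = "density ?M (\<lambda>x. ennreal (v x))"
  note R' = regular_setD[OF R] note A' = A1_onD[OF A]
  have v[measurable]: "v \<in> borel_measurable ?M" by (rule A')
  note F(1)[measurable]
  define E where "E j = maximal_level S D v F (2 ^ j)" for j :: nat
  define C1 where "C1 = 2 * C * 5 ^ ?n / c"
  have C1: "0 \<le> C1" using A'(1) R' by (simp add: C1_def)
  define c2 where "c2 = 2 powr (\<kappa> - 1) / (2 powr (\<kappa> - 1) - 1)"
  have "1 < 2 powr (\<kappa> - 1)" using k by simp
  then have c2: "0 \<le> c2" unfolding c2_def by (intro divide_nonneg_nonneg) linarith+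
  have SE: "S \<inter> E j \<in> sets ?M" for j
    using R'(1) by (auto simp: E_def sets_restrict_space_iff borel_open)
  have nuE: "emeasure ?nu (S \<inter> E j) \<le> ennreal (C1 / 2 ^ j) * (\<integral>\<^sup>+x. ennreal ((if 2 ^ j < 2 * F x then F x else 0) * v x) \<partial>?M)" for j
    unfolding E_def C1_def using F by (intro weak_type_truncated[OF R A]) auto
  have Fv: "(\<integral>\<^sup>+x. ennreal (F x * v x) \<partial>?M) < \<infinity>"
  proof -
    have "(\<integral>\<^sup>+x. ennreal (F x * v x) \<partial>?M) \<le> (\<integral>\<^sup>+x. ennreal (v x) + ennreal (F x powr \<kappa> * v x) \<partial>?M)"
    proof (intro nn_integral_mono_AE)
      show "AE x in ?M. ennreal (F x * v x) \<le> ennreal (v x) + ennreal (F x powr \<kappa> * v x)"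
        using A'(3)
      proof eventually_elim
        case (elim x)
        have "F x \<le> 1 + F x powr \<kappa>"
        proof (cases "F x \<le> 1")
          case False
          then have "F x powr 1 \<le> F x powr \<kappa>" using k by (intro powr_mono) auto
          then show ?thesis using False by simp
        qed (use powr_ge_zero[of "F x" \<kappa>] in linarith)
        then have "F x * v x \<le> (1 + F x powr \<kappa>) * v x" using elim by (intro mult_right_mono) auto
        then have "ennreal (F x * v x) \<le> ennreal (v x + F x powr \<kappa> * v x)" by (intro ennreal_leI) (simp add: algebra_simps)
        then show ?case using elim by simp
      qed
    qed
    also have "\<dots> = ennreal T + (\<integral>\<^sup>+x. ennreal (F x powr \<kappa> * v x) \<partial>?M)"
      by (subst nn_integral_add) (auto simp: T)
    also have "\<dots> < \<infinity>" using Fint by simp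
    finally show ?thesis .
  qed
  have null: "AE y in ?M. \<exists>j. y \<notin> E j"
  proof -
    obtain B where B: "(\<integral>\<^sup>+x. ennreal (F x * v x) \<partial>?M) = ennreal B" "0 \<le> B"
      using Fv by (cases "\<integral>\<^sup>+x. ennreal (F x * v x) \<partial>?M") auto
    let ?Z = "\<Inter>j. S \<inter> E j"
    have Z: "?Z \<in> sets ?M" using SE by (intro sets.countable_INT) auto
    have le: "emeasure ?M ?Z \<le> ennreal (C1 * B / 2 ^ j)" for j
    proof -
      have "emeasure ?M ?Z \<le> emeasure ?M (S \<inter> E j)" by (rule emeasure_mono) (use SE in auto)
      also have "\<dots> = (\<integral>\<^sup>+x. indicator (S \<inter> E j) x \<partial>?M)" using SE by simp
      also have "\<dots> \<le> (\<integral>\<^sup>+x\<in>S \<inter> E j. ennreal (v x) \<partial>?M)"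
      proof (intro nn_integral_mono_AE)
        show "AE x in ?M. indicator (S \<inter> E j) x \<le> ennreal (v x) * indicator (S \<inter> E j) x"
          using A'(3) by eventually_elim (auto simp: indicator_def)
      qed
      also have "\<dots> = emeasure ?nu (S \<inter> E j)" using SE by (subst emeasure_density) auto
      also note nuE
      also have "(\<integral>\<^sup>+x. ennreal ((if 2 ^ j < 2 * F x then F x else 0) * v x) \<partial>?M) \<le> (\<integral>\<^sup>+x. ennreal (F x * v x) \<partial>?M)"
      proof (intro nn_integral_mono_AE)
        show "AE x in ?M. ennreal ((if 2 ^ j < 2 * F x then F x else 0) * v x) \<le> ennreal (F x * v x)"
          using A'(3) by eventually_elim (auto intro!: ennreal_leI mult_right_mono F(2) simp: F(2))
      qed
      finally have "emeasure ?M ?Z \<le> ennreal (C1 / 2 ^ j) * ennreal B"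
        unfolding B by (meson mult_left_mono order_trans zero_le)
      then show ?thesis using B C1 by (simp add: ennreal_mult[symmetric])
    qed
    have "(\<lambda>j. ennreal (C1 * B / 2 ^ j)) \<longlonglongrightarrow> ennreal 0"
    proof (intro tendsto_ennrealI)
      have "(\<lambda>j. (C1 * B) * (1 / 2) ^ j) \<longlonglongrightarrow> (C1 * B) * 0"
        by (intro tendsto_mult tendsto_const LIMSEQ_power_zero) auto
      then show "(\<lambda>j. C1 * B / 2 ^ j) \<longlonglongrightarrow> 0" by (simp add: power_divide)
    qed
    then have "emeasure ?M ?Z \<le> ennreal 0"
      by (rule LIMSEQ_le_const) (use le in auto)
    then have "?Z \<in> null_sets ?M" using Z by auto
    then have "AE y in ?M. y \<notin> ?Z" by (rule AE_not_in)
    then show ?thesis using AE_space by eventually_elim (auto simp: space_restrict_space)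
  qed
  \<comment> \<open>The maximal function at \<open>y\<close> is at most \<open>G y\<close>, and it exceeds \<open>G y / 2\<close> unless \<open>G y = 1\<close>.\<close>
  define G where "G y = (2::real) ^ (LEAST j. y \<notin> E j)" for y
  have [measurable]: "Measurable.pred ?M (\<lambda>y. y \<notin> E j)" for j
  proof -
    have "{y \<in> space ?M. y \<in> E j} = S \<inter> E j" using R'(1) by (auto simp: space_restrict_space)
    then have "Measurable.pred ?M (\<lambda>y. y \<in> E j)" using SE by (simp add: pred_def)
    then show ?thesis by measurable
  qed
  have "(\<lambda>y. LEAST j. y \<notin> E j) \<in> measurable ?M (count_space UNIV)" by measurable
  then have Gm: "G \<in> borel_measurable ?M" unfolding G_def by measurable
  show ?thesis
  proof (rule that[OF Gm])
    show "0 \<le> G x" for x by (simp add: G_def)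
    show "AE y in ?M. \<forall>z\<in>S. \<forall>r>0. y \<in> ball z r \<longrightarrow> ball_mass S (\<lambda>x. F x * v x) z r \<le> ennreal (G y) * ball_mass S v z r"
      using null AE_space
    proof eventually_elim
      case (elim y)
      define j where "j = (LEAST j. y \<notin> E j)"
      have j: "y \<notin> E j" unfolding j_def using elim(1) by (rule LeastI_ex)
      show ?case
      proof (intro ballI allI impI)
        fix z and r :: real assume zr: "z \<in> S" "0 < r" "y \<in> ball z r"
        let ?r = "min r D"
        have "y \<in> ball z ?r" using zr elim(2) R'(5)[OF zr(1)] by (auto simp: space_restrict_space)
        then have "\<not> ennreal (2 ^ j) * ball_mass S v z ?r < ball_mass S (\<lambda>x. F x * v x) z ?r"
          using j zr R'(4) unfolding E_def maximal_level_def by force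
        then have le: "ball_mass S (\<lambda>x. F x * v x) z ?r \<le> ennreal (G y) * ball_mass S v z ?r"
          by (simp add: G_def j_def)
        show "ball_mass S (\<lambda>x. F x * v x) z r \<le> ennreal (G y) * ball_mass S v z r"
        proof (cases "r \<le> D")
          case False
          then show ?thesis
            using le ball_mass_large[OF R zr(1), of r v] ball_mass_large[OF R zr(1), of D v]
              ball_mass_large[OF R zr(1), of r "\<lambda>x. F x * v x"] ball_mass_large[OF R zr(1), of D "\<lambda>x. F x * v x"]
            by simp
        qed (use le in simp)
      qed
    qed
    have "(\<integral>\<^sup>+x. ennreal (G x powr \<kappa> * v x) \<partial>?M)
      \<le> (\<integral>\<^sup>+x. ennreal (v x) + ennreal (2 powr \<kappa>) * (\<Sum>j. ennreal ((2 ^ j) powr \<kappa>) * (ennreal (v x) * indicator (S \<inter> E j) x)) \<partial>?M)"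
    proof (intro nn_integral_mono_AE)
      show "AE x in ?M. ennreal (G x powr \<kappa> * v x) \<le> ennreal (v x) + ennreal (2 powr \<kappa>) * (\<Sum>j. ennreal ((2 ^ j) powr \<kappa>) * (ennreal (v x) * indicator (S \<inter> E j) x))"
        using null A'(3) AE_space
      proof eventually_elim
        case (elim x)
        define j where "j = (LEAST j. x \<notin> E j)"
        show ?case
        proof (cases j)
          case 0
          then have "G x = 1" by (simp add: G_def j_def)
          then show ?thesis by simp
        next
          case (Suc i)
          then have "x \<in> E i" using not_less_Least[of i "\<lambda>j. x \<notin> E j"] by (auto simp: j_def)
          then have x: "x \<in> S \<inter> E i" using elim R'(1) by (auto simp: space_restrict_space)
          have "G x = 2 * 2 ^ i" using Suc by (simp add: G_def j_def)
          then have "ennreal (G x powr \<kappa> * v x) = ennreal (2 powr \<kappa>) * (ennreal ((2 ^ i) powr \<kappa>) * (ennreal (v x) * indicator (S \<inter> E i) x))"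
            using x elim by (simp add: powr_mult ennreal_mult mult.assoc)
          also have "ennreal ((2 ^ i) powr \<kappa>) * (ennreal (v x) * indicator (S \<inter> E i) x)
            \<le> (\<Sum>j. ennreal ((2 ^ j) powr \<kappa>) * (ennreal (v x) * indicator (S \<inter> E j) x))"
            using sum_le_suminf[of "\<lambda>j. ennreal ((2 ^ j) powr \<kappa>) * (ennreal (v x) * indicator (S \<inter> E j) x)" "{i}"] by simp
          finally show ?thesis by (simp add: mult_left_mono add_increasing)
        qed
      qed
    qed
    also have "\<dots> = ennreal T + ennreal (2 powr \<kappa>) * (\<Sum>j. ennreal ((2 ^ j) powr \<kappa>) * (\<integral>\<^sup>+x. ennreal (v x) * indicator (S \<inter> E j) x \<partial>?M))"
      using SE by (subst nn_integral_add) (auto simp: T nn_integral_cmult nn_integral_suminf)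
    also have "\<dots> \<le> ennreal T + ennreal (2 powr \<kappa>) * (\<Sum>j. \<integral>\<^sup>+x. ennreal (C1 * (if 2 ^ j < 2 * F x then (2 ^ j) powr (\<kappa> - 1) else 0) * (F x * v x)) \<partial>?M)"
    proof (intro add_left_mono mult_left_mono suminf_le)
      fix j
      have "(\<integral>\<^sup>+x. ennreal (v x) * indicator (S \<inter> E j) x \<partial>?M) = emeasure ?nu (S \<inter> E j)"
        using SE by (subst emeasure_density) auto
      also note nuE
      finally have "ennreal ((2 ^ j) powr \<kappa>) * (\<integral>\<^sup>+x. ennreal (v x) * indicator (S \<inter> E j) x \<partial>?M)
        \<le> ennreal ((2 ^ j) powr \<kappa>) * (ennreal (C1 / 2 ^ j) * (\<integral>\<^sup>+x. ennreal ((if 2 ^ j < 2 * F x then F x else 0) * v x) \<partial>?M))"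
        by (intro mult_left_mono) auto
      also have "\<dots> = ennreal (C1 * (2 ^ j) powr (\<kappa> - 1)) * (\<integral>\<^sup>+x. ennreal ((if 2 ^ j < 2 * F x then F x else 0) * v x) \<partial>?M)"
      proof -
        have "(2 ^ j) powr \<kappa> * (C1 / 2 ^ j) = C1 * (2 ^ j) powr (\<kappa> - 1)" by (simp add: powr_diff)
        then show ?thesis using C1 by (simp add: mult.assoc[symmetric] ennreal_mult[symmetric])
      qed
      also have "\<dots> = (\<integral>\<^sup>+x. ennreal (C1 * (2 ^ j) powr (\<kappa> - 1)) * ennreal ((if 2 ^ j < 2 * F x then F x else 0) * v x) \<partial>?M)"
        by (rule nn_integral_cmult[symmetric]) measurable
      also have "\<dots> = (\<integral>\<^sup>+x. ennreal (C1 * (if 2 ^ j < 2 * F x then (2 ^ j) powr (\<kappa> - 1) else 0) * (F x * v x)) \<partial>?M)"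
        using C1 by (intro nn_integral_cong) (auto simp: ennreal_mult'[symmetric])
      finally show "ennreal ((2 ^ j) powr \<kappa>) * (\<integral>\<^sup>+x. ennreal (v x) * indicator (S \<inter> E j) x \<partial>?M)
        \<le> (\<integral>\<^sup>+x. ennreal (C1 * (if 2 ^ j < 2 * F x then (2 ^ j) powr (\<kappa> - 1) else 0) * (F x * v x)) \<partial>?M)" .
    qed auto
    also have "(\<Sum>j. \<integral>\<^sup>+x. ennreal (C1 * (if 2 ^ j < 2 * F x then (2 ^ j) powr (\<kappa> - 1) else 0) * (F x * v x)) \<partial>?M)
      = (\<integral>\<^sup>+x. (\<Sum>j. ennreal (C1 * (if 2 ^ j < 2 * F x then (2 ^ j) powr (\<kappa> - 1) else 0) * (F x * v x))) \<partial>?M)"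
      by (rule nn_integral_suminf[symmetric]) measurable
    also have "\<dots> \<le> (\<integral>\<^sup>+x. ennreal (C1 * c2 * 2 powr (\<kappa> - 1)) * ennreal (F x powr \<kappa> * v x) \<partial>?M)"
    proof (intro nn_integral_mono_AE)
      show "AE x in ?M. (\<Sum>j. ennreal (C1 * (if 2 ^ j < 2 * F x then (2 ^ j) powr (\<kappa> - 1) else 0) * (F x * v x)))
        \<le> ennreal (C1 * c2 * 2 powr (\<kappa> - 1)) * ennreal (F x powr \<kappa> * v x)"
        using A'(3)
      proof eventually_elim
        case (elim x)
        let ?h = "\<lambda>j::nat. if 2 ^ j < 2 * F x then (2 ^ j) powr (\<kappa> - 1) else 0"
        have Fv0: "0 \<le> F x * v x" using F(2)[of x] elim by simp
        show ?case
        proof (rule suminf_le_const)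
          fix J
          have "(\<Sum>j<J. ?h j) \<le> c2 * min (2 * F x) (2 ^ J) powr (\<kappa> - 1)"
            unfolding c2_def using k F(2)[of x] by (intro dyadic_sum_le) auto
          also have "\<dots> \<le> c2 * (2 * F x) powr (\<kappa> - 1)"
            using c2 k F(2)[of x] by (intro mult_left_mono powr_mono2) auto
          finally have "C1 * (\<Sum>j<J. ?h j) * (F x * v x) \<le> C1 * (c2 * (2 * F x) powr (\<kappa> - 1)) * (F x * v x)"
            using C1 Fv0 by (intro mult_right_mono mult_left_mono) auto
          also have "\<dots> = C1 * c2 * 2 powr (\<kappa> - 1) * (F x powr \<kappa> * v x)"
            using F(2)[of x] by (simp add: powr_mult powr_diff_1[of "F x" \<kappa>, symmetric] mult_ac)
          finally have "ennreal (C1 * (\<Sum>j<J. ?h j) * (F x * v x)) \<le> ennreal (C1 * c2 * 2 powr (\<kappa> - 1) * (F x powr \<kappa> * v x))"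
            by (rule ennreal_leI)
          moreover have "(\<Sum>j<J. ennreal (C1 * ?h j * (F x * v x))) = ennreal (C1 * (\<Sum>j<J. ?h j) * (F x * v x))"
            using C1 Fv0 by (subst sum_ennreal) (auto simp: sum_distrib_left sum_distrib_right)
          ultimately show "(\<Sum>j<J. ennreal (C1 * ?h j * (F x * v x))) \<le> ennreal (C1 * c2 * 2 powr (\<kappa> - 1)) * ennreal (F x powr \<kappa> * v x)"
            using C1 c2 by (simp add: ennreal_mult'[symmetric])
        qed auto
      qed
    qed
    also have "\<dots> = ennreal (C1 * c2 * 2 powr (\<kappa> - 1)) * (\<integral>\<^sup>+x. ennreal (F x powr \<kappa> * v x) \<partial>?M)"
      by (rule nn_integral_cmult) measurable
    finally show "(\<integral>\<^sup>+x. ennreal (G x powr \<kappa> * v x) \<partial>?M)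
      \<le> ennreal T + ennreal (2 powr \<kappa> * (2 * C * 5 ^ ?n / c) * (2 powr (\<kappa> - 1) / (2 powr (\<kappa> - 1) - 1)) * 2 powr (\<kappa> - 1)) *
        (\<integral>\<^sup>+x. ennreal (F x powr \<kappa> * v x) \<partial>?M)"
      using C1 c2 unfolding C1_def[symmetric] c2_def[symmetric]
      by (simp add: mult.assoc ennreal_mult mult_left_mono)
  qed
qed

section \<open>\<open>A\<^sub>1\<close> weights on a cube\<close>

lemma cube_eq_cbox: "cube x l = cbox (\<chi> i. x $ i - l / 2) (\<chi> i. x $ i + l / 2)"
proof -
  have "\<bar>a - b\<bar> \<le> l / 2 \<longleftrightarrow> b - l / 2 \<le> a \<and> a \<le> b + l / 2" for a b :: real by (rule abs_diff_le_iff)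
  then show ?thesis by (simp add: cube_def set_eq_iff mem_box_cart)
qed

lemma emeasure_box_translate:
  fixes l :: "real ^ 'n"
  assumes "0 \<le> t"
  shows "emeasure lborel (box l (l + (\<chi> i. t))) = ennreal (t ^ CARD('n))"
    and "emeasure lborel (cbox l (l + (\<chi> i. t))) = ennreal (t ^ CARD('n))"
proof -
  have i: "(\<chi> i. t) \<bullet> b = t" if "b \<in> Basis" for b :: "real ^ 'n"
    using that by (auto simp: Basis_vec_def inner_axis)
  have p: "(\<Prod>b\<in>(Basis :: (real ^ 'n) set). (\<chi> i. t) \<bullet> b) = t ^ CARD('n)"
    by (simp add: i cong: prod.cong)
  show "emeasure lborel (box l (l + (\<chi> i. t))) = ennreal (t ^ CARD('n))"
    using assms by (subst emeasure_lborel_box) (auto simp: inner_add_left i p)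
  show "emeasure lborel (cbox l (l + (\<chi> i. t))) = ennreal (t ^ CARD('n))"
    using assms by (subst emeasure_lborel_cbox) (auto simp: inner_add_left i p)
qed

lemma emeasure_cube:
  assumes "0 \<le> l" shows "emeasure lebesgue (cube (x :: real ^ 'n) l) = ennreal (l ^ CARD('n))"
proof -
  have "(\<chi> i. x $ i + l / 2) = (\<chi> i. x $ i - l / 2) + (\<chi> i. l)" by (simp add: vec_eq_iff)
  then show ?thesis using emeasure_box_translate(2)[OF assms] by (simp add: cube_eq_cbox)
qed

lemma sets_cube [simp]: "cube x l \<in> sets lebesgue" by (simp add: cube_eq_cbox)

lemma norm_le_card_bound:
  fixes x :: "real ^ 'n"
  assumes "\<And>i. \<bar>x $ i\<bar> \<le> t" shows "norm x \<le> real CARD('n) * t"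
proof -
  have "norm x \<le> (\<Sum>i\<in>UNIV. \<bar>x $ i\<bar>)" by (rule norm_le_l1_cart)
  also have "\<dots> \<le> (\<Sum>i\<in>(UNIV::'n set). t)" using assms by (intro sum_mono) auto
  finally show ?thesis by simp
qed

lemma regular_set_box:
  fixes a b :: "real ^ 'n"
  assumes S: "S \<in> sets lebesgue" "box a b \<subseteq> S" "S \<subseteq> cbox a b" and s: "0 < s"
    and ab: "\<And>i. s \<le> b $ i - a $ i" "\<And>i. b $ i - a $ i \<le> 2 * s"
  shows "regular_set S ((1 / (8 * real CARD('n))) ^ CARD('n)) (4 * real CARD('n) * s)"
  unfolding regular_set_def
proof (intro conjI ballI allI impI)
  let ?n = "CARD('n)"
  have n: "1 \<le> real ?n" using zero_less_card_finite[where 'a='n] by linarith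
  show "S \<in> sets lebesgue" by fact
  have "(\<chi> i. (a $ i + b $ i) / 2) \<in> box a b"
    unfolding mem_box_cart
  proof (intro allI conjI)
    fix i show "a $ i < (\<chi> i. (a $ i + b $ i) / 2) $ i" "(\<chi> i. (a $ i + b $ i) / 2) $ i < b $ i"
      using ab(1)[of i] s by auto
  qed
  then show "S \<noteq> {}" using S by auto
  show "0 < (1 / (8 * real ?n)) ^ ?n" using n by simp
  show "0 < 4 * real ?n * s" using n s by simp
  fix x assume x: "x \<in> S"
  then have xab: "a $ i \<le> x $ i" "x $ i \<le> b $ i" for i using S(3) by (auto simp: mem_box_cart)
  show "S \<subseteq> ball x (4 * real ?n * s)"
  proof
    fix y assume "y \<in> S"
    then have yab: "a $ i \<le> y $ i" "y $ i \<le> b $ i" for i using S(3) by (auto simp: mem_box_cart)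
    have "\<bar>(x - y) $ i\<bar> \<le> 2 * s" for i using xab[of i] yab[of i] ab(2)[of i] by auto
    then have "norm (x - y) \<le> real ?n * (2 * s)" by (rule norm_le_card_bound)
    also have "\<dots> < 4 * real ?n * s" using n s by simp
    finally show "y \<in> ball x (4 * real ?n * s)" by (simp add: dist_norm)
  qed
  fix r assume r: "0 < r \<and> r \<le> 4 * real ?n * s"
  define t where "t = r / (8 * real ?n)"
  have t: "0 < t" "2 * t \<le> s" using r n by (auto simp: t_def field_simps)
  \<comment> \<open>In each coordinate one moves from \<open>x\<close> towards the centre of the box, to stay inside.\<close>
  define l where "l = (\<chi> i. if x $ i \<le> (a $ i + b $ i) / 2 then x $ i else x $ i - t)"
  let ?B = "box l (l + (\<chi> i. t))"
  have B: "a $ i < y $ i \<and> y $ i < b $ i \<and> \<bar>(x - y) $ i\<bar> \<le> t" if "y \<in> ?B" for y i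
  proof -
    have "l $ i < y $ i" "y $ i < l $ i + t" using that by (auto simp: mem_box_cart)
    then show ?thesis using xab[of i] ab(1)[of i] t unfolding l_def by (auto split: if_splits)
  qed
  have sub: "?B \<subseteq> S \<inter> ball x r"
  proof
    fix y assume y: "y \<in> ?B"
    then have "y \<in> S" using B[OF y] S(2) by (auto simp: mem_box_cart subset_iff)
    moreover have "norm (x - y) \<le> real ?n * t" using B[OF y] by (intro norm_le_card_bound) auto
    then have "norm (x - y) < r" using r n by (simp add: t_def)
    ultimately show "y \<in> S \<inter> ball x r" by (simp add: dist_norm)
  qed
  have "ennreal ((1 / (8 * real ?n)) ^ ?n * r ^ DIM(real ^ 'n)) = emeasure lborel ?B"
    using t emeasure_box_translate(1)[of t l] by (simp add: t_def power_divide)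
  also have "\<dots> = emeasure lebesgue ?B" by simp
  also have "\<dots> \<le> emeasure lebesgue (S \<inter> ball x r)" using sub S(1) by (intro emeasure_mono) auto
  also have "\<dots> = emeasure (lebesgue_on S) (S \<inter> ball x r)" using S(1) by (subst emeasure_restrict_space) auto
  finally show "ennreal ((1 / (8 * real ?n)) ^ ?n * r ^ DIM(real ^ 'n)) \<le> emeasure (lebesgue_on S) (S \<inter> ball x r)" .
qed

lemma is_cube_regular:
  fixes Q0 :: "(real ^ 'n) set"
  assumes "is_cube Q0"
  obtains L where "0 < L" "Q0 \<in> sets lebesgue"
    "\<And>z. z \<in> Q0 \<Longrightarrow> Q0 \<subseteq> cube z (2 * L)"
    "\<And>z l. z \<in> Q0 \<Longrightarrow> 0 < l \<Longrightarrow> l \<le> 2 * L \<Longrightarrow>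
       regular_set (cube z l \<inter> Q0) ((1 / (8 * real CARD('n))) ^ CARD('n)) (2 * real CARD('n) * l)"
    "regular_set Q0 ((1 / (8 * real CARD('n))) ^ CARD('n)) (4 * real CARD('n) * L)"
proof -
  obtain x0 L where L: "0 < L" "Q0 = cube x0 L \<or> Q0 = interior (cube x0 L)"
    using assms by (auto simp: is_cube_def)
  define a where "a = (\<chi> i. x0 $ i - L / 2)"
  define b where "b = (\<chi> i. x0 $ i + L / 2)"
  have Q: "box a b \<subseteq> Q0" "Q0 \<subseteq> cbox a b"
    using L(2) box_subset_cbox[of a b] by (auto simp: cube_eq_cbox a_def[symmetric] b_def[symmetric] interior_cbox)
  have m: "Q0 \<in> sets lebesgue"
    using L(2) by (auto simp: cube_eq_cbox interior_cbox)
  have sub: "Q0 \<subseteq> cube z (2 * L)" if "z \<in> Q0" for z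
  proof
    fix y assume "y \<in> Q0"
    then have y: "a $ i \<le> y $ i" "y $ i \<le> b $ i" for i using Q by (auto simp: mem_box_cart)
    have z: "a $ i \<le> z $ i" "z $ i \<le> b $ i" for i using Q that by (auto simp: mem_box_cart)
    have "\<bar>y $ i - z $ i\<bar> \<le> 2 * L / 2" for i
      using y[of i] z[of i] by (auto simp: a_def b_def)
    then show "y \<in> cube z (2 * L)" by (simp add: cube_def)
  qed
  have reg: "regular_set (cube z l \<inter> Q0) ((1 / (8 * real CARD('n))) ^ CARD('n)) (2 * real CARD('n) * l)"
    if zl: "z \<in> Q0" "0 < l" "l \<le> 2 * L" for z l
  proof -
    define a' where "a' = (\<chi> i. max (z $ i - l / 2) (a $ i))"
    define b' where "b' = (\<chi> i. min (z $ i + l / 2) (b $ i))"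
    have z: "a $ i \<le> z $ i" "z $ i \<le> b $ i" for i using Q zl by (auto simp: mem_box_cart)
    have "regular_set (cube z l \<inter> Q0) ((1 / (8 * real CARD('n))) ^ CARD('n)) (4 * real CARD('n) * (l / 2))"
    proof (rule regular_set_box[of _ a' b'])
      show "cube z l \<inter> Q0 \<in> sets lebesgue" by (intro sets.Int sets_cube m)
      have "box a' b' \<subseteq> box a b" by (auto simp: mem_box_cart a'_def b'_def)
      moreover have "box a' b' \<subseteq> cube z l"
        by (simp add: subset_iff mem_box_cart a'_def b'_def cube_eq_cbox less_imp_le)
      ultimately show "box a' b' \<subseteq> cube z l \<inter> Q0" using Q by auto
      have "cube z l \<inter> cbox a b \<subseteq> cbox a' b'" by (auto simp: mem_box_cart a'_def b'_def cube_eq_cbox)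
      then show "cube z l \<inter> Q0 \<subseteq> cbox a' b'" using Q by auto
      show "l / 2 \<le> b' $ i - a' $ i" "b' $ i - a' $ i \<le> 2 * (l / 2)" for i
        using z[of i] zl by (auto simp: a'_def b'_def a_def b_def min_def max_def)
    qed (use zl in auto)
    then show ?thesis by (simp add: mult_ac)
  qed
  have "regular_set Q0 ((1 / (8 * real CARD('n))) ^ CARD('n)) (4 * real CARD('n) * L)"
    by (rule regular_set_box[of _ a b]) (use m Q L in \<open>auto simp: a_def b_def\<close>)
  then show ?thesis using that L(1) m sub reg by blast
qed

lemma A1_on_subset:
  assumes "A1_on Q C v" "S \<subseteq> Q" "S \<in> sets lebesgue" "Q \<in> sets lebesgue"
  shows "A1_on S C v"
proof -
  note A' = A1_onD[OF assms(1)]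
  have eq: "lebesgue_on S = restrict_space (lebesgue_on Q) S"
    using assms by (simp add: restrict_restrict_space Int_absorb1)
  have SQ: "S \<inter> space (lebesgue_on Q) \<in> sets (lebesgue_on Q)"
    using assms by (auto simp: space_restrict_space sets_restrict_space_iff)
  have AE: "(AE x in lebesgue_on S. P x) \<longleftrightarrow> (AE x in lebesgue_on Q. x \<in> S \<longrightarrow> P x)" for P
    unfolding eq by (rule AE_restrict_space_iff[OF SQ])
  have le: "ball_mass S v z r \<le> ball_mass Q v z r" for z r
    unfolding ball_mass_def eq nn_integral_restrict_space[OF SQ]
    by (intro nn_integral_mono) (auto simp: indicator_def)
  have m: "v \<in> borel_measurable (lebesgue_on S)"
    unfolding eq by (rule measurable_restrict_space1) (rule A'(2))
  show ?thesis unfolding A1_on_def AE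
  proof (intro conjI m A'(1))
    show "AE x in lebesgue_on Q. x \<in> S \<longrightarrow> 1 \<le> v x" using A'(3) by eventually_elim auto
    show "AE x in lebesgue_on Q. x \<in> S \<longrightarrow> (\<forall>z\<in>S. \<forall>r>0. x \<in> ball z r \<longrightarrow>
        ball_mass S v z r \<le> ennreal (C * r ^ DIM('a) * v x))"
      using A'(4) by eventually_elim (use le assms(2) in \<open>blast intro: order_trans\<close>)
  qed
qed

text \<open>
  It suffices to have the \<open>A\<^sub>1\<close> condition, for each cube separately, on the cubes with centre in a
  countable dense set whose side length is rational or maximal. Their exceptional sets can be united, and every ball
  lies in such a cube of comparable size.
\<close>

lemma A1_on_of_cubes:
  fixes Q0 :: "(real ^ 'n) set"
  assumes Q: "Q0 \<in> sets lebesgue" and L: "0 < L" "\<And>z. z \<in> Q0 \<Longrightarrow> Q0 \<subseteq> cube z (2 * L)"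
    and C: "0 < C" and v: "v \<in> borel_measurable (lebesgue_on Q0)" and v1: "AE x in lebesgue_on Q0. 1 \<le> v x"
    and cubes: "\<And>z l. z \<in> Q0 \<Longrightarrow> 0 < l \<Longrightarrow> l \<le> 2 * L \<Longrightarrow> AE y in lebesgue_on (cube z l \<inter> Q0).
       (\<integral>\<^sup>+x. ennreal (v x) \<partial>lebesgue_on (cube z l \<inter> Q0)) \<le> ennreal (C * l ^ CARD('n) * v y)"
  shows "A1_on Q0 (C * 5 ^ CARD('n)) v"
proof -
  let ?n = "CARD('n)"
  let ?M = "lebesgue_on Q0"
  obtain X where X: "countable X" "X \<subseteq> Q0" "Q0 \<subseteq> closure X" by (rule separable)
  let ?R = "{q\<in>\<rat>. 0 < q \<and> q \<le> 2 * L} \<union> {2 * L}"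
  have ctb: "countable ?R" using countable_rat by (auto intro: countable_subset)
  let ?I = "\<lambda>z l. \<integral>\<^sup>+x. ennreal (v x) * indicator (cube z l) x \<partial>?M"
  have ae: "AE y in ?M. y \<in> cube z l \<longrightarrow> ?I z l \<le> ennreal (C * l ^ ?n * v y)" if "z \<in> X" "l \<in> ?R" for z l
  proof -
    have eq: "lebesgue_on (cube z l \<inter> Q0) = restrict_space ?M (cube z l)"
      by (simp add: restrict_restrict_space[OF ] Q Int_commute)
    have sp: "cube z l \<inter> space ?M \<in> sets ?M" using Q by (auto simp: space_restrict_space sets_restrict_space_iff)
    have "AE y in restrict_space ?M (cube z l). (\<integral>\<^sup>+x. ennreal (v x) \<partial>restrict_space ?M (cube z l)) \<le> ennreal (C * l ^ ?n * v y)"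
      using cubes[of z l] that L X(2) unfolding eq by auto
    then show ?thesis by (simp only: AE_restrict_space_iff[OF sp] nn_integral_restrict_space[OF sp])
  qed
  have AE: "AE y in ?M. \<forall>z\<in>X. \<forall>l\<in>?R. y \<in> cube z l \<longrightarrow> ?I z l \<le> ennreal (C * l ^ ?n * v y)"
    using ae ctb X(1) by (simp only: AE_ball_countable) blast
  show ?thesis unfolding A1_on_def
  proof (intro conjI v v1)
    show "0 < C * 5 ^ ?n" using C by simp
    show "AE y in ?M. \<forall>z\<in>Q0. \<forall>r>0. y \<in> ball z r \<longrightarrow> ball_mass Q0 v z r \<le> ennreal (C * 5 ^ ?n * r ^ DIM(real ^ 'n) * v y)"
      using AE v1 AE_space
    proof eventually_elim
      case (elim y)
      show ?case
      proof (intro ballI allI impI)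
        fix z and r :: real assume zr: "z \<in> Q0" "0 < r" "y \<in> ball z r"
        obtain z' where z': "z' \<in> X" "dist z' z < r" using X(3) zr by (meson closure_approachable subsetD)
        \<comment> \<open>A rational side length between \<open>4 * r\<close> and \<open>5 * r\<close> compensates the displacement of the centre by up to \<open>r\<close>;
          if that is too large, the cube of side \<open>2 * L\<close> contains the domain.\<close>
        have "\<exists>l\<in>?R. l \<le> 5 * r \<and> Q0 \<inter> ball z r \<subseteq> cube z' l"
        proof (cases "5 * r \<le> 2 * L")
          case True
          obtain q where q: "q \<in> \<rat>" "4 * r < q" "q < 5 * r" using Rats_dense_in_real[of "4 * r" "5 * r"] zr by auto
          have "ball z r \<subseteq> cube z' q"
          proof
            fix x assume "x \<in> ball z r"
            then have "dist x z' \<le> q / 2" using z' q dist_triangle[of x z' z] by (auto simp: dist_commute)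
            then have "norm (x - z') \<le> q / 2" by (simp add: dist_norm)
            then have "\<bar>(x - z') $ i\<bar> \<le> q / 2" for i using component_le_norm_cart[of "x - z'" i] by linarith
            then show "x \<in> cube z' q" by (simp add: cube_def)
          qed
          then show ?thesis using q True zr by (intro bexI[of _ q]) auto
        next
          case False
          then show ?thesis using L(2)[of z'] z' X(2) by (intro bexI[of _ "2 * L"]) auto
        qed
        then obtain l where l: "l \<in> ?R" "l \<le> 5 * r" "Q0 \<inter> ball z r \<subseteq> cube z' l" by blast
        have l0: "0 < l" using l L by auto
        have yQ: "y \<in> Q0" using elim Q by (auto simp: space_restrict_space)
        have "ball_mass Q0 v z r \<le> ?I z' l"
          unfolding ball_mass_def using l(3) Q
          by (intro nn_integral_mono) (auto simp: indicator_def space_restrict_space)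
        also have "\<dots> \<le> ennreal (C * l ^ ?n * v y)" using elim(1) z' l yQ zr by blast
        also have "\<dots> \<le> ennreal (C * (5 * r) ^ ?n * v y)"
          using C l l0 elim by (intro ennreal_leI mult_right_mono mult_left_mono power_mono) auto
        finally show "ball_mass Q0 v z r \<le> ennreal (C * 5 ^ ?n * r ^ DIM(real ^ 'n) * v y)"
          by (simp add: power_mult_distrib mult.assoc)
      qed
    qed
  qed
qed

lemma A1_imp_A1_on:
  fixes Q0 :: "(real ^ 'n) set"
  assumes Q0: "is_cube Q0" and v: "v \<in> A1 Q0" and v1: "AE x in lebesgue_on Q0. 1 \<le> v x"
  obtains C where "A1_on Q0 C v"
proof -
  obtain L where L: "0 < L" "Q0 \<in> sets lebesgue" "\<And>z. z \<in> Q0 \<Longrightarrow> Q0 \<subseteq> cube z (2 * L)"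
    using is_cube_regular[OF Q0] by metis
  obtain C where C: "0 < C" and c: "\<And>z l. z \<in> Q0 \<Longrightarrow> 0 < l \<Longrightarrow> AE x in lebesgue_on (cube z l \<inter> Q0).
        (\<integral>\<^sup>+ y. ennreal (v y) \<partial>lebesgue_on (cube z l \<inter> Q0)) / emeasure lebesgue (cube z l) \<le> ennreal (C * v x)"
    using v unfolding A1_def by blast
  have vm: "v \<in> borel_measurable (lebesgue_on Q0)" using v by (simp add: A1_def weight_def)
  have "A1_on Q0 (C * 5 ^ CARD('n)) v"
  proof (rule A1_on_of_cubes[OF L(2,1,3) C vm v1])
    fix z l assume zl: "z \<in> Q0" "0 < l" "l \<le> 2 * L"
    show "AE y in lebesgue_on (cube z l \<inter> Q0).
       (\<integral>\<^sup>+x. ennreal (v x) \<partial>lebesgue_on (cube z l \<inter> Q0)) \<le> ennreal (C * l ^ CARD('n) * v y)"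
      using c[OF zl(1,2)]
    proof eventually_elim
      case (elim y)
      let ?J = "\<integral>\<^sup>+ y. ennreal (v y) \<partial>lebesgue_on (cube z l \<inter> Q0)"
      have l: "ennreal (l ^ CARD('n)) \<noteq> 0" "ennreal (l ^ CARD('n)) \<noteq> \<infinity>" using zl by auto
      have "?J = ?J / ennreal (l ^ CARD('n)) * ennreal (l ^ CARD('n))"
        using l by (simp add: ennreal_divide_times ennreal_mult_divide_eq)
      also have "\<dots> \<le> ennreal (C * v y) * ennreal (l ^ CARD('n))"
        using elim unfolding emeasure_cube[OF less_imp_le[OF zl(2)]] by (intro mult_right_mono) auto
      also have "\<dots> = ennreal (C * l ^ CARD('n) * v y)"
        using zl by (subst ennreal_mult''[symmetric]) (auto simp: mult_ac)
      finally show ?case .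
    qed
  qed
  then show ?thesis using that by blast
qed

text \<open>
  The constants of \<open>self_improvement\<close> are the same for all sets \<open>cube z l \<inter> Q0\<close>, and its conclusion on
  these sets is the \<open>A\<^sub>1\<close> condition for \<open>v powr (1 + d)\<close>.
\<close>

lemma A1_on_improve:
  fixes Q0 :: "(real ^ 'n) set"
  assumes Q0: "is_cube Q0" and A: "A1_on Q0 C v"
  obtains d C' where "0 < d" "d \<le> 1" "A1_on Q0 C' (\<lambda>x. v x powr (1 + d))"
proof -
  let ?n = "CARD('n)"
  obtain L where L: "0 < L" "Q0 \<in> sets lebesgue" "\<And>z. z \<in> Q0 \<Longrightarrow> Q0 \<subseteq> cube z (2 * L)"
    and reg: "\<And>z l. z \<in> Q0 \<Longrightarrow> 0 < l \<Longrightarrow> l \<le> 2 * L \<Longrightarrow>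
       regular_set (cube z l \<inter> Q0) ((1 / (8 * real ?n)) ^ ?n) (2 * real ?n * l)"
    using is_cube_regular[OF Q0] by metis
  note A' = A1_onD[OF A]
  have v[measurable]: "v \<in> borel_measurable (lebesgue_on Q0)" by (rule A')
  define c where "c = (1 / (8 * real ?n)) ^ ?n"
  have c: "0 < c" unfolding c_def using zero_less_card_finite[where 'a='n] by simp
  define b where "b = unit_ball_vol (real DIM(real ^ 'n)) / 2"
  have b: "0 < b" by (simp add: b_def)
  define C2 where "C2 = max (C / b) 1"
  define K where "K = 8 ^ DIM(real ^ 'n) * b / c * (2 * C2\<^sup>2)"
  have K: "0 < K" using b c by (simp add: K_def C2_def)
  define e where "e = min 1 (1 / (2 * K))"
  have e: "0 < e" "e \<le> 1" using K by (auto simp: e_def)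
  \<comment> \<open>Chosen so that \<open>2 powr d - 1 = e\<close>.\<close>
  define d where "d = log 2 (1 + e)"
  have d: "0 < d" "d \<le> 1" using e by (auto simp: d_def log_le_one_cancel_iff)
  have de: "2 powr d - 1 = e" using e by (simp add: d_def)
  have "(2 powr d - 1) * (8 ^ DIM(real ^ 'n) * b / c) * (2 * C2\<^sup>2) = e * K"
    unfolding de K_def by (simp only: mult.assoc)
  also have "\<dots> \<le> 1 / (2 * K) * K" using K by (intro mult_right_mono) (auto simp: e_def)
  finally have small: "(2 powr d - 1) * (8 ^ DIM(real ^ 'n) * b / c) * (2 * C2\<^sup>2) \<le> 1 / 2"
    using K by simp
  define C3 where "C3 = 2 * C * (2 * C / b) powr d * (2 * real ?n) ^ ?n"
  have C3: "0 < C3" using A'(1) b zero_less_card_finite[where 'a='n] by (simp add: C3_def)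
  have "A1_on Q0 (C3 * 5 ^ ?n) (\<lambda>x. v x powr (1 + d))"
  proof (rule A1_on_of_cubes[OF L(2,1,3) C3])
    show "AE x in lebesgue_on Q0. 1 \<le> v x powr (1 + d)"
      using A'(3) by eventually_elim (use d in \<open>auto simp: ge_one_powr_ge_zero\<close>)
    fix z l assume zl: "z \<in> Q0" "0 < l" "l \<le> 2 * L"
    have "A1_on (cube z l \<inter> Q0) C v" using L(2) by (intro A1_on_subset[OF A]) auto
    then show "AE y in lebesgue_on (cube z l \<inter> Q0).
       (\<integral>\<^sup>+x. ennreal (v x powr (1 + d)) \<partial>lebesgue_on (cube z l \<inter> Q0)) \<le> ennreal (C3 * l ^ ?n * v y powr (1 + d))"
      using self_improvement[OF reg[OF zl] _ d, of C v C2] small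
      by (simp add: C2_def b_def c_def C3_def power_mult_distrib mult_ac)
  qed measurable
  then show ?thesis using that d by blast
qed

section \<open>Powers of \<open>A\<^sub>1\<close> weights with variable exponent\<close>

text \<open>
  Instead of Jensen's inequality: for \<open>a = V y\<close> one has \<open>V powr s \<le> a powr s + a powr (s - 1) * V\<close>, by
  distinguishing \<open>V \<le> a\<close> and \<open>V > a\<close>. The constant does not depend on \<open>s\<close>.
\<close>

lemma A1_on_powr:
  fixes S :: "'a::euclidean_space set"
  assumes R: "regular_set S c D" and A: "A1_on S C V" and s: "0 \<le> s" "s \<le> 1"
  shows "A1_on S (unit_ball_vol (DIM('a)) + C) (\<lambda>x. V x powr s)"
proof -
  let ?n = "DIM('a)"
  let ?M = "lebesgue_on S"
  note R' = regular_setD[OF R] note A' = A1_onD[OF A]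
  have V[measurable]: "V \<in> borel_measurable ?M" by (rule A')
  show ?thesis unfolding A1_on_def
  proof (intro conjI)
    show "0 < unit_ball_vol (real ?n) + C" using A'(1) by (simp add: add_nonneg_pos)
    show "AE y in ?M. 1 \<le> V y powr s" using A'(3) by eventually_elim (use s in \<open>auto simp: ge_one_powr_ge_zero\<close>)
    show "AE y in ?M. \<forall>z\<in>S. \<forall>r>0. y \<in> ball z r \<longrightarrow>
      ball_mass S (\<lambda>x. V x powr s) z r \<le> ennreal ((unit_ball_vol (real ?n) + C) * r ^ ?n * V y powr s)"
      using A'(3,4)
    proof eventually_elim
      case (elim y)
      show ?case
      proof (intro ballI allI impI)
        fix z and r :: real assume zr: "z \<in> S" "0 < r" "y \<in> ball z r"
        have a: "1 \<le> V y" using elim by simp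
        have "ball_mass S (\<lambda>x. V x powr s) z r \<le> (\<integral>\<^sup>+x. ennreal (V y powr s) * indicator (S \<inter> ball z r) x
          + ennreal (V y powr (s - 1)) * (ennreal (V x) * indicator (ball z r) x) \<partial>?M)"
          unfolding ball_mass_def
        proof (intro nn_integral_mono_AE)
          show "AE x in ?M. ennreal (V x powr s) * indicator (ball z r) x \<le> ennreal (V y powr s) * indicator (S \<inter> ball z r) x
            + ennreal (V y powr (s - 1)) * (ennreal (V x) * indicator (ball z r) x)"
            using A'(3) AE_space
          proof eventually_elim
            case (elim x)
            have "V x powr s \<le> V y powr s + V y powr (s - 1) * V x"
            proof (cases "V x \<le> V y")
              case True
              then have "V x powr s \<le> V y powr s" using elim s by (intro powr_mono2) auto
              moreover have "0 \<le> V y powr (s - 1) * V x" using elim by simp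
              ultimately show ?thesis by linarith
            next
              case False
              then have "V x powr (s - 1) \<le> V y powr (s - 1)" using a s by (intro powr_mono2') auto
              then have "V x powr (s - 1) * V x \<le> V y powr (s - 1) * V x" using elim by (intro mult_right_mono) auto
              moreover have "V x powr (s - 1) * V x = V x powr s" using elim by (simp add: powr_diff)
              moreover have "0 \<le> V y powr s" by simp
              ultimately show ?thesis by linarith
            qed
            then have "ennreal (V x powr s) \<le> ennreal (V y powr s + V y powr (s - 1) * V x)" by (rule ennreal_leI)
            also have "\<dots> = ennreal (V y powr s) + ennreal (V y powr (s - 1)) * ennreal (V x)"
              using elim by (simp add: ennreal_mult)
            finally show ?case using elim R'(1) by (auto simp: indicator_def space_restrict_space)
          qed
        qed
        also have "\<dots> = ennreal (V y powr s) * emeasure ?M (S \<inter> ball z r) + ennreal (V y powr (s - 1)) * ball_mass S V z r"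
        proof -
          have [measurable]: "S \<inter> ball z r \<in> sets ?M" using R'(1) by simp
          show ?thesis unfolding ball_mass_def
            by (subst nn_integral_add, measurable) (subst nn_integral_cmult, measurable, subst nn_integral_cmult_indicator, measurable)
        qed
        also have "\<dots> \<le> ennreal (V y powr s) * ennreal (unit_ball_vol ?n * r ^ ?n) + ennreal (V y powr (s - 1)) * ennreal (C * r ^ ?n * V y)"
        proof (intro add_mono mult_left_mono)
          have "emeasure ?M (S \<inter> ball z r) \<le> emeasure lebesgue (ball z r)"
          proof (subst emeasure_restrict_space)
            show "emeasure lebesgue (S \<inter> ball z r) \<le> emeasure lebesgue (ball z r)"
              by (rule emeasure_mono) auto
          qed (use R'(1) in auto)
          then show "emeasure ?M (S \<inter> ball z r) \<le> ennreal (unit_ball_vol ?n * r ^ ?n)"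
            using zr by (simp add: emeasure_ball)
          show "ball_mass S V z r \<le> ennreal (C * r ^ ?n * V y)" using elim zr by auto
        qed auto
        also have "\<dots> = ennreal ((unit_ball_vol ?n + C) * r ^ ?n * V y powr s)"
        proof -
          have "V y powr (s - 1) * V y = V y powr s" using a by (simp add: powr_diff)
          then have "V y powr (s - 1) * (C * r ^ ?n * V y) = C * r ^ ?n * V y powr s" by (simp add: mult_ac)
          then show ?thesis using a zr A'(1)
            by (simp add: ennreal_mult[symmetric] ennreal_plus[symmetric] algebra_simps del: ennreal_plus)
        qed
        finally show "ball_mass S (\<lambda>x. V x powr s) z r \<le> ennreal ((unit_ball_vol (real ?n) + C) * r ^ ?n * V y powr s)" .
      qed
    qed
  qed measurable
qed

text \<open>
  The closure of \<open>Q0\<close> without balls around the singularities is compact, and each of its points has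
  a neighbourhood on which \<open>v\<close> is essentially bounded.
\<close>

lemma bounded_away_from_singularities:
  fixes Q0 :: "(real ^ 'n) set"
  assumes Q: "bounded Q0" "Q0 \<in> sets lebesgue" and r: "0 < r"
  obtains B where "1 \<le> B" "AE x in lebesgue_on Q0. (\<forall>z\<in>singularities Q0 v. r \<le> dist z x) \<longrightarrow> v x \<le> B"
proof -
  let ?M = "lebesgue_on Q0"
  let ?K = "closure Q0 - (\<Union>z\<in>singularities Q0 v. ball z r)"
  have K: "compact ?K" using Q by (intro compact_diff) (auto simp: compact_closure)
  have *: "\<exists>U B. open U \<and> x \<in> U \<and> (AE y in ?M. y \<in> U \<longrightarrow> v y \<le> B)" if x: "x \<in> ?K" for x
  proof -
    have "x \<notin> singularities Q0 v" using x r by auto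
    then obtain U where U: "open U" "x \<in> U" "ess_bounded_on (U \<inter> Q0) v"
      using x by (auto simp: singularities_def)
    then obtain B where B: "AE y in lebesgue_on (U \<inter> Q0). \<bar>v y\<bar> \<le> B" by (auto simp: ess_bounded_on_def)
    have eq: "lebesgue_on (U \<inter> Q0) = restrict_space ?M U"
      using U Q by (simp add: restrict_restrict_space borel_open Int_commute)
    have sp: "U \<inter> space ?M \<in> sets ?M" using U Q by (auto simp: space_restrict_space sets_restrict_space_iff borel_open)
    have "AE y in ?M. y \<in> U \<longrightarrow> \<bar>v y\<bar> \<le> B" using B unfolding eq AE_restrict_space_iff[OF sp] .
    then have "AE y in ?M. y \<in> U \<longrightarrow> v y \<le> B" by eventually_elim auto
    then show ?thesis using U by blast
  qed
  let ?D = "{U. open U \<and> (\<exists>B. AE y in ?M. y \<in> U \<longrightarrow> v y \<le> B)}"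
  have "?K \<subseteq> \<Union> ?D" using * by blast
  then obtain F where F: "F \<subseteq> ?D" "finite F" "?K \<subseteq> \<Union> F"
    using compactE[OF K, of ?D] by blast
  have "\<forall>U\<in>F. \<exists>B. AE y in ?M. y \<in> U \<longrightarrow> v y \<le> B" using F(1) by auto
  from bchoice[OF this] obtain B where B: "\<And>U. U \<in> F \<Longrightarrow> AE y in ?M. y \<in> U \<longrightarrow> v y \<le> B U" by auto
  define B0 where "B0 = 1 + (\<Sum>x\<in>F. \<bar>B x\<bar>)"
  show ?thesis
  proof (rule that[of B0])
    show "1 \<le> B0" by (simp add: B0_def sum_nonneg)
    have "AE y in ?M. \<forall>x\<in>F. y \<in> x \<longrightarrow> v y \<le> B x"
      using F B by (intro AE_finite_allI) auto
    then show "AE x in ?M. (\<forall>z\<in>singularities Q0 v. r \<le> dist z x) \<longrightarrow> v x \<le> B0"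
      using AE_space
    proof eventually_elim
      case (elim y)
      show ?case
      proof
        assume far: "\<forall>z\<in>singularities Q0 v. r \<le> dist z y"
        have "y \<in> Q0" using elim Q by (auto simp: space_restrict_space)
        then have "y \<in> ?K" using far closure_subset by (force simp: not_less)
        then obtain x where x: "x \<in> F" "y \<in> x" using F by blast
        then have "v y \<le> \<bar>B x\<bar>" using elim by fastforce
        also have "\<dots> \<le> (\<Sum>x\<in>F. \<bar>B x\<bar>)" using x F by (intro member_le_sum) auto
        finally show "v y \<le> B0" by (simp add: B0_def)
      qed
    qed
  qed
qed

lemma powr_le_exp_of_ln_le:
  fixes v d K :: real
  assumes "1 \<le> v" "d * ln v \<le> K" shows "v powr d \<le> exp K"
  using assms by (simp add: powr_def)

text \<open>
  Freezing the exponent at the singularities. Where \<open>dist z x < \<rho>\<close>, the logarithm of \<open>v\<close> is at most \<open>\<theta>\<close> times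
  \<open>log (1 / |x - z|)\<close>, so \<open>v powr t x\<close> and \<open>v powr t z\<close> are comparable by log-Hoelder continuity of \<open>t\<close>.
  A small ball lies either near one singularity, where the weight may be replaced by \<open>v powr t z\<close>, or away
  from all of them, where \<open>v\<close> is bounded. For large balls the total mass suffices, as \<open>v \<ge> 1\<close>. Freezing at
  the centre of the ball instead would not do: \<open>v\<close> may be arbitrarily large at distances from \<open>z\<close>
  much smaller than the radius.
\<close>

proposition A1_on_variable_powr:
  fixes S :: "'a::euclidean_space set"
  assumes R: "regular_set S c D" and v: "v \<in> borel_measurable (lebesgue_on S)"
    and v1: "AE x in lebesgue_on S. 1 \<le> v x"
    and T: "0 < T" and A: "A1_on S C (\<lambda>x. v x powr T)"
    and Z: "finite Z" "Z \<subseteq> S" and th: "0 < \<theta>" and rho: "0 < \<rho>" "\<rho> \<le> 1"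
    and near: "AE x in lebesgue_on S. \<forall>z\<in>Z. dist z x < \<rho> \<longrightarrow> v x \<le> norm (x - z) powr (- \<theta>)"
    and far: "1 \<le> B" "AE x in lebesgue_on S. (\<forall>z\<in>Z. \<rho> / 2 \<le> dist z x) \<longrightarrow> v x \<le> B"
    and t: "t \<in> borel_measurable (lebesgue_on S)" "\<And>x. x \<in> S \<Longrightarrow> 0 \<le> t x \<and> t x \<le> T"
    and tL: "0 \<le> L" "\<And>x y. x \<in> S \<Longrightarrow> y \<in> S \<Longrightarrow> \<bar>t x - t y\<bar> * ln (1 / norm (x - y)) \<le> L"
  obtains C' where "A1_on S C' (\<lambda>x. v x powr t x)"
proof -
  let ?n = "DIM('a)"
  let ?M = "lebesgue_on S"
  note R' = regular_setD[OF R] note A' = A1_onD[OF A]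
  note v[measurable] t(1)[measurable]
  obtain T0 where T0: "0 < T0" "(\<integral>\<^sup>+x. ennreal (v x powr T) \<partial>?M) = ennreal T0"
    using A1_on_total[OF R A] by metis
  define K0 where "K0 = exp (\<theta> * L)"
  have K0: "1 \<le> K0" using th tL by (simp add: K0_def)
  define C'' where "C'' = unit_ball_vol ?n + C"
  have C'': "0 < C''" using A'(1) by (simp add: C''_def add_nonneg_pos)
  have frozen: "A1_on S C'' (\<lambda>x. v x powr t z)" if "z \<in> Z" for z
  proof -
    have "A1_on S C'' (\<lambda>x. (v x powr T) powr (t z / T))"
      unfolding C''_def using t(2)[of z] that Z T by (intro A1_on_powr[OF R A]) auto
    then show ?thesis using T by (simp add: powr_powr)
  qed
  have cmp: "AE x in ?M. \<forall>z\<in>Z. dist z x < \<rho> \<longrightarrow> v x powr t x \<le> K0 * v x powr t z \<and> v x powr t z \<le> K0 * v x powr t x"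
    using near v1 AE_space
  proof eventually_elim
    case (elim x)
    have x: "x \<in> S" using elim R' by (auto simp: space_restrict_space)
    show ?case
    proof (intro ballI impI)
      fix z assume z: "z \<in> Z" "dist z x < \<rho>"
      have "\<bar>t x - t z\<bar> * ln (v x) \<le> \<theta> * L"
      proof (cases "x = z")
        case False
        then have nx: "0 < norm (x - z)" by simp
        have "ln (v x) \<le> ln (norm (x - z) powr (- \<theta>))" using elim z by (intro ln_mono) auto
        also have "\<dots> = \<theta> * ln (1 / norm (x - z))" using nx by (simp add: ln_powr ln_div)
        finally have "\<bar>t x - t z\<bar> * ln (v x) \<le> \<theta> * (\<bar>t x - t z\<bar> * ln (1 / norm (x - z)))"
          by (metis abs_ge_zero mult.left_commute mult_left_mono)
        also have "\<dots> \<le> \<theta> * L" using tL(2)[OF x, of z] z Z th by (intro mult_left_mono) auto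
        finally show ?thesis .
      qed (use th tL in simp)
      then have K: "v x powr \<bar>t x - t z\<bar> \<le> K0" using elim unfolding K0_def by (intro powr_le_exp_of_ln_le)
      have "v x powr (t x - t z) \<le> v x powr \<bar>t x - t z\<bar>" "v x powr (t z - t x) \<le> v x powr \<bar>t x - t z\<bar>"
        using elim by (auto intro!: powr_mono)
      then have "v x powr t z * v x powr (t x - t z) \<le> v x powr t z * K0" "v x powr t x * v x powr (t z - t x) \<le> v x powr t x * K0"
        using K by (auto intro!: mult_left_mono)
      then show "v x powr t x \<le> K0 * v x powr t z \<and> v x powr t z \<le> K0 * v x powr t x"
        by (simp add: powr_add[symmetric] mult.commute)
    qed
  qed
  define C' where "C' = (8 / \<rho>) ^ ?n * T0 + K0 * (K0 * C'') + B powr T * unit_ball_vol ?n"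
  have p1: "0 \<le> (8 / \<rho>) ^ ?n * T0" "0 \<le> K0 * (K0 * C'')" "0 \<le> B powr T * unit_ball_vol ?n"
    using rho T0 K0 C'' far by auto
  have p: "0 < C'" unfolding C'_def using p1 rho T0 by (intro add_pos_nonneg) auto
  have vt1: "AE y in ?M. 1 \<le> v y powr t y"
    using v1 AE_space by eventually_elim (use t(2) R' in \<open>auto simp: space_restrict_space ge_one_powr_ge_zero\<close>)
  have "A1_on S C' (\<lambda>x. v x powr t x)"
    unfolding A1_on_def
  proof (intro conjI p vt1)
    have fz: "AE y in ?M. \<forall>z\<in>Z. \<forall>z0\<in>S. \<forall>r>0. y \<in> ball z0 r \<longrightarrow> ball_mass S (\<lambda>x. v x powr t z) z0 r \<le> ennreal (C'' * r ^ ?n * v y powr t z)"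
      by (rule AE_finite_allI[OF Z(1)]) (rule A1_onD(4)[OF frozen])
    show "AE y in ?M. \<forall>z\<in>S. \<forall>r>0. y \<in> ball z r \<longrightarrow>
       ball_mass S (\<lambda>x. v x powr t x) z r \<le> ennreal (C' * r ^ ?n * v y powr t y)"
      using fz cmp vt1 AE_space
    proof eventually_elim
      case (elim y)
      have y: "y \<in> S" using elim R' by (auto simp: space_restrict_space)
      have vy: "1 \<le> v y powr t y" by (rule elim)
      show ?case
      proof (intro ballI allI impI)
        fix z0 and r :: real assume z0: "z0 \<in> S" "0 < r" "y \<in> ball z0 r"
        have final: "ball_mass S (\<lambda>x. v x powr t x) z0 r \<le> ennreal (C' * r ^ ?n * v y powr t y)"
          if "ball_mass S (\<lambda>x. v x powr t x) z0 r \<le> ennreal (k * r ^ ?n * v y powr t y)" "k \<le> C'" for k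
        proof -
          have "k * r ^ ?n * v y powr t y \<le> C' * r ^ ?n * v y powr t y" using that(2) z0 by (intro mult_right_mono) auto
          then show ?thesis using that(1) by (meson ennreal_leI order_trans)
        qed
        \<comment> \<open>If \<open>r < \<rho> / 8\<close>, points of the ball are within \<open>\<rho> / 4\<close> of \<open>y\<close>; hence the threshold \<open>3 / 4 * \<rho>\<close>, between
          the radius \<open>\<rho>\<close> of the bound near \<open>z\<close> and the radius \<open>\<rho> / 2\<close> outside which \<open>v \<le> B\<close>.\<close>
        consider "\<rho> / 8 \<le> r" | z where "r < \<rho> / 8" "z \<in> Z" "dist z y < 3 / 4 * \<rho>"
          | "r < \<rho> / 8" "\<forall>z\<in>Z. 3 / 4 * \<rho> \<le> dist z y" by force
        then show "ball_mass S (\<lambda>x. v x powr t x) z0 r \<le> ennreal (C' * r ^ ?n * v y powr t y)"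
        proof cases
          case 1
          have "ball_mass S (\<lambda>x. v x powr t x) z0 r \<le> (\<integral>\<^sup>+x. ennreal (v x powr t x) \<partial>?M)" by (rule ball_mass_le_total)
          also have "\<dots> \<le> (\<integral>\<^sup>+x. ennreal (v x powr T) \<partial>?M)"
          proof (intro nn_integral_mono_AE)
            show "AE x in ?M. ennreal (v x powr t x) \<le> ennreal (v x powr T)"
              using v1 AE_space by eventually_elim (use t(2) R' in \<open>auto simp: space_restrict_space intro!: ennreal_leI powr_mono\<close>)
          qed
          also have "\<dots> = ennreal T0" by (rule T0)
          also have "\<dots> \<le> ennreal ((8 / \<rho>) ^ ?n * T0 * r ^ ?n * v y powr t y)"
          proof (rule ennreal_leI)
            have "1 ^ ?n \<le> (8 / \<rho> * r) ^ ?n" using 1 rho by (intro power_mono) (auto simp: field_simps)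
            then have "1 * 1 \<le> (8 / \<rho> * r) ^ ?n * v y powr t y" using vy by (intro mult_mono) auto
            then have "T0 * 1 \<le> T0 * ((8 / \<rho> * r) ^ ?n * v y powr t y)" using T0 by (intro mult_left_mono) auto
            then show "T0 \<le> (8 / \<rho>) ^ ?n * T0 * r ^ ?n * v y powr t y"
              unfolding power_mult_distrib[of "8 / \<rho>" r] by (simp only: mult_ac mult_1_right mult_1_left)
          qed
          finally show ?thesis by (rule final) (use p1 in \<open>simp add: C'_def\<close>)
        next
          case (2 z)
          have "ball_mass S (\<lambda>x. v x powr t x) z0 r \<le> (\<integral>\<^sup>+x. ennreal K0 * (ennreal (v x powr t z) * indicator (ball z0 r) x) \<partial>?M)"
            unfolding ball_mass_def
          proof (intro nn_integral_mono_AE)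
            show "AE x in ?M. ennreal (v x powr t x) * indicator (ball z0 r) x \<le> ennreal K0 * (ennreal (v x powr t z) * indicator (ball z0 r) x)"
              using cmp
            proof eventually_elim
              case (elim x)
              show ?case
              proof (cases "x \<in> ball z0 r")
                case True
                have "dist z x \<le> dist z y + dist y z0 + dist z0 x"
                  using dist_triangle[of z x y] dist_triangle[of y x z0] by linarith
                then have "dist z x < \<rho>" using 2 z0 True rho by (simp add: dist_commute)
                then have "v x powr t x \<le> K0 * v x powr t z" using elim 2 by blast
                then show ?thesis using True K0 by (simp add: ennreal_mult[symmetric])
              qed auto
            qed
          qed
          also have "\<dots> = ennreal K0 * ball_mass S (\<lambda>x. v x powr t z) z0 r"
            unfolding ball_mass_def by (rule nn_integral_cmult) measurable
          also have "\<dots> \<le> ennreal K0 * ennreal (C'' * r ^ ?n * v y powr t z)"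
            using elim(1) 2 z0 by (intro mult_left_mono) auto
          also have "\<dots> = ennreal (K0 * (C'' * r ^ ?n * v y powr t z))"
            using K0 by (intro ennreal_mult'[symmetric]) auto
          also have "\<dots> \<le> ennreal (K0 * (K0 * C'') * r ^ ?n * v y powr t y)"
          proof (rule ennreal_leI)
            have "v y powr t z \<le> K0 * v y powr t y" using elim(2) 2 rho by force
            then have "K0 * (C'' * r ^ ?n * v y powr t z) \<le> K0 * (C'' * r ^ ?n * (K0 * v y powr t y))"
              using K0 C'' z0 by (intro mult_left_mono) auto
            then show "K0 * (C'' * r ^ ?n * v y powr t z) \<le> K0 * (K0 * C'') * r ^ ?n * v y powr t y" by (simp add: mult_ac)
          qed
          finally show ?thesis by (rule final) (use p1 in \<open>simp add: C'_def\<close>)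
        next
          case 3
          have "ball_mass S (\<lambda>x. v x powr t x) z0 r \<le> (\<integral>\<^sup>+x. ennreal (B powr T) * indicator (S \<inter> ball z0 r) x \<partial>?M)"
            unfolding ball_mass_def
          proof (intro nn_integral_mono_AE)
            show "AE x in ?M. ennreal (v x powr t x) * indicator (ball z0 r) x \<le> ennreal (B powr T) * indicator (S \<inter> ball z0 r) x"
              using far(2) v1 AE_space
            proof eventually_elim
              case (elim x)
              have xS: "x \<in> S" using elim R' by (auto simp: space_restrict_space)
              show ?case
              proof (cases "x \<in> ball z0 r")
                case True
                have "\<rho> / 2 \<le> dist z x" if "z \<in> Z" for z
                proof -
                  have "dist z y \<le> dist z x + dist x z0 + dist z0 y"
                    using dist_triangle[of z y x] dist_triangle[of x y z0] by linarith
                  then show ?thesis using 3 z0 True that by (force simp: dist_commute)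
                qed
                then have "v x \<le> B" using elim by blast
                then have "v x powr t x \<le> B powr t x" using elim t(2)[OF xS] by (intro powr_mono2) auto
                also have "\<dots> \<le> B powr T" using far(1) t(2)[OF xS] by (intro powr_mono) auto
                finally show ?thesis using True xS by (simp add: ennreal_leI)
              qed auto
            qed
          qed
          also have "\<dots> = ennreal (B powr T) * emeasure ?M (S \<inter> ball z0 r)"
            using R'(1) by (intro nn_integral_cmult_indicator) auto
          also have "emeasure ?M (S \<inter> ball z0 r) = emeasure lebesgue (S \<inter> ball z0 r)"
            using R'(1) by (subst emeasure_restrict_space) auto
          also have "ennreal (B powr T) * emeasure lebesgue (S \<inter> ball z0 r) \<le> ennreal (B powr T) * emeasure lebesgue (ball z0 r)"
            by (intro mult_left_mono emeasure_mono) auto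
          also have "\<dots> = ennreal (B powr T * unit_ball_vol ?n * r ^ ?n)"
            using z0 by (simp add: emeasure_ball ennreal_mult[symmetric] mult.assoc)
          also have "\<dots> \<le> ennreal (B powr T * unit_ball_vol ?n * r ^ ?n * v y powr t y)"
            using vy z0 mult_left_mono[of 1 "v y powr t y" "B powr T * unit_ball_vol ?n * r ^ ?n"]
            by (intro ennreal_leI) auto
          finally show ?thesis by (rule final) (use p1 in \<open>simp add: C'_def\<close>)
        qed
      qed
    qed
  qed measurable
  then show ?thesis using that by blast
qed

text \<open>
  The range \<open>[0, 1 + d]\<close> of the exponents reaches beyond \<open>1\<close> because of self-improvement.
\<close>

proposition admissible_variable_powr:
  fixes Q0 :: "(real ^ 'n) set"
  assumes Q0: "is_cube Q0" and v: "v \<in> A1 Q0" "admissible Q0 v"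
  obtains d where "0 < d"
    "\<forall>t L. t \<in> borel_measurable (lebesgue_on Q0) \<and> (\<forall>x\<in>Q0. 0 \<le> t x \<and> t x \<le> 1 + d) \<and> 0 \<le> L \<and>
       (\<forall>x\<in>Q0. \<forall>y\<in>Q0. \<bar>t x - t y\<bar> * ln (1 / norm (x - y)) \<le> L) \<longrightarrow>
       (\<exists>C. A1_on Q0 C (\<lambda>x. v x powr t x))"
proof -
  obtain L where L: "Q0 \<in> sets lebesgue"
    "regular_set Q0 ((1 / (8 * real CARD('n))) ^ CARD('n)) (4 * real CARD('n) * L)"
    using is_cube_regular[OF Q0] by metis
  let ?Z = "singularities Q0 v"
  have v1: "AE x in lebesgue_on Q0. 1 \<le> v x" and Z: "finite ?Z" "?Z \<subseteq> Q0" using v by (auto simp: admissible_def)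
  obtain \<theta> r where th: "0 < \<theta>" "0 < r" and near: "\<And>z. z \<in> ?Z \<Longrightarrow>
        AE x in lebesgue_on (cube z r \<inter> closure Q0). v x \<le> norm (x - z) powr (- \<theta>)"
    using v by (auto simp: admissible_def)
  have vm: "v \<in> borel_measurable (lebesgue_on Q0)" using v by (simp add: A1_def weight_def)
  obtain C where A: "A1_on Q0 C v" using A1_imp_A1_on[OF Q0 v(1) v1] .
  obtain d C' where d: "0 < d" "A1_on Q0 C' (\<lambda>x. v x powr (1 + d))" using A1_on_improve[OF Q0 A] by metis
  have bd: "bounded Q0"
    using regular_setD(2,5)[OF L(2)] bounded_ball bounded_subset by blast
  define \<rho> where "\<rho> = min 1 (r / 2)"
  have rho: "0 < \<rho>" "\<rho> \<le> 1" "\<rho> \<le> r / 2" using th by (auto simp: \<rho>_def)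
  have near': "AE x in lebesgue_on Q0. \<forall>z\<in>?Z. dist z x < \<rho> \<longrightarrow> v x \<le> norm (x - z) powr (- \<theta>)"
  proof (intro AE_finite_allI Z)
    fix z assume z: "z \<in> ?Z"
    have cl: "cube z r \<inter> closure Q0 \<in> sets lebesgue" by (intro sets.Int sets_cube) auto
    have "AE x in lebesgue. x \<in> cube z r \<inter> closure Q0 \<longrightarrow> v x \<le> norm (x - z) powr (- \<theta>)"
      using near[OF z] AE_restrict_space_iff[of "cube z r \<inter> closure Q0" lebesgue] cl by simp
    then have "AE x in lebesgue. x \<in> Q0 \<longrightarrow> (dist z x < \<rho> \<longrightarrow> v x \<le> norm (x - z) powr (- \<theta>))"
    proof eventually_elim
      case (elim x)
      show ?case
      proof (intro impI)
        assume x: "x \<in> Q0" "dist z x < \<rho>"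
        then have "norm (x - z) \<le> r / 2" using rho by (simp add: dist_norm norm_minus_commute)
        then have "\<bar>(x - z) $ i\<bar> \<le> r / 2" for i using component_le_norm_cart[of "x - z" i] by linarith
        then have "x \<in> cube z r" by (simp add: cube_def)
        then show "v x \<le> norm (x - z) powr (- \<theta>)" using elim x closure_subset by blast
      qed
    qed
    then show "AE x in lebesgue_on Q0. dist z x < \<rho> \<longrightarrow> v x \<le> norm (x - z) powr (- \<theta>)"
      using L(1) by (subst AE_restrict_space_iff) auto
  qed
  obtain B where B: "1 \<le> B" "AE x in lebesgue_on Q0. (\<forall>z\<in>?Z. \<rho> / 2 \<le> dist z x) \<longrightarrow> v x \<le> B"
    using bounded_away_from_singularities[OF bd L(1), of "\<rho> / 2" v] rho by auto
  show ?thesis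
  proof (rule that[OF d(1)], intro allI impI, elim conjE)
    fix t L' assume t: "t \<in> borel_measurable (lebesgue_on Q0)" "\<forall>x\<in>Q0. 0 \<le> t x \<and> t x \<le> 1 + d"
      "0 \<le> L'" "\<forall>x\<in>Q0. \<forall>y\<in>Q0. \<bar>t x - t y\<bar> * ln (1 / norm (x - y)) \<le> L'"
    have T: "0 < 1 + d" using d by simp
    show "\<exists>C. A1_on Q0 C (\<lambda>x. v x powr t x)"
      by (rule A1_on_variable_powr[OF L(2) vm v1 T d(2) Z th(1) rho(1,2) near' B t(1) _ t(3)])
        (use t in \<open>blast+\<close>)
  qed
qed

section \<open>Averages and variable exponents\<close>

text \<open>
  The way in which log-Hoelder continuity is used: a quantity between a constant and a multiple of
  \<open>r\<^bsup>-n\<^esup>\<close> is changed only by a constant factor when its exponent changes by \<open>O(1 / log (1 / r))\<close>.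
\<close>

lemma powr_variation_bounded:
  fixes \<tau> e r :: real
  assumes "0 < c1" "c1 \<le> \<tau>" "0 < r" "\<tau> * r ^ n \<le> C1" "\<bar>e\<bar> \<le> E" "\<bar>e\<bar> * ln (1 / r) \<le> L" "0 \<le> L"
  shows "\<tau> powr e \<le> exp (E * (\<bar>ln c1\<bar> + \<bar>ln C1\<bar>) + real n * L)"
proof -
  have t: "0 < \<tau>" using assms by linarith
  have C1: "0 < C1" using assms t by (smt (verit) mult_pos_pos zero_less_power)
  have E: "0 \<le> E" using assms by linarith
  have "\<bar>e\<bar> * \<bar>ln \<tau>\<bar> \<le> E * (\<bar>ln c1\<bar> + \<bar>ln C1\<bar>) + real n * L"
  proof (cases "0 \<le> ln \<tau>")
    case True
    have "ln (\<tau> * r ^ n) \<le> ln C1" using assms t by (intro ln_mono) auto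
    then have "ln \<tau> \<le> \<bar>ln C1\<bar> + real n * ln (1 / r)" using t assms by (simp add: ln_mult ln_realpow ln_div)
    then have "\<bar>e\<bar> * \<bar>ln \<tau>\<bar> \<le> \<bar>e\<bar> * (\<bar>ln C1\<bar> + real n * ln (1 / r))" using True by (intro mult_left_mono) auto
    also have "\<dots> = \<bar>e\<bar> * \<bar>ln C1\<bar> + real n * (\<bar>e\<bar> * ln (1 / r))" by (simp add: algebra_simps)
    also have "\<dots> \<le> E * \<bar>ln C1\<bar> + real n * L" using assms by (intro add_mono mult_right_mono mult_left_mono) auto
    also have "\<dots> \<le> E * (\<bar>ln c1\<bar> + \<bar>ln C1\<bar>) + real n * L" using E by (simp add: distrib_left)
    finally show ?thesis .
  next
    case False
    have "ln c1 \<le> ln \<tau>" using assms by (intro ln_mono) auto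
    then have "\<bar>ln \<tau>\<bar> \<le> \<bar>ln c1\<bar> + \<bar>ln C1\<bar>" using False by linarith
    then have "\<bar>e\<bar> * \<bar>ln \<tau>\<bar> \<le> E * (\<bar>ln c1\<bar> + \<bar>ln C1\<bar>)" using assms E by (intro mult_mono) auto
    moreover have "0 \<le> real n * L" using assms by simp
    ultimately show ?thesis by linarith
  qed
  moreover have "e * ln \<tau> \<le> \<bar>e\<bar> * \<bar>ln \<tau>\<bar>" by (metis abs_ge_self abs_mult)
  ultimately show ?thesis using t by (simp add: powr_def)
qed

lemma one_plus_powr_le:
  fixes a k :: real
  assumes "0 \<le> a" "0 \<le> k" shows "(1 + a) powr k \<le> 2 powr k * (1 + a powr k)"
proof -
  have "(1 + a) powr k \<le> (2 * max 1 a) powr k" using assms by (intro powr_mono2) auto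
  also have "\<dots> = 2 powr k * max 1 a powr k" using assms by (intro powr_mult)
  also have "max 1 a powr k \<le> 1 + a powr k" by (auto simp: max_def)
  finally show ?thesis by (simp add: mult_left_mono)
qed

text \<open>
  This replaces Jensen's inequality for an exponent that varies over a ball. With \<open>A\<close> the average
  of \<open>1 + h powr (p / \<kappa>)\<close>, integration over the ball shows that the average of \<open>h\<close> is at most a
  multiple of \<open>A powr (\<kappa> / px)\<close>. Values of \<open>h\<close> above this level \<open>T\<close> are controlled by \<open>h / T \<le> (h / T) powr (py / \<kappa>)\<close>.
\<close>

lemma variable_Jensen_pointwise:
  fixes h A \<kappa> px py K :: real
  assumes A: "1 \<le> A" and k: "0 < \<kappa>" "\<kappa> \<le> px" "\<kappa> \<le> py" and h: "0 \<le> h"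
    and K: "A powr ((px - py) / px) \<le> K"
  shows "h \<le> A powr (\<kappa> / px) + K * A powr (\<kappa> / px) / A * h powr (py / \<kappa>)"
proof -
  define T where "T = A powr (\<kappa> / px)"
  have T: "1 \<le> T" unfolding T_def using A k by (intro ge_one_powr_ge_zero) auto
  have K0: "0 \<le> K" using K powr_ge_zero order_trans by blast
  show ?thesis
  proof (cases "h \<le> T")
    case True
    have "0 \<le> K * T / A * h powr (py / \<kappa>)" using K0 T A by simp
    then show ?thesis using True unfolding T_def[symmetric] by linarith
  next
    case False
    have "(h / T) powr 1 \<le> (h / T) powr (py / \<kappa>)" using False T k by (intro powr_mono) auto
    then have "h \<le> T * (h / T) powr (py / \<kappa>)" using False T by (simp add: field_simps)
    also have "\<dots> = T * T powr (- (py / \<kappa>)) * h powr (py / \<kappa>)" using False T by (simp add: powr_divide powr_minus_divide)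
    also have "T powr (- (py / \<kappa>)) = A powr (-1) * A powr ((px - py) / px)"
    proof -
      have "\<kappa> / px * (- (py / \<kappa>)) = - 1 + (px - py) / px" using k by (simp add: field_simps)
      then show ?thesis unfolding T_def powr_powr by (simp only: powr_add)
    qed
    also have "\<dots> = A powr ((px - py) / px) / A" using A by (simp add: powr_minus_divide)
    also have "T * (A powr ((px - py) / px) / A) * h powr (py / \<kappa>) \<le> T * (K / A) * h powr (py / \<kappa>)"
      using T K A by (intro mult_right_mono mult_left_mono divide_right_mono) auto
    finally show ?thesis using T unfolding T_def[symmetric] by (simp add: mult_ac)
  qed
qed

text \<open>
  Homogeneity: the relation between \<open>p\<close>, \<open>\<beta>\<close> and the Sobolev exponent makes all powers of \<open>r\<close> disappear.
\<close>

lemma exponent_cancellation: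
  fixes U V r A \<kappa> p \<beta> :: real
  assumes "0 < U" "0 < V" "0 < r" "0 < A" "0 < n" "p \<noteq> 0"
  shows "(U / r ^ n) powr (- (1 / p - \<beta> / real n)) * (V / r ^ n) powr (- (1 - 1 / p)) * r powr (\<beta> - real n) * V * A powr (\<kappa> / p)
    = U powr (- (1 / p - \<beta> / real n)) * (V * A powr \<kappa>) powr (1 / p)" (is "?l = ?r")
proof -
  have pos: "0 < ?l" "0 < ?r" using assms by auto
  have "ln ?l = ln ?r"
    using assms by (simp add: ln_mult ln_powr ln_div ln_realpow) (simp add: field_simps)
  then show ?thesis using pos by (simp only: ln_inj_iff)
qed

text \<open>
  Jensen's inequality up to a constant: \<open>H \<le> A / 2 + (2 / A) powr (\<kappa> - 1) * H powr \<kappa>\<close>, and the first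
  summand is absorbed when this is integrated over the ball.
\<close>

lemma average_power_le:
  fixes S :: "'a::euclidean_space set"
  assumes s: "\<sigma> \<in> borel_measurable (lebesgue_on S)" "AE x in lebesgue_on S. 0 \<le> \<sigma> x"
    and H: "H \<in> borel_measurable (lebesgue_on S)" "\<And>x. 0 \<le> H x" and k: "1 < \<kappa>"
    and V: "ball_mass S \<sigma> z r = ennreal V" "0 \<le> V"
    and AV: "ball_mass S (\<lambda>x. H x * \<sigma> x) z r = ennreal (A * V)" "0 < A"
    and K: "(\<integral>\<^sup>+x. ennreal (H x powr \<kappa> * \<sigma> x) \<partial>lebesgue_on S) \<le> ennreal K" "0 \<le> K"
  shows "V * A powr \<kappa> \<le> 2 powr \<kappa> * K"
proof -
  let ?M = "lebesgue_on S"
  note s(1)[measurable] H(1)[measurable]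
  define b where "b = (2 / A) powr (\<kappa> - 1)"
  have "ennreal (A * V) \<le> (\<integral>\<^sup>+x. ennreal (A / 2) * (ennreal (\<sigma> x) * indicator (ball z r) x) + ennreal b * ennreal (H x powr \<kappa> * \<sigma> x) \<partial>?M)"
    unfolding AV(1)[symmetric] ball_mass_def
  proof (intro nn_integral_mono_AE)
    show "AE x in ?M. ennreal (H x * \<sigma> x) * indicator (ball z r) x
      \<le> ennreal (A / 2) * (ennreal (\<sigma> x) * indicator (ball z r) x) + ennreal b * ennreal (H x powr \<kappa> * \<sigma> x)"
      using s(2)
    proof eventually_elim
      case (elim x)
      have "H x \<le> A / 2 + b * H x powr \<kappa>"
      proof (cases "H x \<le> A / 2")
        case True
        have "0 \<le> b * H x powr \<kappa>" by (simp add: b_def)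
        then show ?thesis using True by linarith
      next
        case False
        have "1 powr (\<kappa> - 1) \<le> (2 / A * H x) powr (\<kappa> - 1)" using False AV k by (intro powr_mono2) (auto simp: field_simps)
        also have "\<dots> = b * H x powr (\<kappa> - 1)" unfolding b_def by (rule powr_mult)
        finally have "1 \<le> b * H x powr (\<kappa> - 1)" by simp
        then have "H x * 1 \<le> H x * (b * H x powr (\<kappa> - 1))" using H(2)[of x] by (intro mult_left_mono) auto
        also have "\<dots> = b * H x powr \<kappa>" using powr_diff_1[OF H(2), of x \<kappa>] by (simp add: mult_ac)
        finally show ?thesis using AV by linarith
      qed
      then have "H x * \<sigma> x \<le> (A / 2 + b * H x powr \<kappa>) * \<sigma> x" using elim by (intro mult_right_mono) auto
      then have "ennreal (H x * \<sigma> x) \<le> ennreal (A / 2 * \<sigma> x + b * (H x powr \<kappa> * \<sigma> x))"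
        by (intro ennreal_leI) (simp add: algebra_simps)
      also have "\<dots> = ennreal (A / 2 * \<sigma> x) + ennreal (b * (H x powr \<kappa> * \<sigma> x))"
        using elim AV by (intro ennreal_plus) (auto simp: b_def)
      also have "\<dots> = ennreal (A / 2) * ennreal (\<sigma> x) + ennreal b * ennreal (H x powr \<kappa> * \<sigma> x)"
        using elim AV by (intro arg_cong2[where f="(+)"] ennreal_mult) (auto simp: b_def)
      finally show ?case by (auto simp: indicator_def)
    qed
  qed
  also have "\<dots> = ennreal (A / 2) * ennreal V + ennreal b * (\<integral>\<^sup>+x. ennreal (H x powr \<kappa> * \<sigma> x) \<partial>?M)"
    unfolding V(1)[symmetric] ball_mass_def
    by (subst nn_integral_add, measurable) (subst nn_integral_cmult, measurable, subst nn_integral_cmult, measurable)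
  also have "\<dots> \<le> ennreal (A / 2) * ennreal V + ennreal b * ennreal K"
    using K by (intro add_left_mono mult_left_mono) auto
  also have "\<dots> = ennreal (A / 2 * V + b * K)"
    using AV V K by (subst ennreal_plus) (auto simp: b_def ennreal_mult[symmetric])
  finally have "A * V \<le> A / 2 * V + b * K"
    using AV V K by (subst (asm) ennreal_le_iff) (auto simp: b_def)
  then have "A * V / 2 \<le> b * K" by simp
  then have "A powr (\<kappa> - 1) * (A * V) \<le> A powr (\<kappa> - 1) * (2 * (b * K))" by (intro mult_left_mono) auto
  also have "\<dots> = 2 * (A powr (\<kappa> - 1) * b) * K" by simp
  also have "A powr (\<kappa> - 1) * b = 2 powr (\<kappa> - 1)" using AV by (simp add: b_def powr_divide)
  also have "2 * 2 powr (\<kappa> - 1) = 2 powr \<kappa>" by (rule powr_diff_1) simp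
  finally show ?thesis using AV by (simp add: powr_diff_1[of A \<kappa>, symmetric] mult_ac)
qed

section \<open>The weighted fractional maximal operator\<close>

lemma A1_on_ball:
  fixes S :: "'a::euclidean_space set"
  assumes R: "regular_set S c D" and A: "A1_on S C v"
    and T: "(\<integral>\<^sup>+x. ennreal (v x) \<partial>lebesgue_on S) = ennreal T"
    and x: "x \<in> S" "0 < r" "r \<le> D"
  obtains U where "ball_mass S v x r = ennreal U" "0 < U" "c * r ^ DIM('a) \<le> U" "U \<le> T"
    "AE y in lebesgue_on S. y \<in> ball x r \<longrightarrow> U \<le> C * r ^ DIM('a) * v y"
proof -
  note R' = regular_setD[OF R] note A' = A1_onD[OF A]
  obtain U where U: "ball_mass S v x r = ennreal U" "0 \<le> U"
    using ball_mass_finite[OF R A, of x r] by (cases "ball_mass S v x r") auto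
  have "ennreal (1 * (c * r ^ DIM('a))) \<le> ball_mass S v x r"
    using A'(3) by (intro ball_mass_lower[OF R x]) (auto elim: eventually_mono)
  then have cU: "c * r ^ DIM('a) \<le> U" using U R' x by (simp add: ennreal_le_iff)
  obtain T' where T': "0 < T'" "ennreal T' = ennreal T" using A1_on_total[OF R A] T by metis
  then have "0 < T" by (metis ennreal_0 ennreal_eq_0_iff not_le)
  then have UT: "U \<le> T"
    using ball_mass_le_total[of S v x r] U T by (simp add: ennreal_le_iff)
  show ?thesis
  proof (rule that[OF U(1) _ cU UT])
    show "0 < U" using cU R' x by (smt (verit) mult_pos_pos zero_less_power)
    show "AE y in lebesgue_on S. y \<in> ball x r \<longrightarrow> U \<le> C * r ^ DIM('a) * v y"
      using A'(3,4)
    proof eventually_elim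
      case (elim y)
      show ?case
      proof
        assume "y \<in> ball x r"
        then have "ennreal U \<le> ennreal (C * r ^ DIM('a) * v y)" using elim(2) x U(1) by metis
        then show "U \<le> C * r ^ DIM('a) * v y" using elim A'(1) x by (subst (asm) ennreal_le_iff) auto
      qed
    qed
  qed
qed

text \<open>
  The \<open>A\<^sub>1\<close> condition in the form in which it is applied to \<open>v = u y\<close> or \<open>v = \<sigma> x\<close>: a negative power of
  the weight is at most the same power of its average \<open>U / s\<close>, up to a constant.
\<close>

lemma powr_minus_le_average:
  fixes U C s v a :: real
  assumes "0 < U" "0 < C" "0 < s" "U \<le> C * s * v" "0 \<le> a" "a \<le> 1"
  shows "v powr (- a) \<le> max 1 C * (U / s) powr (- a)"
proof -
  have "U / s / C \<le> v" using assms by (simp add: field_simps)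
  then have "v powr (- a) \<le> (U / s / C) powr (- a)" using assms by (intro powr_mono2') auto
  also have "\<dots> = C powr a * (U / s) powr (- a)"
  proof -
    have "(U / s / C) powr (- a) = (U / s) powr (- a) / C powr (- a)" by (rule powr_divide)
    then show ?thesis using assms by (simp add: powr_minus[of C] field_simps)
  qed
  also have "C powr a \<le> max 1 C powr a" using assms by (intro powr_mono2) auto
  also have "max 1 C powr a \<le> max 1 C powr 1" using assms by (intro powr_mono) auto
  finally show ?thesis by (simp add: mult_right_mono)
qed

text \<open>
  The data of the two-weight problem for the fractional maximal operator of order \<open>\<beta>\<close>. Here \<open>1 / P\<close> is a
  lower bound of \<open>1 / p\<close>, so the last condition on \<open>\<beta>\<close> keeps the Sobolev exponent bounded.
\<close>

locale two_weights =
  fixes S :: "'a::euclidean_space set" and c D :: real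
    and p :: "'a \<Rightarrow> real" and \<kappa> P \<beta> L :: real
    and u \<sigma> :: "'a \<Rightarrow> real" and Cu Cs Tu Ts :: real
  assumes R: "regular_set S c D"
    and p_meas: "p \<in> borel_measurable (lebesgue_on S)"
    and p_range: "\<And>x. x \<in> S \<Longrightarrow> \<kappa> \<le> p x \<and> p x \<le> P" and kap: "1 < \<kappa>"
    and L0: "0 \<le> L" and LH: "\<And>x y. x \<in> S \<Longrightarrow> y \<in> S \<Longrightarrow> \<bar>p x - p y\<bar> * ln (1 / norm (x - y)) \<le> L"
    and bet: "0 \<le> \<beta>" "\<beta> < real DIM('a)" "\<beta> / real DIM('a) < 1 / P"
    and Au: "A1_on S Cu u" and As: "A1_on S Cs \<sigma>"
    and Tu: "(\<integral>\<^sup>+x. ennreal (u x) \<partial>lebesgue_on S) = ennreal Tu"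
    and Ts: "(\<integral>\<^sup>+x. ennreal (\<sigma> x) \<partial>lebesgue_on S) = ennreal Ts" "0 \<le> Ts"
begin

text \<open>The reciprocal of the Sobolev exponent.\<close>

definition iq :: "'a \<Rightarrow> real" where "iq x = 1 / p x - \<beta> / real DIM('a)"

definition w :: "'a \<Rightarrow> real" where "w x = u x powr iq x * \<sigma> x powr (- (1 - 1 / p x))"

definition winv :: "'a \<Rightarrow> real" where "winv x = u x powr (- iq x) * \<sigma> x powr (1 - 1 / p x)"

text \<open>
  Constants for the estimate over one ball. They depend on the data of the locale but not on the
  function to which the operator is applied. The exponentials come from \<open>powr_variation_bounded\<close>, applied to
  averages of \<open>u\<close> (\<open>K1\<close>) and to averages of \<open>1 + h powr (p / \<kappa>)\<close> (\<open>K2\<close>).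
\<close>

definition K1 :: real where "K1 = max 1 Cu * exp (1 * (\<bar>ln c\<bar> + \<bar>ln Tu\<bar>) + real DIM('a) * L)"

definition K3 :: real where "K3 = 2 powr \<kappa> * (Ts + 1)"

definition K2 :: real where "K2 = exp (P * (\<bar>ln 1\<bar> + \<bar>ln (K3 / c)\<bar>) + real DIM('a) * L)"

definition K6 :: real where "K6 = max 1 (2 powr \<kappa> * K3)"

definition K7 :: real where "K7 = Cs powr (1 / \<kappa>) * Cu powr (1 - 1 / \<kappa>) / c"

definition K0 :: real where "K0 = K1 * (1 + K2) * max 1 Cs * K6"

lemmas Rd = regular_setD[OF R] and Aud = A1_onD[OF Au] and Asd = A1_onD[OF As]

lemma in_S: "AE x in lebesgue_on S. x \<in> S"
  using AE_space[of "lebesgue_on S"] by (simp add: space_restrict_space)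

lemma K_pos: "1 \<le> K1" "0 < K3" "0 < K2" "1 \<le> K6" "0 < K7" "1 \<le> K0"
proof -
  have "1 * 1 \<le> K1" unfolding K1_def using L0 by (intro mult_mono) (auto simp: one_le_exp_iff)
  then show a: "1 \<le> K1" by simp
  show "0 < K3" using Ts by (simp add: K3_def)
  show b: "0 < K2" by (simp add: K2_def)
  show d: "1 \<le> K6" by (simp add: K6_def)
  show "0 < K7" using Rd Aud(1) Asd(1) by (simp add: K7_def)
  have "1 * 1 * 1 * 1 \<le> K0" unfolding K0_def using a b d by (intro mult_mono) auto
  then show "1 \<le> K0" by simp
qed

lemma p_pos: "x \<in> S \<Longrightarrow> 1 < p x" "x \<in> S \<Longrightarrow> 0 < 1 / p x" "x \<in> S \<Longrightarrow> 1 / p x < 1"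
proof -
  show a: "x \<in> S \<Longrightarrow> 1 < p x" for x using p_range[of x] kap by auto
  show "x \<in> S \<Longrightarrow> 0 < 1 / p x" "x \<in> S \<Longrightarrow> 1 / p x < 1" for x using a[of x] by auto
qed

lemma iq_range: assumes "x \<in> S" shows "1 / P - \<beta> / real DIM('a) \<le> iq x" "0 < iq x" "iq x \<le> 1 / p x" "iq x \<le> 1"
proof -
  have "1 / P \<le> 1 / p x" using p_range[OF assms] p_pos(1)[OF assms] by (intro divide_left_mono) auto
  then show a: "1 / P - \<beta> / real DIM('a) \<le> iq x" by (simp add: iq_def)
  then show "0 < iq x" using bet by linarith
  show b: "iq x \<le> 1 / p x" using bet by (simp add: iq_def)
  then show "iq x \<le> 1" using p_pos(3)[OF assms] by linarith
qed

lemma LH_ball: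
  assumes "x \<in> S" "y \<in> S" "y \<in> ball x r" "0 < r" "\<bar>e\<bar> \<le> \<bar>p x - p y\<bar>"
  shows "\<bar>e\<bar> * ln (1 / r) \<le> L"
proof (cases "x = y \<or> ln (1 / r) \<le> 0")
  case True
  then have "\<bar>e\<bar> * ln (1 / r) \<le> 0" using assms by (auto intro: mult_nonneg_nonpos)
  then show ?thesis using L0 by linarith
next
  case False
  have n: "0 < norm (x - y)" "norm (x - y) \<le> r" using False assms by (auto simp: dist_norm)
  have "1 / r \<le> 1 / norm (x - y)" using n assms(4) by (intro divide_left_mono) auto
  moreover have "0 < 1 / r" using \<open>0 < r\<close> by simp
  ultimately have "ln (1 / r) \<le> ln (1 / norm (x - y))" by (metis less_le_trans ln_le_cancel_iff)
  then have "\<bar>e\<bar> * ln (1 / r) \<le> \<bar>p x - p y\<bar> * ln (1 / norm (x - y))"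
    using False assms(5) by (intro mult_mono) linarith+
  then show ?thesis using LH[OF assms(1,2)] by linarith
qed

lemma recip_p_diff:
  assumes "x \<in> S" "y \<in> S" shows "\<bar>1 / p x - 1 / p y\<bar> \<le> \<bar>p x - p y\<bar>" "\<bar>1 / p x - 1 / p y\<bar> \<le> 1"
proof -
  note px = p_pos(1)[OF assms(1)] and py = p_pos(1)[OF assms(2)]
  have "1 * 1 \<le> p x * p y" using px py by (intro mult_mono) auto
  have "\<bar>1 / p x - 1 / p y\<bar> = \<bar>p x - p y\<bar> / (p x * p y)" using px py by (simp add: divide_simps abs_mult abs_minus_commute)
  also have "\<dots> \<le> \<bar>p x - p y\<bar> / 1" using \<open>1 * 1 \<le> p x * p y\<close> by (intro divide_left_mono) auto
  finally show "\<bar>1 / p x - 1 / p y\<bar> \<le> \<bar>p x - p y\<bar>" by simp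
  show "\<bar>1 / p x - 1 / p y\<bar> \<le> 1"
    using p_pos(2,3)[OF assms(1)] p_pos(2,3)[OF assms(2)] by linarith
qed

text \<open>
  The estimate over one ball, as sketched at the beginning of the file, with \<open>\<kappa>\<close> in the role of the
  constant exponent. Let \<open>U\<close> and \<open>V\<close> be the masses of \<open>u\<close> and \<open>\<sigma>\<close> on the ball and \<open>A\<close> the \<open>\<sigma>\<close>-average of
  \<open>H\<close>. Pulling out \<open>u\<close>, applying the variable Jensen inequality to \<open>h\<close> and cancelling the powers of \<open>r\<close>
  bounds the left-hand side by a multiple of \<open>(u x / U) powr iq x * X powr (1 / p x)\<close> for
  \<open>X = V * A powr \<kappa>\<close>. As \<open>X\<close> is bounded, \<open>1 / p x\<close> may be lowered to \<open>iq x\<close>. Finally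
  \<open>X / U \<le> (K7 * M2) powr \<kappa>\<close>: on the ball, \<open>A\<close> is at most the maximal function \<open>M1\<close>, and \<open>V\<close>, \<open>U\<close>
  are at most multiples of \<open>r\<^bsup>n\<^esup> \<sigma>\<close>, \<open>r\<^bsup>n\<^esup> u\<close>; so the \<open>\<kappa>\<close>-th root of \<open>X / U\<close> is bounded by a \<open>u\<close>-average
  of \<open>F\<close>.
\<close>

lemma local_estimate:
  fixes g M1 :: "'a \<Rightarrow> real"
  defines "h \<equiv> \<lambda>y. g y * \<sigma> y powr (- 1 / p y)"
  defines "H \<equiv> \<lambda>y. 1 + h y powr (p y / \<kappa>)"
  defines "F \<equiv> \<lambda>y. M1 y * (\<sigma> y / u y) powr (1 / \<kappa>)"
  assumes x: "x \<in> S" "0 < r" "r \<le> D"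
    and g: "g \<in> borel_measurable (lebesgue_on S)" "\<And>y. 0 \<le> g y"
    and HK: "(\<integral>\<^sup>+y. ennreal (H y powr \<kappa> * \<sigma> y) \<partial>lebesgue_on S) \<le> ennreal K3"
    and M1: "\<And>y. 0 \<le> M1 y" "AE y in lebesgue_on S. \<forall>z\<in>S. \<forall>r>0. y \<in> ball z r \<longrightarrow>
       ball_mass S (\<lambda>x. H x * \<sigma> x) z r \<le> ennreal (M1 y) * ball_mass S \<sigma> z r"
    and M2: "0 \<le> M2" "ball_mass S (\<lambda>y. F y * u y) x r \<le> ennreal M2 * ball_mass S u x r"
    and sx: "ball_mass S \<sigma> x r \<le> ennreal (Cs * r ^ DIM('a) * \<sigma> x)" "1 \<le> \<sigma> x" "1 \<le> u x"
  shows "ennreal (w x * r powr (\<beta> - real DIM('a))) * ball_mass S (\<lambda>y. g y * winv y) x r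
    \<le> ennreal (K0 * (u x * (K7 * M2) powr \<kappa>) powr iq x)"
proof -
  let ?n = "DIM('a)"
  let ?M = "lebesgue_on S"
  have [measurable]: "p \<in> borel_measurable ?M" "u \<in> borel_measurable ?M" "\<sigma> \<in> borel_measurable ?M" "g \<in> borel_measurable ?M"
    using p_meas Aud Asd g by auto
  have hm[measurable]: "h \<in> borel_measurable ?M" unfolding h_def by measurable
  have Hm[measurable]: "H \<in> borel_measurable ?M" unfolding H_def by measurable
  have h0: "0 \<le> h y" for y using g by (simp add: h_def)
  have H1: "1 \<le> H y" for y by (simp add: H_def)
  have n: "0 < ?n" by simp
  obtain U where U: "ball_mass S u x r = ennreal U" "0 < U" "c * r ^ ?n \<le> U" "U \<le> Tu"
    "AE y in ?M. y \<in> ball x r \<longrightarrow> U \<le> Cu * r ^ ?n * u y"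
    by (rule A1_on_ball[OF R Au Tu x])
  obtain V where V: "ball_mass S \<sigma> x r = ennreal V" "0 < V" "c * r ^ ?n \<le> V" "V \<le> Ts"
    "AE y in ?M. y \<in> ball x r \<longrightarrow> V \<le> Cs * r ^ ?n * \<sigma> y"
    by (rule A1_on_ball[OF R As Ts(1) x])
  have "ball_mass S (\<lambda>y. H y * \<sigma> y) x r \<le> (\<integral>\<^sup>+y. ennreal (H y powr \<kappa> * \<sigma> y) \<partial>?M)"
    unfolding ball_mass_def
  proof (intro nn_integral_mono_AE)
    show "AE y in ?M. ennreal (H y * \<sigma> y) * indicator (ball x r) y \<le> ennreal (H y powr \<kappa> * \<sigma> y)"
      using Asd(3)
    proof eventually_elim
      case (elim y)
      have "H y powr 1 \<le> H y powr \<kappa>" using H1[of y] kap by (intro powr_mono) auto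
      then have "H y * \<sigma> y \<le> H y powr \<kappa> * \<sigma> y" using H1[of y] elim by (intro mult_right_mono) auto
      then show ?case by (auto simp: indicator_def intro: ennreal_leI)
    qed
  qed
  then have WK: "ball_mass S (\<lambda>y. H y * \<sigma> y) x r \<le> ennreal K3" using HK by order
  then have "ball_mass S (\<lambda>y. H y * \<sigma> y) x r < top" by (rule le_less_trans) simp
  then obtain W where W: "ball_mass S (\<lambda>y. H y * \<sigma> y) x r = ennreal W" "0 \<le> W"
    by (cases "ball_mass S (\<lambda>y. H y * \<sigma> y) x r") auto
  have WK3: "W \<le> K3" using WK W K_pos(2) by (simp add: ennreal_le_iff)
  have "ennreal V \<le> ennreal W"
    unfolding V(1)[symmetric] W(1)[symmetric] ball_mass_def
  proof (intro nn_integral_mono_AE)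
    show "AE y in ?M. ennreal (\<sigma> y) * indicator (ball x r) y \<le> ennreal (H y * \<sigma> y) * indicator (ball x r) y"
      using Asd(3)
    proof eventually_elim
      case (elim y)
      have "1 * \<sigma> y \<le> H y * \<sigma> y" using H1[of y] elim by (intro mult_right_mono) auto
      then show ?case by (auto simp: indicator_def intro: ennreal_leI)
    qed
  qed
  then have VW: "V \<le> W" using W by (simp add: ennreal_le_iff)
  define A where "A = W / V"
  have A: "1 \<le> A" "W = A * V" using VW V by (auto simp: A_def)
  have Ar: "A * r ^ ?n \<le> K3 / c"
  proof -
    have "A * (c * r ^ ?n) \<le> A * V" using V A by (intro mult_left_mono) auto
    also have "\<dots> \<le> K3" using A WK3 by simp
    finally show ?thesis using Rd(3) by (simp add: field_simps)
  qed
  define t where "t = A powr (\<kappa> / p x)"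
  have t0: "0 < t" using A by (simp add: t_def)
  have px: "1 < p x" using p_pos x by auto
  define B where "B = K1 * (U / r ^ ?n) powr (- iq x)"
  have B0: "0 < B" using K_pos U x by (simp add: B_def)
  \<comment> \<open>Both weights leave the integral: \<open>u\<close> through its average over the ball, \<open>h\<close> through the level \<open>t\<close>.\<close>
  have pull: "AE y in ?M. y \<in> ball x r \<longrightarrow> g y * winv y \<le> B * (t * \<sigma> y + K2 * t / A * (H y * \<sigma> y))"
    using U(5) in_S Aud(3) Asd(3)
  proof eventually_elim
    case (elim y)
    show ?case
    proof
      assume y: "y \<in> ball x r"
      have yS: "y \<in> S" using elim by simp
      have py: "1 < p y" using p_pos yS by auto
      have "(U / r ^ ?n) powr (iq x - iq y) \<le> exp (1 * (\<bar>ln c\<bar> + \<bar>ln Tu\<bar>) + real ?n * L)"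
      proof (rule powr_variation_bounded[OF Rd(3) _ x(2)])
        show "c \<le> U / r ^ ?n" using U x by (simp add: field_simps)
        show "U / r ^ ?n * r ^ ?n \<le> Tu" using U x by simp
        have "iq x - iq y = 1 / p x - 1 / p y" by (simp add: iq_def)
        then show "\<bar>iq x - iq y\<bar> \<le> 1" "\<bar>iq x - iq y\<bar> * ln (1 / r) \<le> L"
          using recip_p_diff[OF x(1) yS] LH_ball[OF x(1) yS y x(2)] by auto
      qed (rule L0)
      then have "max 1 Cu * ((U / r ^ ?n) powr (- iq x) * (U / r ^ ?n) powr (iq x - iq y))
          \<le> max 1 Cu * ((U / r ^ ?n) powr (- iq x) * exp (1 * (\<bar>ln c\<bar> + \<bar>ln Tu\<bar>) + real ?n * L))"
        by (intro mult_left_mono) auto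
      moreover have "u y powr (- iq y) \<le> max 1 Cu * (U / r ^ ?n) powr (- iq y)"
        using U(2) Aud(1) x elim(1) y iq_range[OF yS] by (intro powr_minus_le_average) auto
      ultimately have uy: "u y powr (- iq y) \<le> B"
        by (simp add: B_def K1_def powr_add[symmetric] mult_ac)
      have "A powr ((p x - p y) / p x) \<le> K2"
        unfolding K2_def
      proof (rule powr_variation_bounded[OF _ A(1) x(2) Ar])
        have "\<bar>(p x - p y) / p x\<bar> = \<bar>p x - p y\<bar> / p x" using px by simp
        also have "\<dots> \<le> \<bar>p x - p y\<bar> / 1" using px by (intro divide_left_mono) auto
        finally have le: "\<bar>(p x - p y) / p x\<bar> \<le> \<bar>p x - p y\<bar>" by simp
        then show "\<bar>(p x - p y) / p x\<bar> \<le> P" using p_range[OF x(1)] p_range[OF yS] kap by linarith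
        show "\<bar>(p x - p y) / p x\<bar> * ln (1 / r) \<le> L" by (rule LH_ball[OF x(1) yS y x(2) le])
      qed (use L0 in auto)
      then have "h y \<le> t + K2 * t / A * h y powr (p y / \<kappa>)"
        unfolding t_def using kap p_range[OF x(1)] p_range[OF yS] h0 A
        by (intro variable_Jensen_pointwise) auto
      also have "\<dots> \<le> t + K2 * t / A * H y"
        using K_pos(3) t0 A by (intro add_left_mono mult_left_mono) (auto simp: H_def)
      finally have "h y * \<sigma> y \<le> (t + K2 * t / A * H y) * \<sigma> y" using elim by (intro mult_right_mono) auto
      moreover have "g y * \<sigma> y powr (1 - 1 / p y) = h y * \<sigma> y"
        using elim by (simp add: h_def powr_diff powr_minus_divide)
      ultimately have "g y * \<sigma> y powr (1 - 1 / p y) \<le> t * \<sigma> y + K2 * t / A * (H y * \<sigma> y)"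
        by (simp add: algebra_simps)
      then have "u y powr (- iq y) * (g y * \<sigma> y powr (1 - 1 / p y)) \<le> B * (t * \<sigma> y + K2 * t / A * (H y * \<sigma> y))"
        using uy B0 g by (intro mult_mono) auto
      then show "g y * winv y \<le> B * (t * \<sigma> y + K2 * t / A * (H y * \<sigma> y))"
        by (simp add: winv_def mult_ac)
    qed
  qed
  have mass: "ball_mass S (\<lambda>y. g y * winv y) x r \<le> ennreal (B * (t * V * (1 + K2)))"
  proof -
    have k: "0 \<le> B * t" "0 \<le> B * (K2 * t / A)" using B0 t0 K_pos(3) A by auto
    have "ball_mass S (\<lambda>y. g y * winv y) x r \<le> (\<integral>\<^sup>+y. ennreal (B * t) * (ennreal (\<sigma> y) * indicator (ball x r) y)
        + ennreal (B * (K2 * t / A)) * (ennreal (H y * \<sigma> y) * indicator (ball x r) y) \<partial>?M)"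
      unfolding ball_mass_def
    proof (intro nn_integral_mono_AE)
      show "AE y in ?M. ennreal (g y * winv y) * indicator (ball x r) y \<le> ennreal (B * t) * (ennreal (\<sigma> y) * indicator (ball x r) y)
        + ennreal (B * (K2 * t / A)) * (ennreal (H y * \<sigma> y) * indicator (ball x r) y)"
        using pull Asd(3)
      proof eventually_elim
        case (elim y)
        show ?case
        proof (cases "y \<in> ball x r")
          case True
          have "ennreal (g y * winv y) \<le> ennreal (B * t * \<sigma> y + B * (K2 * t / A) * (H y * \<sigma> y))"
            using elim True by (intro ennreal_leI) (simp add: algebra_simps)
          also have "\<dots> = ennreal (B * t * \<sigma> y) + ennreal (B * (K2 * t / A) * (H y * \<sigma> y))"
            using k elim H1[of y] by (intro ennreal_plus mult_nonneg_nonneg[OF k(1)] mult_nonneg_nonneg[OF k(2)] mult_nonneg_nonneg) auto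
          also have "\<dots> = ennreal (B * t) * ennreal (\<sigma> y) + ennreal (B * (K2 * t / A)) * ennreal (H y * \<sigma> y)"
            using k elim H1[of y] by (intro arg_cong2[where f="(+)"] ennreal_mult mult_nonneg_nonneg[of "H y"]) auto
          finally show ?thesis using True by simp
        qed auto
      qed
    qed
    also have "\<dots> = ennreal (B * t) * ennreal V + ennreal (B * (K2 * t / A)) * ennreal W"
      unfolding V(1)[symmetric] W(1)[symmetric] ball_mass_def
      by (subst nn_integral_add, measurable) (subst nn_integral_cmult, measurable, subst nn_integral_cmult, measurable)
    also have "\<dots> = ennreal (B * t * V) + ennreal (B * (K2 * t / A) * W)"
      using k V W by (intro arg_cong2[where f="(+)"] ennreal_mult[symmetric]) auto
    also have "\<dots> = ennreal (B * t * V + B * (K2 * t / A) * W)"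
      using k V W by (intro ennreal_plus[symmetric] mult_nonneg_nonneg[OF k(1)] mult_nonneg_nonneg[OF k(2)]) auto
    also have "B * t * V + B * (K2 * t / A) * W = B * (t * V * (1 + K2))"
      using A by (simp add: algebra_simps)
    finally show ?thesis .
  qed
  define X where "X = V * A powr \<kappa>"
  have X0: "0 < X" using V A by (simp add: X_def)
  have XK: "X \<le> 2 powr \<kappa> * K3"
    unfolding X_def
  proof (rule average_power_le[OF _ _ Hm _ kap V(1)])
    show "AE y in ?M. 0 \<le> \<sigma> y" using Asd(3) by eventually_elim auto
    show "0 \<le> H y" for y using H1[of y] by linarith
    show "ball_mass S (\<lambda>y. H y * \<sigma> y) x r = ennreal (A * V)" using W A by simp
  qed (use V A K_pos HK in auto)
  have XU: "X / U \<le> (K7 * M2) powr \<kappa>"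
  proof -
    define a where "a = 1 / \<kappa>"
    have a: "0 < a" "a < 1" using kap by (auto simp: a_def)
    \<comment> \<open>\<open>Q / U\<close> is the \<open>\<kappa>\<close>-th root of \<open>X / U\<close>.\<close>
    define Q where "Q = A * V powr a * U powr (1 - a)"
    define Cc where "Cc = Cs powr a * Cu powr (1 - a)"
    have Cc: "0 < Cc" using Asd(1) Aud(1) by (simp add: Cc_def)
    have Q0: "0 \<le> Q" using A by (simp add: Q_def)
    have "AE y in ?M. y \<in> ball x r \<longrightarrow> Q / (Cc * r ^ ?n) \<le> F y * u y"
      using U(5) V(5) M1(2) Aud(3) Asd(3)
    proof eventually_elim
      case (elim y)
      show ?case
      proof
        assume y: "y \<in> ball x r"
        have "ennreal W \<le> ennreal (M1 y) * ennreal V"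
          using elim(3) x y W(1) V(1) by metis
        also have "\<dots> = ennreal (M1 y * V)" using M1 V by (intro ennreal_mult[symmetric]) auto
        finally have "A * V \<le> M1 y * V" using M1 V A by (subst (asm) ennreal_le_iff) auto
        then have AM: "A \<le> M1 y" using V by simp
        have "Q \<le> M1 y * (Cs * r ^ ?n * \<sigma> y) powr a * (Cu * r ^ ?n * u y) powr (1 - a)"
          unfolding Q_def using AM A a V U elim y by (intro mult_mono powr_mono2) auto
        also have "\<dots> = Cc * ((r ^ ?n) powr a * (r ^ ?n) powr (1 - a)) * (M1 y * (\<sigma> y powr a * u y powr (1 - a)))"
          using elim x Asd(1) Aud(1) by (simp add: Cc_def powr_mult mult_ac)
        also have "(r ^ ?n) powr a * (r ^ ?n) powr (1 - a) = r ^ ?n" using x by (simp add: powr_add[symmetric])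
        also have "M1 y * (\<sigma> y powr a * u y powr (1 - a)) = F y * u y"
          using elim by (simp add: F_def a_def powr_divide powr_diff)
        finally show "Q / (Cc * r ^ ?n) \<le> F y * u y" using Cc x by (simp add: field_simps)
      qed
    qed
    then have "ennreal (Q / (Cc * r ^ ?n) * (c * r ^ ?n)) \<le> ball_mass S (\<lambda>y. F y * u y) x r"
      using Q0 Cc x by (intro ball_mass_lower[OF R x]) auto
    also note M2(2)
    also have "ennreal M2 * ball_mass S u x r = ennreal (M2 * U)" using M2 U by (simp add: ennreal_mult)
    finally have "Q / (Cc * r ^ ?n) * (c * r ^ ?n) \<le> M2 * U" using M2 U by (subst (asm) ennreal_le_iff) auto
    then have "Q \<le> K7 * M2 * U"
      using Cc x Rd(3) by (simp add: K7_def Cc_def[unfolded a_def] field_simps)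
    moreover have "Q = A * (V / U) powr a * U" using U V by (simp add: Q_def powr_divide powr_diff)
    ultimately have "A * (V / U) powr a \<le> K7 * M2" using U by simp
    then have "(A * (V / U) powr a) powr \<kappa> \<le> (K7 * M2) powr \<kappa>" using A kap by (intro powr_mono2) auto
    moreover have "(A * (V / U) powr a) powr \<kappa> = X / U"
      using A U V kap by (simp add: X_def powr_mult powr_powr a_def)
    ultimately show ?thesis by simp
  qed
  have wx: "0 \<le> w x * r powr (\<beta> - real ?n)" by (simp add: w_def)
  have "ennreal (w x * r powr (\<beta> - real ?n)) * ball_mass S (\<lambda>y. g y * winv y) x r
    \<le> ennreal (w x * r powr (\<beta> - real ?n)) * ennreal (B * (t * V * (1 + K2)))"
    by (intro mult_left_mono mass) auto
  also have "\<dots> = ennreal (w x * r powr (\<beta> - real ?n) * (B * (t * V * (1 + K2))))"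
    using wx B0 t0 V K_pos(3) by (intro ennreal_mult[symmetric]) auto
  also have "\<dots> \<le> ennreal (K0 * (u x * (K7 * M2) powr \<kappa>) powr iq x)"
  proof (rule ennreal_leI)
    have iq: "0 < iq x" using iq_range[OF x(1)] by simp
    have "ennreal V \<le> ennreal (Cs * r ^ ?n * \<sigma> x)" using sx V by simp
    then have "V \<le> Cs * r ^ ?n * \<sigma> x" using Asd(1) x sx by (subst (asm) ennreal_le_iff) auto
    then have sig: "\<sigma> x powr (- (1 - 1 / p x)) \<le> max 1 Cs * (V / r ^ ?n) powr (- (1 - 1 / p x))"
      using V Asd(1) x p_pos(2,3)[OF x(1)] by (intro powr_minus_le_average) auto
    define k where "k = u x powr iq x * (K1 * (1 + K2))"
    have k0: "0 \<le> k" using K_pos by (simp add: k_def)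
    define Y where "Y = (U / r ^ ?n) powr (- iq x) * r powr (\<beta> - real ?n) * V * t"
    have Y0: "0 \<le> Y" using V t0 by (simp add: Y_def)
    have "w x * r powr (\<beta> - real ?n) * (B * (t * V * (1 + K2))) = k * (\<sigma> x powr (- (1 - 1 / p x)) * Y)"
      by (simp add: w_def B_def k_def Y_def mult_ac)
    also have "\<dots> \<le> k * ((max 1 Cs * (V / r ^ ?n) powr (- (1 - 1 / p x))) * Y)"
      by (intro mult_left_mono mult_right_mono sig k0 Y0)
    also have "\<dots> = k * max 1 Cs * ((U / r ^ ?n) powr (- iq x) * (V / r ^ ?n) powr (- (1 - 1 / p x)) * r powr (\<beta> - real ?n) * V * A powr (\<kappa> / p x))"
      by (simp add: Y_def t_def mult_ac)
    also have "\<dots> = k * max 1 Cs * (U powr (- iq x) * X powr (1 / p x))"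
    proof -
      have "(U / r ^ ?n) powr (- iq x) * (V / r ^ ?n) powr (- (1 - 1 / p x)) * r powr (\<beta> - real ?n) * V * A powr (\<kappa> / p x)
        = U powr (- iq x) * X powr (1 / p x)"
        unfolding iq_def X_def using U V x A px n by (intro exponent_cancellation) auto
      then show ?thesis by simp
    qed
    also have "\<dots> \<le> k * max 1 Cs * (U powr (- iq x) * (X powr iq x * K6))"
    proof (intro mult_left_mono)
      have "X powr (1 / p x) = X powr iq x * X powr (\<beta> / real ?n)"
        by (simp add: powr_add[symmetric] iq_def)
      also have "X powr (\<beta> / real ?n) \<le> K6 powr (\<beta> / real ?n)"
        using X0 XK bet by (intro powr_mono2) (auto simp: K6_def)
      also have "K6 powr (\<beta> / real ?n) \<le> K6 powr 1" using K_pos(4) bet by (intro powr_mono) auto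
      finally show "X powr (1 / p x) \<le> X powr iq x * K6" using K_pos(4) by (simp add: mult_left_mono)
    qed (use k0 in auto)
    also have "\<dots> = K0 * (u x * (X / U)) powr iq x"
      using sx U X0 by (simp add: k_def K0_def powr_mult powr_divide powr_minus_divide)
    also have "\<dots> \<le> K0 * (u x * (K7 * M2) powr \<kappa>) powr iq x"
      using K_pos(6) sx U X0 XU iq by (intro mult_left_mono powr_mono2) auto
    finally show "w x * r powr (\<beta> - real ?n) * (B * (t * V * (1 + K2))) \<le> K0 * (u x * (K7 * M2) powr \<kappa>) powr iq x" .
  qed
  finally show ?thesis .
qed

text \<open>
  The function \<open>G\<close> majorises \<open>w\<close> times the fractional maximal function of \<open>g / w\<close>. Its modular is a
  multiple of the integral of \<open>M2 powr \<kappa> * u\<close>. The maximal theorem for \<open>u dx\<close> reduces this to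
  \<open>F powr \<kappa> * u = M1 powr \<kappa> * \<sigma>\<close>, and the maximal theorem for \<open>\<sigma> dx\<close> to \<open>H powr \<kappa> * \<sigma>\<close>, which is
  at most a multiple of \<open>\<sigma> + g powr p\<close>.
\<close>

proposition weighted_maximal_bound:
  obtains K where "0 \<le> K"
    "\<And>g. g \<in> borel_measurable (lebesgue_on S) \<Longrightarrow> (\<And>x. 0 \<le> g x) \<Longrightarrow>
       (\<integral>\<^sup>+x. ennreal (g x powr p x) \<partial>lebesgue_on S) \<le> 1 \<Longrightarrow>
       \<exists>G. G \<in> borel_measurable (lebesgue_on S) \<and> (\<forall>x. 0 \<le> G x) \<and>
         (AE x in lebesgue_on S. \<forall>r>0. ennreal (w x * r powr (\<beta> - real DIM('a))) *
            ball_mass S (\<lambda>y. g y * winv y) x r \<le> ennreal (G x)) \<and>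
         (\<integral>\<^sup>+x. ennreal (G x powr (1 / iq x)) \<partial>lebesgue_on S) \<le> ennreal K"
proof -
  let ?n = "DIM('a)"
  let ?M = "lebesgue_on S"
  have meas[measurable]: "p \<in> borel_measurable ?M" "u \<in> borel_measurable ?M" "\<sigma> \<in> borel_measurable ?M"
    using p_meas Aud Asd by auto
  have iqm[measurable]: "iq \<in> borel_measurable ?M" unfolding iq_def by measurable
  have Tu0: "0 < Tu"
  proof -
    obtain T' where "0 < T'" "ennreal T' = ennreal Tu" using A1_on_total[OF R Au] Tu by metis
    then show ?thesis by (metis ennreal_0 ennreal_eq_0_iff not_le)
  qed
  define J where "J C = 2 powr \<kappa> * (2 * C * 5 ^ ?n / c) * (2 powr (\<kappa> - 1) / (2 powr (\<kappa> - 1) - 1)) * 2 powr (\<kappa> - 1)" for C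
  have J: "0 \<le> J C" if "0 < C" for C
  proof -
    have "1 < 2 powr (\<kappa> - 1)" using kap by simp
    then have "0 \<le> 2 powr (\<kappa> - 1) / (2 powr (\<kappa> - 1) - 1)" by (intro divide_nonneg_nonneg) linarith+
    then show ?thesis using that Rd(3) unfolding J_def by (intro mult_nonneg_nonneg) auto
  qed
  define K8 where "K8 = Ts + J Cs * K3"
  define K9 where "K9 = Tu + J Cu * K8"
  have K8: "0 \<le> K8" using Ts J[OF Asd(1)] K_pos(2) by (simp add: K8_def)
  have K9: "0 \<le> K9" using Tu0 J[OF Aud(1)] K8 by (simp add: K9_def)
  define E where "E = 1 / (1 / P - \<beta> / real ?n)"
  define K where "K = K0 powr E * K7 powr \<kappa> * K9"
  show ?thesis
  proof (rule that[of K])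
    show "0 \<le> K" using K9 by (simp add: K_def)
    fix g :: "'a \<Rightarrow> real"
    assume g: "g \<in> borel_measurable ?M" "\<And>x. 0 \<le> g x" "(\<integral>\<^sup>+x. ennreal (g x powr p x) \<partial>?M) \<le> 1"
    note g(1)[measurable]
    define h where "h y = g y * \<sigma> y powr (- 1 / p y)" for y
    define H where "H y = 1 + h y powr (p y / \<kappa>)" for y
    have hm[measurable]: "h \<in> borel_measurable ?M" unfolding h_def by measurable
    have Hm[measurable]: "H \<in> borel_measurable ?M" unfolding H_def by measurable
    have h0: "0 \<le> h y" for y using g by (simp add: h_def)
    have H0: "0 \<le> H y" for y by (simp add: H_def)
    have HK: "(\<integral>\<^sup>+y. ennreal (H y powr \<kappa> * \<sigma> y) \<partial>?M) \<le> ennreal K3"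
    proof -
      have "(\<integral>\<^sup>+y. ennreal (H y powr \<kappa> * \<sigma> y) \<partial>?M)
        \<le> (\<integral>\<^sup>+y. ennreal (2 powr \<kappa>) * (ennreal (\<sigma> y) + ennreal (g y powr p y)) \<partial>?M)"
      proof (intro nn_integral_mono_AE)
        show "AE y in ?M. ennreal (H y powr \<kappa> * \<sigma> y) \<le> ennreal (2 powr \<kappa>) * (ennreal (\<sigma> y) + ennreal (g y powr p y))"
          using in_S Asd(3)
        proof eventually_elim
          case (elim y)
          have py: "1 < p y" using p_pos elim by auto
          have "H y powr \<kappa> \<le> 2 powr \<kappa> * (1 + h y powr p y)"
            using one_plus_powr_le[of "h y powr (p y / \<kappa>)" \<kappa>] kap by (simp add: H_def powr_powr)
          then have "H y powr \<kappa> * \<sigma> y \<le> 2 powr \<kappa> * (1 + h y powr p y) * \<sigma> y" using elim by (intro mult_right_mono) auto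
          also have "\<dots> = 2 powr \<kappa> * (\<sigma> y + h y powr p y * \<sigma> y)" by (simp add: algebra_simps)
          also have "h y powr p y * \<sigma> y = g y powr p y"
            using elim py by (simp add: h_def powr_mult powr_divide powr_powr powr_minus_divide)
          finally have "ennreal (H y powr \<kappa> * \<sigma> y) \<le> ennreal (2 powr \<kappa> * (\<sigma> y + g y powr p y))" by (rule ennreal_leI)
          also have "\<dots> = ennreal (2 powr \<kappa>) * (ennreal (\<sigma> y) + ennreal (g y powr p y))"
            using elim by (subst ennreal_mult) auto
          finally show ?case .
        qed
      qed
      also have "\<dots> = ennreal (2 powr \<kappa>) * (ennreal Ts + (\<integral>\<^sup>+y. ennreal (g y powr p y) \<partial>?M))"
        unfolding Ts(1)[symmetric]
        by (subst nn_integral_cmult, measurable) (subst nn_integral_add, measurable)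
      also have "\<dots> \<le> ennreal (2 powr \<kappa>) * (ennreal Ts + 1)" using g(3) by (intro mult_left_mono add_left_mono) auto
      also have "\<dots> = ennreal K3" using Ts(2) by (simp add: K3_def ennreal_mult)
      finally show ?thesis .
    qed
    have "(\<integral>\<^sup>+y. ennreal (H y powr \<kappa> * \<sigma> y) \<partial>?M) < \<infinity>" using HK by (rule le_less_trans) simp
    then obtain M1 where M1: "M1 \<in> borel_measurable ?M" "\<And>y. 0 \<le> M1 y"
      "AE y in ?M. \<forall>z\<in>S. \<forall>r>0. y \<in> ball z r \<longrightarrow> ball_mass S (\<lambda>x. H x * \<sigma> x) z r \<le> ennreal (M1 y) * ball_mass S \<sigma> z r"
      "(\<integral>\<^sup>+x. ennreal (M1 x powr \<kappa> * \<sigma> x) \<partial>?M) \<le> ennreal Ts + ennreal (J Cs) * (\<integral>\<^sup>+y. ennreal (H y powr \<kappa> * \<sigma> y) \<partial>?M)"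
      using maximal_majorant[OF R As kap Ts(1) Hm H0] unfolding J_def by blast
    note M1(1)[measurable]
    have M1K: "(\<integral>\<^sup>+x. ennreal (M1 x powr \<kappa> * \<sigma> x) \<partial>?M) \<le> ennreal K8"
    proof -
      have "ennreal Ts + ennreal (J Cs) * (\<integral>\<^sup>+y. ennreal (H y powr \<kappa> * \<sigma> y) \<partial>?M) \<le> ennreal Ts + ennreal (J Cs) * ennreal K3"
        using HK by (intro add_left_mono mult_left_mono) auto
      also have "\<dots> = ennreal K8" using Ts(2) J[OF Asd(1)] K_pos(2) by (simp add: K8_def ennreal_mult)
      finally show ?thesis using M1(4) by order
    qed
    define F where "F y = M1 y * (\<sigma> y / u y) powr (1 / \<kappa>)" for y
    have Fm[measurable]: "F \<in> borel_measurable ?M" unfolding F_def by measurable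
    have F0: "0 \<le> F y" for y using M1(2) by (simp add: F_def)
    have FK: "(\<integral>\<^sup>+y. ennreal (F y powr \<kappa> * u y) \<partial>?M) \<le> ennreal K8"
    proof -
      have "(\<integral>\<^sup>+y. ennreal (F y powr \<kappa> * u y) \<partial>?M) = (\<integral>\<^sup>+y. ennreal (M1 y powr \<kappa> * \<sigma> y) \<partial>?M)"
      proof (intro nn_integral_cong_AE)
        show "AE y in ?M. ennreal (F y powr \<kappa> * u y) = ennreal (M1 y powr \<kappa> * \<sigma> y)"
          using Aud(3) Asd(3)
        proof eventually_elim
          case (elim y)
          have "((\<sigma> y / u y) powr (1 / \<kappa>)) powr \<kappa> = \<sigma> y / u y" using kap elim by (simp add: powr_powr)
          then show ?case using elim by (simp add: F_def powr_mult)
        qed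
      qed
      then show ?thesis using M1K by simp
    qed
    have "(\<integral>\<^sup>+y. ennreal (F y powr \<kappa> * u y) \<partial>?M) < \<infinity>" using FK by (rule le_less_trans) simp
    then obtain M2 where M2: "M2 \<in> borel_measurable ?M" "\<And>y. 0 \<le> M2 y"
      "AE y in ?M. \<forall>z\<in>S. \<forall>r>0. y \<in> ball z r \<longrightarrow> ball_mass S (\<lambda>x. F x * u x) z r \<le> ennreal (M2 y) * ball_mass S u z r"
      "(\<integral>\<^sup>+x. ennreal (M2 x powr \<kappa> * u x) \<partial>?M) \<le> ennreal Tu + ennreal (J Cu) * (\<integral>\<^sup>+y. ennreal (F y powr \<kappa> * u y) \<partial>?M)"
      using maximal_majorant[OF R Au kap Tu Fm F0] unfolding J_def by blast
    note M2(1)[measurable]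
    have M2K: "(\<integral>\<^sup>+x. ennreal (M2 x powr \<kappa> * u x) \<partial>?M) \<le> ennreal K9"
    proof -
      have "ennreal Tu + ennreal (J Cu) * (\<integral>\<^sup>+y. ennreal (F y powr \<kappa> * u y) \<partial>?M) \<le> ennreal Tu + ennreal (J Cu) * ennreal K8"
        using FK by (intro add_left_mono mult_left_mono) auto
      also have "\<dots> = ennreal K9" using Tu0 J[OF Aud(1)] K8 by (simp add: K9_def ennreal_mult)
      finally show ?thesis using M2(4) by order
    qed
    define G where "G x = K0 * (u x * (K7 * M2 x) powr \<kappa>) powr iq x" for x
    have "AE x in ?M. \<forall>r>0. ennreal (w x * r powr (\<beta> - real ?n)) * ball_mass S (\<lambda>y. g y * winv y) x r \<le> ennreal (G x)"
      using M2(3) Asd(3,4) Aud(3) in_S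
    proof eventually_elim
      case (elim x)
      have x: "x \<in> S" by (rule elim)
      have small: "ennreal (w x * r powr (\<beta> - real ?n)) * ball_mass S (\<lambda>y. g y * winv y) x r \<le> ennreal (G x)"
        if r: "0 < r" "r \<le> D" for r
        unfolding G_def
      proof (rule local_estimate[OF x r g(1,2) _ M1(2) _ M2(2)])
        show "(\<integral>\<^sup>+y. ennreal ((1 + (g y * \<sigma> y powr (- 1 / p y)) powr (p y / \<kappa>)) powr \<kappa> * \<sigma> y) \<partial>?M) \<le> ennreal K3"
          using HK unfolding H_def h_def .
        show "AE y in ?M. \<forall>z\<in>S. \<forall>r>0. y \<in> ball z r \<longrightarrow>
          ball_mass S (\<lambda>x. (1 + (g x * \<sigma> x powr (- 1 / p x)) powr (p x / \<kappa>)) * \<sigma> x) z r \<le> ennreal (M1 y) * ball_mass S \<sigma> z r"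
          using M1(3) unfolding H_def h_def .
        show "ball_mass S (\<lambda>y. M1 y * (\<sigma> y / u y) powr (1 / \<kappa>) * u y) x r \<le> ennreal (M2 x) * ball_mass S u x r"
          using elim(1) x r unfolding F_def by simp
        show "ball_mass S \<sigma> x r \<le> ennreal (Cs * r ^ ?n * \<sigma> x)" using elim(3) x r by simp
      qed (use elim in auto)
      show ?case
      proof (intro allI impI)
        fix r :: real assume r: "0 < r"
        show "ennreal (w x * r powr (\<beta> - real ?n)) * ball_mass S (\<lambda>y. g y * winv y) x r \<le> ennreal (G x)"
        proof (cases "r \<le> D")
          case False
          have "r powr (\<beta> - real ?n) \<le> D powr (\<beta> - real ?n)" using False bet Rd(4) by (intro powr_mono2') auto
          then have wle: "w x * r powr (\<beta> - real ?n) \<le> w x * D powr (\<beta> - real ?n)" by (intro mult_left_mono) (auto simp: w_def)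
          have eq: "ball_mass S v x r = ball_mass S v x D" for v
            using ball_mass_large[OF R x, of r v] ball_mass_large[OF R x, of D v] False by simp
          have "ennreal (w x * r powr (\<beta> - real ?n)) * ball_mass S (\<lambda>y. g y * winv y) x r
            \<le> ennreal (w x * D powr (\<beta> - real ?n)) * ball_mass S (\<lambda>y. g y * winv y) x D"
            unfolding eq by (rule mult_right_mono[OF ennreal_leI[OF wle]]) simp
          also have "\<dots> \<le> ennreal (G x)" using small[of D] Rd(4) by simp
          finally show ?thesis .
        qed (use small r in auto)
      qed
    qed
    moreover have "(\<integral>\<^sup>+x. ennreal (G x powr (1 / iq x)) \<partial>?M) \<le> ennreal K"
    proof -
      have "(\<integral>\<^sup>+x. ennreal (G x powr (1 / iq x)) \<partial>?M) \<le> (\<integral>\<^sup>+x. ennreal (K0 powr E * K7 powr \<kappa>) * ennreal (M2 x powr \<kappa> * u x) \<partial>?M)"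
      proof (intro nn_integral_mono_AE)
        show "AE x in ?M. ennreal (G x powr (1 / iq x)) \<le> ennreal (K0 powr E * K7 powr \<kappa>) * ennreal (M2 x powr \<kappa> * u x)"
          using in_S Aud(3)
        proof eventually_elim
          case (elim x)
          note iq = iq_range[OF elim(1)]
          have "1 / iq x \<le> E" unfolding E_def using iq bet by (intro divide_left_mono) auto
          then have KE: "K0 powr (1 / iq x) \<le> K0 powr E" using K_pos(6) by (intro powr_mono) auto
          have "G x powr (1 / iq x) = K0 powr (1 / iq x) * (u x * (K7 * M2 x) powr \<kappa>)"
            using iq elim by (simp add: G_def powr_mult powr_powr)
          also have "\<dots> \<le> K0 powr E * (u x * (K7 * M2 x) powr \<kappa>)" using KE elim by (intro mult_right_mono) auto
          also have "\<dots> = K0 powr E * K7 powr \<kappa> * (M2 x powr \<kappa> * u x)" by (simp add: powr_mult mult_ac)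
          finally show ?case using elim by (simp add: ennreal_mult[symmetric] ennreal_leI)
        qed
      qed
      also have "\<dots> = ennreal (K0 powr E * K7 powr \<kappa>) * (\<integral>\<^sup>+x. ennreal (M2 x powr \<kappa> * u x) \<partial>?M)"
        by (rule nn_integral_cmult) measurable
      also have "\<dots> \<le> ennreal (K0 powr E * K7 powr \<kappa>) * ennreal K9" by (intro mult_left_mono M2K) auto
      also have "\<dots> = ennreal K" unfolding K_def using K9 by (intro ennreal_mult[symmetric]) auto
      finally show ?thesis .
    qed
    moreover have "G \<in> borel_measurable ?M" unfolding G_def by measurable
    moreover have "\<forall>x. 0 \<le> G x" using K_pos(6) by (simp add: G_def)
    ultimately show "\<exists>G. G \<in> borel_measurable ?M \<and> (\<forall>x. 0 \<le> G x) \<and>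
         (AE x in ?M. \<forall>r>0. ennreal (w x * r powr (\<beta> - real ?n)) * ball_mass S (\<lambda>y. g y * winv y) x r \<le> ennreal (G x)) \<and>
         (\<integral>\<^sup>+x. ennreal (G x powr (1 / iq x)) \<partial>?M) \<le> ennreal K"
      by blast
  qed
qed

end

section \<open>The weighted fractional integral\<close>

text \<open>
  On the \<open>k\<close>-th annulus the kernel is at most its value at distance \<open>\<rho> k / 2\<close>, and the mass of \<open>f\<close> is
  controlled by the fractional maximal function of order \<open>a - s\<close>, which leaves the summand \<open>\<rho> k powr s\<close>.
  It will be used for annuli shrinking to \<open>x\<close> with \<open>s > 0\<close> and for growing annuli with \<open>s < 0\<close>.
\<close>

lemma annuli_bound:
  fixes S :: "'a::euclidean_space set" and f :: "'a \<Rightarrow> real"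
  assumes f: "f \<in> borel_measurable (lebesgue_on S)" "\<And>y. 0 \<le> f y"
    and om: "0 \<le> \<omega>" and a: "a < real DIM('a)" and rho: "\<And>k::nat. 0 < \<rho> k" and A: "0 \<le> A"
    and bound: "\<And>k. ennreal (\<omega> * \<rho> k powr (a - s - real DIM('a))) * ball_mass S f x (\<rho> k) \<le> ennreal A"
    and Z: "(\<lambda>k. \<rho> k powr s) sums Z"
    and cover: "\<And>y. y \<in> E \<Longrightarrow> \<exists>k. \<rho> k / 2 \<le> norm (x - y) \<and> norm (x - y) < \<rho> k"
  shows "ennreal \<omega> * (\<integral>\<^sup>+y\<in>E. ennreal (f y * norm (x - y) powr (a - real DIM('a))) \<partial>lebesgue_on S)
    \<le> ennreal (2 powr (real DIM('a) - a) * A * Z)"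
proof -
  let ?n = "real DIM('a)"
  let ?M = "lebesgue_on S"
  note f(1)[measurable]
  define cf where "cf k = (\<rho> k / 2) powr (a - ?n)" for k
  have "(\<integral>\<^sup>+y\<in>E. ennreal (f y * norm (x - y) powr (a - ?n)) \<partial>?M)
    \<le> (\<integral>\<^sup>+y. (\<Sum>k. ennreal (cf k) * (ennreal (f y) * indicator (ball x (\<rho> k)) y)) \<partial>?M)"
  proof (intro nn_integral_mono)
    fix y
    show "ennreal (f y * norm (x - y) powr (a - ?n)) * indicator E y
      \<le> (\<Sum>k. ennreal (cf k) * (ennreal (f y) * indicator (ball x (\<rho> k)) y))"
    proof (cases "y \<in> E")
      case True
      then obtain k where k: "\<rho> k / 2 \<le> norm (x - y)" "norm (x - y) < \<rho> k" using cover by blast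
      have "norm (x - y) powr (a - ?n) \<le> cf k"
        unfolding cf_def using k rho[of k] a by (intro powr_mono2') auto
      then have "norm (x - y) powr (a - ?n) * f y \<le> cf k * f y"
        using f(2)[of y] by (rule mult_right_mono)
      then have "f y * norm (x - y) powr (a - ?n) \<le> cf k * f y" by (simp only: mult.commute)
      then have "ennreal (f y * norm (x - y) powr (a - ?n)) \<le> ennreal (cf k * f y)" by (rule ennreal_leI)
      also have "\<dots> = ennreal (cf k) * (ennreal (f y) * indicator (ball x (\<rho> k)) y)"
        using k f(2)[of y] by (simp add: dist_norm ennreal_mult cf_def)
      also have "\<dots> \<le> (\<Sum>k. ennreal (cf k) * (ennreal (f y) * indicator (ball x (\<rho> k)) y))"
        using sum_le_suminf[of "\<lambda>k. ennreal (cf k) * (ennreal (f y) * indicator (ball x (\<rho> k)) y)" "{k}"] by simp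
      finally show ?thesis using True by simp
    qed auto
  qed
  also have "\<dots> = (\<Sum>k. \<integral>\<^sup>+y. ennreal (cf k) * (ennreal (f y) * indicator (ball x (\<rho> k)) y) \<partial>?M)"
    by (rule nn_integral_suminf) measurable
  also have "\<dots> = (\<Sum>k. ennreal (cf k) * ball_mass S f x (\<rho> k))"
    unfolding ball_mass_def by (subst nn_integral_cmult, measurable)
  finally have "ennreal \<omega> * (\<integral>\<^sup>+y\<in>E. ennreal (f y * norm (x - y) powr (a - ?n)) \<partial>?M)
    \<le> ennreal \<omega> * (\<Sum>k. ennreal (cf k) * ball_mass S f x (\<rho> k))"
    by (rule mult_left_mono) auto
  also have "\<dots> = (\<Sum>k. ennreal \<omega> * (ennreal (cf k) * ball_mass S f x (\<rho> k)))" by simp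
  also have "\<dots> \<le> (\<Sum>k. ennreal (2 powr (?n - a) * A * \<rho> k powr s))"
  proof (intro suminf_le)
    fix k
    have eq: "\<omega> * cf k = (2 powr (?n - a) * \<rho> k powr s) * (\<omega> * \<rho> k powr (a - s - ?n))"
    proof -
      have "cf k = \<rho> k powr (a - ?n) / 2 powr (a - ?n)" unfolding cf_def by (rule powr_divide)
      also have "\<rho> k powr (a - ?n) = \<rho> k powr s * \<rho> k powr (a - s - ?n)" by (simp add: powr_add[symmetric])
      finally have "cf k = \<rho> k powr s * \<rho> k powr (a - s - ?n) * (1 / 2 powr (a - ?n))" by simp
      also have "1 / 2 powr (a - ?n) = 2 powr (?n - a)" using powr_minus_divide[of 2 "a - ?n"] by simp
      finally show ?thesis by simp
    qed
    have "ennreal \<omega> * (ennreal (cf k) * ball_mass S f x (\<rho> k)) = ennreal (\<omega> * cf k) * ball_mass S f x (\<rho> k)"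
      using om by (simp add: ennreal_mult mult.assoc cf_def)
    also have "\<dots> = ennreal (2 powr (?n - a) * \<rho> k powr s) * (ennreal (\<omega> * \<rho> k powr (a - s - ?n)) * ball_mass S f x (\<rho> k))"
      unfolding eq mult.assoc[symmetric]
      using om by (subst ennreal_mult[symmetric]) (auto simp: mult.assoc)
    also have "\<dots> \<le> ennreal (2 powr (?n - a) * \<rho> k powr s) * ennreal A" by (intro mult_left_mono bound) auto
    also have "\<dots> = ennreal (2 powr (?n - a) * A * \<rho> k powr s)"
      using A by (simp add: ennreal_mult[symmetric] mult_ac)
    finally show "ennreal \<omega> * (ennreal (cf k) * ball_mass S f x (\<rho> k)) \<le> ennreal (2 powr (?n - a) * A * \<rho> k powr s)" .
  qed auto
  also have "\<dots> = ennreal (2 powr (?n - a) * A * Z)"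
    using A by (intro suminf_ennreal_eq sums_mult Z) auto
  finally show ?thesis .
qed

text \<open>
  Welland's inequality before optimisation: \<open>A\<close> and \<open>B\<close> bound \<open>\<omega>\<close> times the fractional maximal functions of the
  orders \<open>a - e\<close> and \<open>a + e\<close> at \<open>x\<close>, and \<open>t\<close> is the radius at which one passes from the first to
  the second. The factor \<open>\<omega>\<close> is the value of the weight at \<open>x\<close>.
\<close>

lemma potential_le_maximal:
  fixes S :: "'a::euclidean_space set" and f :: "'a \<Rightarrow> real"
  assumes f: "f \<in> borel_measurable (lebesgue_on S)" "\<And>y. 0 \<le> f y"
    and om: "0 \<le> \<omega>" and a: "a < real DIM('a)" and e: "0 < e" and t: "0 < t" and A: "0 \<le> A" and B: "0 \<le> B"
    and bA: "\<And>r. 0 < r \<Longrightarrow> ennreal (\<omega> * r powr (a - e - real DIM('a))) * ball_mass S f x r \<le> ennreal A"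
    and bB: "\<And>r. 0 < r \<Longrightarrow> ennreal (\<omega> * r powr (a + e - real DIM('a))) * ball_mass S f x r \<le> ennreal B"
  shows "ennreal \<omega> * (\<integral>\<^sup>+y. ennreal (f y * norm (x - y) powr (a - real DIM('a))) \<partial>lebesgue_on S)
    \<le> ennreal (2 powr (real DIM('a) - a) / (1 - 2 powr (- e)) * (t powr e * A + t powr (- e) * B))"
proof -
  let ?n = "real DIM('a)"
  let ?M = "lebesgue_on S"
  define q where "q = 2 powr (- e)"
  have q: "0 < q" "q < 1" using e powr_less_mono[of "- e" 0 2] by (auto simp: q_def)
  have geo: "(\<lambda>k. q ^ k) sums (1 / (1 - q))" using q by (intro geometric_sums) auto
  have pq: "(2 ^ k) powr (- e) = q ^ k" for k :: nat
    by (simp add: q_def powr_powr powr_realpow[symmetric] mult.commute)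
  let ?I = "ball x t - {x}" and ?O = "- ball x t"
  have m: "(\<lambda>y. ennreal (f y * norm (x - y) powr (a - ?n))) \<in> borel_measurable ?M"
  proof -
    have "(\<lambda>y. norm (x - y)) \<in> borel_measurable ?M"
      by (intro measurable_restrict_space1) (simp add: measurable_completion)
    then show ?thesis using f(1) by measurable
  qed
  have I: "ennreal \<omega> * (\<integral>\<^sup>+y\<in>?I. ennreal (f y * norm (x - y) powr (a - ?n)) \<partial>?M) \<le> ennreal (2 powr (?n - a) * A * (t powr e * (1 / (1 - q))))"
  proof (rule annuli_bound[OF f om a, where \<rho>="\<lambda>k. t / 2 ^ k" and s=e])
    show "0 < t / 2 ^ k" for k using t by simp
    then show "ennreal (\<omega> * (t / 2 ^ k) powr (a - e - ?n)) * ball_mass S f x (t / 2 ^ k) \<le> ennreal A" for k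
      by (intro bA)
    have "(t / 2 ^ k) powr e = t powr e * q ^ k" for k
      unfolding pq[symmetric] by (simp add: powr_divide powr_minus_divide)
    then show "(\<lambda>k. (t / 2 ^ k) powr e) sums (t powr e * (1 / (1 - q)))" using sums_mult[OF geo] by simp
    fix y assume y: "y \<in> ?I"
    then have d: "0 < norm (x - y)" "norm (x - y) < t" by (auto simp: dist_norm)
    define j where "j = (LEAST k. t / 2 ^ k \<le> norm (x - y))"
    obtain k :: nat where "t / norm (x - y) < 2 ^ k" using real_arch_pow[of 2 "t / norm (x - y)"] by auto
    then have "t / 2 ^ k \<le> norm (x - y)" using d by (simp add: field_simps)
    then have j: "t / 2 ^ j \<le> norm (x - y)" unfolding j_def by (rule LeastI)
    show "\<exists>k. t / 2 ^ k / 2 \<le> norm (x - y) \<and> norm (x - y) < t / 2 ^ k"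
    proof (cases j)
      case 0 then show ?thesis using j d by simp
    next
      case (Suc i)
      then have "\<not> t / 2 ^ i \<le> norm (x - y)" using not_less_Least[of i "\<lambda>k. t / 2 ^ k \<le> norm (x - y)"] by (simp add: j_def)
      then show ?thesis using j Suc by (intro exI[of _ i]) (simp add: field_simps)
    qed
  qed (rule A)
  have O: "ennreal \<omega> * (\<integral>\<^sup>+y\<in>?O. ennreal (f y * norm (x - y) powr (a - ?n)) \<partial>?M) \<le> ennreal (2 powr (?n - a) * B * (t powr (- e) * q * (1 / (1 - q))))"
  proof (rule annuli_bound[OF f om a, where \<rho>="\<lambda>k. 2 * t * 2 ^ k" and s="- e"])
    show p: "0 < 2 * t * 2 ^ k" for k using t by simp
    show "ennreal (\<omega> * (2 * t * 2 ^ k) powr (a - (- e) - ?n)) * ball_mass S f x (2 * t * 2 ^ k) \<le> ennreal B" for k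
      using bB[OF p, of k] by simp
    have "(2 * t * 2 ^ k) powr (- e) = t powr (- e) * q * q ^ k" for k
      by (simp add: powr_mult pq q_def[symmetric])
    then show "(\<lambda>k. (2 * t * 2 ^ k) powr (- e)) sums (t powr (- e) * q * (1 / (1 - q)))" using sums_mult[OF geo] by simp
    fix y assume y: "y \<in> ?O"
    then have d: "t \<le> norm (x - y)" by (auto simp: dist_norm)
    define j where "j = (LEAST k. norm (x - y) < 2 * t * 2 ^ k)"
    obtain k :: nat where "norm (x - y) / t < 2 ^ k" using real_arch_pow[of 2 "norm (x - y) / t"] by auto
    then have "norm (x - y) < t * 2 ^ k" using t by (simp add: field_simps)
    also have "\<dots> \<le> 2 * t * 2 ^ k" using t by simp
    finally have j: "norm (x - y) < 2 * t * 2 ^ j" unfolding j_def by (rule LeastI)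
    show "\<exists>k. 2 * t * 2 ^ k / 2 \<le> norm (x - y) \<and> norm (x - y) < 2 * t * 2 ^ k"
    proof (cases j)
      case 0 then show ?thesis using j d by (intro exI[of _ 0]) simp
    next
      case (Suc i)
      then have "\<not> norm (x - y) < 2 * t * 2 ^ i" using not_less_Least[of i "\<lambda>k. norm (x - y) < 2 * t * 2 ^ k"] by (simp add: j_def)
      then show ?thesis using j Suc by (intro exI[of _ "Suc i"]) simp
    qed
  qed (rule B)
  have eq: "ennreal (f y * norm (x - y) powr (a - ?n)) = ennreal (f y * norm (x - y) powr (a - ?n)) * indicator ?I y
      + ennreal (f y * norm (x - y) powr (a - ?n)) * indicator ?O y" for y
    using t by (cases "y = x") (auto simp: indicator_def)
  have im: "(indicator ?I :: 'a \<Rightarrow> ennreal) \<in> borel_measurable ?M" "(indicator ?O :: 'a \<Rightarrow> ennreal) \<in> borel_measurable ?M"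
    by (intro measurable_restrict_space1 borel_measurable_indicator; simp)+
  have "(\<integral>\<^sup>+y. ennreal (f y * norm (x - y) powr (a - ?n)) \<partial>?M)
    = (\<integral>\<^sup>+y\<in>?I. ennreal (f y * norm (x - y) powr (a - ?n)) \<partial>?M) + (\<integral>\<^sup>+y\<in>?O. ennreal (f y * norm (x - y) powr (a - ?n)) \<partial>?M)"
    using m im by (subst eq) (intro nn_integral_add borel_measurable_times_ennreal)
  then have "ennreal \<omega> * (\<integral>\<^sup>+y. ennreal (f y * norm (x - y) powr (a - ?n)) \<partial>?M)
    \<le> ennreal (2 powr (?n - a) * A * (t powr e * (1 / (1 - q)))) + ennreal (2 powr (?n - a) * B * (t powr (- e) * q * (1 / (1 - q))))"
    using add_mono[OF I O] by (simp add: distrib_left)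
  also have "\<dots> = ennreal (2 powr (?n - a) * A * (t powr e * (1 / (1 - q))) + 2 powr (?n - a) * B * (t powr (- e) * q * (1 / (1 - q))))"
    using A B q by (intro ennreal_plus[symmetric]) auto
  also have "\<dots> \<le> ennreal (2 powr (?n - a) / (1 - q) * (t powr e * A + t powr (- e) * B))"
  proof (rule ennreal_leI)
    define k where "k = 2 powr (?n - a) / (1 - q)"
    have k: "0 \<le> k" using q by (simp add: k_def)
    have "k * (t powr (- e) * B * q) \<le> k * (t powr (- e) * B * 1)" using k q B by (intro mult_left_mono) auto
    then show "2 powr (?n - a) * A * (t powr e * (1 / (1 - q))) + 2 powr (?n - a) * B * (t powr (- e) * q * (1 / (1 - q)))
      \<le> 2 powr (?n - a) / (1 - q) * (t powr e * A + t powr (- e) * B)"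
      unfolding k_def by (simp add: algebra_simps add_divide_distrib)
  qed
  finally show ?thesis unfolding q_def .
qed

text \<open>
  A form of log-Hoelder continuity without restriction on the distance: the logarithm is negative
  for distances above \<open>1\<close>, and at most \<open>1\<close> for distances between \<open>1 / 2\<close> and \<open>1\<close>.
\<close>

lemma log_Holder_bound:
  assumes "log_Holder Q0 p" "\<And>x. x \<in> Q0 \<Longrightarrow> 0 \<le> p x \<and> p x \<le> P" "0 \<le> P"
  obtains L where "0 \<le> L" "\<And>x y. x \<in> Q0 \<Longrightarrow> y \<in> Q0 \<Longrightarrow> \<bar>p x - p y\<bar> * ln (1 / norm (x - y)) \<le> L"
proof -
  obtain C where C: "0 < C" "\<And>x y. x \<in> Q0 \<Longrightarrow> y \<in> Q0 \<Longrightarrow> x \<noteq> y \<Longrightarrow> norm (x - y) \<le> 1 / 2 \<Longrightarrow> \<bar>p x - p y\<bar> \<le> C / ln (1 / norm (x - y))"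
    using assms(1) unfolding log_Holder_def by blast
  show ?thesis
  proof (rule that[of "C + P"])
    show "0 \<le> C + P" using C assms by simp
    fix x y assume xy: "x \<in> Q0" "y \<in> Q0"
    have P: "\<bar>p x - p y\<bar> \<le> P" using assms(2)[OF xy(1)] assms(2)[OF xy(2)] by linarith
    consider "x = y" | "x \<noteq> y" "norm (x - y) \<le> 1 / 2" | "1 / 2 < norm (x - y)" by fastforce
    then show "\<bar>p x - p y\<bar> * ln (1 / norm (x - y)) \<le> C + P"
    proof cases
      case 2
      have "1 < 1 / norm (x - y)" using 2 by simp
      then have l: "0 < ln (1 / norm (x - y))" by (rule ln_gt_zero)
      have "\<bar>p x - p y\<bar> * ln (1 / norm (x - y)) \<le> C" using C(2)[OF xy 2] l by (simp only: pos_le_divide_eq)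
      then show ?thesis using assms(3) by linarith
    next
      case 3
      have n: "0 < norm (x - y)" using 3 by linarith
      then have "1 / norm (x - y) \<le> 2" using 3 by (simp only: divide_le_eq) simp
      moreover have "0 < 1 / norm (x - y)" using n by simp
      ultimately have "ln (1 / norm (x - y)) \<le> 2 - 1" using ln_le_minus_one[of "1 / norm (x - y)"] by linarith
      then have "\<bar>p x - p y\<bar> * ln (1 / norm (x - y)) \<le> \<bar>p x - p y\<bar> * 1" by (intro mult_left_mono) auto
      also have "\<dots> \<le> C + P" using P C(1) by simp
      finally show ?thesis .
    qed (use C assms in simp)
  qed
qed

lemma log_modulus_transfer:
  fixes d d' l :: real
  assumes "\<bar>d\<bar> \<le> M * \<bar>d'\<bar>" "\<bar>d'\<bar> * l \<le> L" "0 \<le> L" "0 \<le> M"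
  shows "\<bar>d\<bar> * l \<le> M * L"
proof (cases "0 \<le> l")
  case True
  then have "\<bar>d\<bar> * l \<le> M * \<bar>d'\<bar> * l" using assms by (intro mult_right_mono)
  also have "\<dots> \<le> M * L" using assms mult_left_mono[of "\<bar>d'\<bar> * l" L M] by (simp add: mult.assoc)
  finally show ?thesis .
next
  case False
  then have "\<bar>d\<bar> * l \<le> 0" by (simp add: mult_nonneg_nonpos)
  then show ?thesis using assms by (smt (verit) mult_nonneg_nonneg)
qed

lemma frac_kernel_bounds:
  fixes x y :: "real ^ 'n"
  shows "0 \<le> frac_kernel \<alpha> x y" "frac_kernel \<alpha> x y \<le> norm (x - y) powr (\<alpha> - real CARD('n))"
    and "frac_kernel \<alpha> x y = norm (x - y) powr \<alpha> / (2 * norm (x - y)) ^ CARD('n)"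
proof -
  show eq: "frac_kernel \<alpha> x y = norm (x - y) powr \<alpha> / (2 * norm (x - y)) ^ CARD('n)"
    unfolding frac_kernel_def measure_def by (subst emeasure_cube) auto
  show "0 \<le> frac_kernel \<alpha> x y" unfolding eq by simp
  show "frac_kernel \<alpha> x y \<le> norm (x - y) powr (\<alpha> - real CARD('n))"
  proof (cases "x = y")
    case False
    have "norm (x - y) ^ CARD('n) \<le> (2 * norm (x - y)) ^ CARD('n)" by (intro power_mono) auto
    then have "norm (x - y) powr \<alpha> / (2 * norm (x - y)) ^ CARD('n) \<le> norm (x - y) powr \<alpha> / norm (x - y) ^ CARD('n)"
      using False by (intro divide_left_mono) auto
    then show ?thesis using False by (simp add: eq powr_diff powr_realpow)
  next
    case True
    then show ?thesis unfolding eq by simp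
  qed
qed

lemma borel_measurable_lebesgue_on_AE:
  fixes f g :: "real ^ 'n \<Rightarrow> real"
  assumes S: "S \<in> sets lebesgue" and f: "f \<in> borel_measurable (lebesgue_on S)" and ae: "AE x in lebesgue_on S. f x = g x"
  shows "g \<in> borel_measurable (lebesgue_on S)"
proof -
  have "AE x in lebesgue. x \<in> S \<longrightarrow> f x = g x" using ae S by (subst (asm) AE_restrict_space_iff) auto
  then have eq: "AE x in lebesgue. (if x \<in> S then f x else 0) = (if x \<in> S then g x else 0)" by eventually_elim auto
  have "(\<lambda>x. if x \<in> S then f x else 0) \<in> borel_measurable lebesgue" using f S by (rule borel_measurable_if_I)
  then have "(\<lambda>x. if x \<in> S then g x else 0) \<in> borel_measurable lebesgue"
    by (rule borel_measurable_AE[OF _ eq])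
  then show ?thesis using S by (simp add: borel_measurable_if_D)
qed

text \<open>
  Let \<open>q\<close>, \<open>q\<^sup>-\<close>, \<open>q\<^sup>+\<close> be the Sobolev exponents of the orders \<open>\<alpha>\<close>, \<open>\<alpha> - \<epsilon>\<close>, \<open>\<alpha> + \<epsilon>\<close>, so that
  \<open>1 / q\<^sup>\<plusminus> = 1 / q \<minusplus> \<epsilon> / n\<close>. With the majorants \<open>Gm\<close>, \<open>Gq\<close> of the two weighted maximal functions put
  \<open>T = 1 + Gm powr q\<^sup>- + Gq powr q\<^sup>+\<close>. Then \<open>Gm \<le> T powr (1 / q + \<epsilon> / n)\<close> and
  \<open>Gq \<le> T powr (1 / q - \<epsilon> / n)\<close>, and the radius \<open>T powr (-1 / n)\<close> in Welland's inequality makes both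
  contributions equal to \<open>T powr (1 / q)\<close>, whose modular is the integral of \<open>T\<close>. The conclusion is stated
  with a majorant \<open>\<Phi>\<close> of \<open>W\<close> times the potential of \<open>|f|\<close>, which gives the existence of the fractional
  integral at the same time.
\<close>

proposition weighted_fractional_integral:
  fixes S :: "'a::euclidean_space set" and W :: "'a \<Rightarrow> real"
  assumes tm: "two_weights S c D p \<kappa> P (\<alpha> - \<epsilon>) L um \<sigma> Cum Cs Tum Ts"
    and tp: "two_weights S c D p \<kappa> P (\<alpha> + \<epsilon>) L up \<sigma> Cup Cs Tup Ts"
    and eps: "0 < \<epsilon>"
    and Wm: "\<And>x. x \<in> S \<Longrightarrow> W x = um x powr (1 / p x - (\<alpha> - \<epsilon>) / real DIM('a)) * \<sigma> x powr (- (1 - 1 / p x))"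
    and Wp: "\<And>x. x \<in> S \<Longrightarrow> W x = up x powr (1 / p x - (\<alpha> + \<epsilon>) / real DIM('a)) * \<sigma> x powr (- (1 - 1 / p x))"
    and W: "W \<in> borel_measurable (lebesgue_on S)" "AE x in lebesgue_on S. 0 < W x"
  obtains K where "0 < K"
    "\<And>f. f \<in> borel_measurable (lebesgue_on S) \<Longrightarrow> (\<integral>\<^sup>+x. ennreal (\<bar>W x * f x\<bar> powr p x) \<partial>lebesgue_on S) \<le> 1 \<Longrightarrow>
      \<exists>\<Phi>. (\<forall>x. 0 \<le> \<Phi> x) \<and>
        (AE x in lebesgue_on S. ennreal (W x) *
          (\<integral>\<^sup>+y. ennreal (\<bar>f y\<bar> * norm (x - y) powr (\<alpha> - real DIM('a))) \<partial>lebesgue_on S) \<le> ennreal (\<Phi> x)) \<and>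
        (\<integral>\<^sup>+x. ennreal ((\<Phi> x / K) powr (1 / (1 / p x - \<alpha> / real DIM('a)))) \<partial>lebesgue_on S) \<le> 1"
proof -
  let ?n = "real DIM('a)"
  let ?M = "lebesgue_on S"
  interpret m: two_weights S c D p \<kappa> P "\<alpha> - \<epsilon>" L um \<sigma> Cum Cs Tum Ts by (rule tm)
  interpret q: two_weights S c D p \<kappa> P "\<alpha> + \<epsilon>" L up \<sigma> Cup Cs Tup Ts by (rule tp)
  have n: "0 < ?n" by simp
  note p_meas[measurable] = m.p_meas
  note W(1)[measurable]
  have iqm_meas[measurable]: "m.iq \<in> borel_measurable ?M" "q.iq \<in> borel_measurable ?M"
    unfolding m.iq_def q.iq_def by measurable
  obtain Km where Km: "0 \<le> Km" and m: "\<And>g. g \<in> borel_measurable ?M \<Longrightarrow> (\<And>x. 0 \<le> g x) \<Longrightarrow>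
       (\<integral>\<^sup>+x. ennreal (g x powr p x) \<partial>?M) \<le> 1 \<Longrightarrow>
       \<exists>G. G \<in> borel_measurable ?M \<and> (\<forall>x. 0 \<le> G x) \<and>
         (AE x in ?M. \<forall>r>0. ennreal (m.w x * r powr (\<alpha> - \<epsilon> - ?n)) * ball_mass S (\<lambda>y. g y * m.winv y) x r \<le> ennreal (G x)) \<and>
         (\<integral>\<^sup>+x. ennreal (G x powr (1 / m.iq x)) \<partial>?M) \<le> ennreal Km"
    using m.weighted_maximal_bound by blast
  obtain Kq where Kq: "0 \<le> Kq" and q: "\<And>g. g \<in> borel_measurable ?M \<Longrightarrow> (\<And>x. 0 \<le> g x) \<Longrightarrow>
       (\<integral>\<^sup>+x. ennreal (g x powr p x) \<partial>?M) \<le> 1 \<Longrightarrow>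
       \<exists>G. G \<in> borel_measurable ?M \<and> (\<forall>x. 0 \<le> G x) \<and>
         (AE x in ?M. \<forall>r>0. ennreal (q.w x * r powr (\<alpha> + \<epsilon> - ?n)) * ball_mass S (\<lambda>y. g y * q.winv y) x r \<le> ennreal (G x)) \<and>
         (\<integral>\<^sup>+x. ennreal (G x powr (1 / q.iq x)) \<partial>?M) \<le> ennreal Kq"
    using q.weighted_maximal_bound by blast
  define iq where "iq x = 1 / p x - \<alpha> / ?n" for x
  have iqm: "m.iq x = iq x + \<epsilon> / ?n" and iqq: "q.iq x = iq x - \<epsilon> / ?n" for x
    by (simp_all add: iq_def m.iq_def q.iq_def diff_divide_distrib add_divide_distrib)
  define e0 where "e0 = 1 / P - \<alpha> / ?n"
  have e0: "0 < e0"
  proof -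
    have "\<alpha> / ?n \<le> (\<alpha> + \<epsilon>) / ?n" using eps by (intro divide_right_mono) auto
    then show ?thesis using q.bet(3) by (simp add: e0_def)
  qed
  have iq: "e0 \<le> iq x" "iq x \<le> 1" if "x \<in> S" for x
  proof -
    show "e0 \<le> iq x" using m.iq_range(1)[OF that] unfolding iqm e0_def by (simp add: diff_divide_distrib)
    have "0 \<le> \<epsilon> / ?n" using eps by simp
    then show "iq x \<le> 1" using m.iq_range(4)[OF that] unfolding iqm by linarith
  qed
  obtain \<mu> where mu: "emeasure ?M S = ennreal \<mu>" "0 \<le> \<mu>"
    using finite_measure.emeasure_finite[OF regular_set_finite_measure(2)[OF m.R], of S]
    by (cases "emeasure ?M S") auto
  define Z where "Z = 2 * (2 powr (?n - \<alpha>) / (1 - 2 powr (- \<epsilon>)))"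
  have Z: "0 \<le> Z"
  proof -
    have "2 powr (- \<epsilon>) < (1::real)" using eps powr_less_mono[of "- \<epsilon>" 0 2] by simp
    then show ?thesis by (simp add: Z_def)
  qed
  define Z1 where "Z1 = max 1 Z powr (1 / e0)"
  have Z1: "0 \<le> Z1" by (simp add: Z1_def)
  define K where "K = max 1 (Z1 * (\<mu> + Km + Kq))"
  have K: "1 \<le> K" "Z1 * (\<mu> + Km + Kq) \<le> K" by (auto simp: K_def)
  show ?thesis
  proof (rule that[of K])
    show "0 < K" using K by linarith
    fix f :: "'a \<Rightarrow> real"
    assume f: "f \<in> borel_measurable ?M" and fp: "(\<integral>\<^sup>+x. ennreal (\<bar>W x * f x\<bar> powr p x) \<partial>?M) \<le> 1"
    note f[measurable]
    define g where "g y = \<bar>W y * f y\<bar>" for y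
    have g: "g \<in> borel_measurable ?M" "\<And>y. 0 \<le> g y" "(\<integral>\<^sup>+x. ennreal (g x powr p x) \<partial>?M) \<le> 1"
      using fp unfolding g_def by (simp_all add: g_def[abs_def])
    obtain Gm where Gm: "Gm \<in> borel_measurable ?M" "\<And>x. 0 \<le> Gm x"
      "AE x in ?M. \<forall>r>0. ennreal (m.w x * r powr (\<alpha> - \<epsilon> - ?n)) * ball_mass S (\<lambda>y. g y * m.winv y) x r \<le> ennreal (Gm x)"
      "(\<integral>\<^sup>+x. ennreal (Gm x powr (1 / m.iq x)) \<partial>?M) \<le> ennreal Km"
      using m[OF g] by blast
    obtain Gq where Gq: "Gq \<in> borel_measurable ?M" "\<And>x. 0 \<le> Gq x"
      "AE x in ?M. \<forall>r>0. ennreal (q.w x * r powr (\<alpha> + \<epsilon> - ?n)) * ball_mass S (\<lambda>y. g y * q.winv y) x r \<le> ennreal (Gq x)"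
      "(\<integral>\<^sup>+x. ennreal (Gq x powr (1 / q.iq x)) \<partial>?M) \<le> ennreal Kq"
      using q[OF g] by blast
    note Gm(1)[measurable] Gq(1)[measurable]
    have wm: "m.w x = W x" if "x \<in> S" for x by (simp only: m.w_def m.iq_def Wm[OF that])
    have wq: "q.w x = W x" if "x \<in> S" for x by (simp only: q.w_def q.iq_def Wp[OF that])
    have inv: "m.winv x = inverse (m.w x)" "q.winv x = inverse (q.w x)" for x
      by (simp_all only: m.w_def m.winv_def q.w_def q.winv_def powr_minus inverse_mult_distrib inverse_inverse_eq)
    have eq: "AE y in ?M. g y * m.winv y = \<bar>f y\<bar> \<and> g y * q.winv y = \<bar>f y\<bar>"
      using W(2) m.in_S by eventually_elim (simp add: inv wm wq g_def abs_mult)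
    have bm: "ball_mass S (\<lambda>y. g y * m.winv y) x r = ball_mass S (\<lambda>y. \<bar>f y\<bar>) x r"
      "ball_mass S (\<lambda>y. g y * q.winv y) x r = ball_mass S (\<lambda>y. \<bar>f y\<bar>) x r" for x r
    proof -
      show "ball_mass S (\<lambda>y. g y * m.winv y) x r = ball_mass S (\<lambda>y. \<bar>f y\<bar>) x r"
        unfolding ball_mass_def by (rule nn_integral_cong_AE, rule eventually_mono[OF eq]) simp
      show "ball_mass S (\<lambda>y. g y * q.winv y) x r = ball_mass S (\<lambda>y. \<bar>f y\<bar>) x r"
        unfolding ball_mass_def by (rule nn_integral_cong_AE, rule eventually_mono[OF eq]) simp
    qed
    define T where "T x = 1 + Gm x powr (1 / m.iq x) + Gq x powr (1 / q.iq x)" for x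
    have T1: "1 \<le> T x" for x by (simp add: T_def)
    have Tm[measurable]: "T \<in> borel_measurable ?M" unfolding T_def by measurable
    define \<Phi> where "\<Phi> x = Z * T x powr iq x" for x
    have "AE x in ?M. ennreal (W x) * (\<integral>\<^sup>+y. ennreal (\<bar>f y\<bar> * norm (x - y) powr (\<alpha> - ?n)) \<partial>?M) \<le> ennreal (\<Phi> x)"
      using Gm(3) Gq(3) W(2) m.in_S
    proof eventually_elim
      case (elim x)
      have x: "x \<in> S" by (rule elim)
      have im: "0 < m.iq x" "0 < q.iq x" using m.iq_range(2)[OF x] q.iq_range(2)[OF x] .
      define t where "t = T x powr (- 1 / ?n)"
      have t: "0 < t" using T1[of x] by (simp add: t_def)
      have "ennreal (W x) * (\<integral>\<^sup>+y. ennreal (\<bar>f y\<bar> * norm (x - y) powr (\<alpha> - ?n)) \<partial>?M)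
        \<le> ennreal (2 powr (?n - \<alpha>) / (1 - 2 powr (- \<epsilon>)) * (t powr \<epsilon> * Gm x + t powr (- \<epsilon>) * Gq x))"
      proof (rule potential_le_maximal[OF _ _ _ _ eps t Gm(2) Gq(2)])
        show "ennreal (W x * r powr (\<alpha> - \<epsilon> - ?n)) * ball_mass S (\<lambda>y. \<bar>f y\<bar>) x r \<le> ennreal (Gm x)" if "0 < r" for r
          using elim(1) that unfolding bm wm[OF x] by blast
        show "ennreal (W x * r powr (\<alpha> + \<epsilon> - ?n)) * ball_mass S (\<lambda>y. \<bar>f y\<bar>) x r \<le> ennreal (Gq x)" if "0 < r" for r
          using elim(2) that unfolding bm wq[OF x] by blast
        show "\<alpha> < ?n" using q.bet eps by linarith
      qed (use elim in auto)
      also have "\<dots> \<le> ennreal (\<Phi> x)"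
      proof (rule ennreal_leI)
        have "Gm x = (Gm x powr (1 / m.iq x)) powr m.iq x" using im Gm(2)[of x] by (simp add: powr_powr)
        also have "\<dots> \<le> T x powr m.iq x" using im unfolding T_def by (intro powr_mono2) auto
        finally have "t powr \<epsilon> * Gm x \<le> t powr \<epsilon> * T x powr m.iq x" by (intro mult_left_mono) auto
        also have "\<dots> = T x powr iq x" by (simp add: t_def powr_powr powr_add[symmetric] iqm)
        finally have 1: "t powr \<epsilon> * Gm x \<le> T x powr iq x" .
        have "Gq x = (Gq x powr (1 / q.iq x)) powr q.iq x" using im Gq(2)[of x] by (simp add: powr_powr)
        also have "\<dots> \<le> T x powr q.iq x" using im unfolding T_def by (intro powr_mono2) auto
        finally have "t powr (- \<epsilon>) * Gq x \<le> t powr (- \<epsilon>) * T x powr q.iq x" by (intro mult_left_mono) auto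
        also have "\<dots> = T x powr iq x" by (simp add: t_def powr_powr powr_add[symmetric] iqq)
        finally have 2: "t powr (- \<epsilon>) * Gq x \<le> T x powr iq x" .
        have "0 \<le> 2 powr (?n - \<alpha>) / (1 - 2 powr (- \<epsilon>))" using Z by (simp add: Z_def)
        then have "2 powr (?n - \<alpha>) / (1 - 2 powr (- \<epsilon>)) * (t powr \<epsilon> * Gm x + t powr (- \<epsilon>) * Gq x)
          \<le> 2 powr (?n - \<alpha>) / (1 - 2 powr (- \<epsilon>)) * (2 * T x powr iq x)"
          using 1 2 by (intro mult_left_mono) auto
        then show "2 powr (?n - \<alpha>) / (1 - 2 powr (- \<epsilon>)) * (t powr \<epsilon> * Gm x + t powr (- \<epsilon>) * Gq x) \<le> \<Phi> x"
          unfolding \<Phi>_def Z_def by (simp only: mult_ac)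
      qed
      finally show ?case .
    qed
    moreover have "(\<integral>\<^sup>+x. ennreal ((\<Phi> x / K) powr (1 / (1 / p x - \<alpha> / ?n))) \<partial>?M) \<le> 1"
    proof -
      have "(\<integral>\<^sup>+x. ennreal ((\<Phi> x / K) powr (1 / (1 / p x - \<alpha> / ?n))) \<partial>?M)
        \<le> (\<integral>\<^sup>+x. ennreal (Z1 / K) * (indicator S x + ennreal (Gm x powr (1 / m.iq x)) + ennreal (Gq x powr (1 / q.iq x))) \<partial>?M)"
      proof (intro nn_integral_mono_AE)
        show "AE x in ?M. ennreal ((\<Phi> x / K) powr (1 / (1 / p x - \<alpha> / ?n)))
          \<le> ennreal (Z1 / K) * (indicator S x + ennreal (Gm x powr (1 / m.iq x)) + ennreal (Gq x powr (1 / q.iq x)))"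
          using m.in_S
        proof eventually_elim
          case (elim x)
          have i: "0 < iq x" using iq(1)[OF elim] e0 by linarith
          have ib: "1 / iq x \<le> 1 / e0" "1 \<le> 1 / iq x"
            using iq[OF elim] e0 i by (auto intro!: divide_left_mono simp: field_simps)
          have "(\<Phi> x / K) powr (1 / iq x) = Z powr (1 / iq x) * T x / K powr (1 / iq x)"
            using i T1[of x] by (simp add: \<Phi>_def powr_divide powr_mult powr_powr)
          also have "\<dots> \<le> Z1 * T x / K powr 1"
          proof (intro frac_le mult_mono)
            have "Z powr (1 / iq x) \<le> max 1 Z powr (1 / iq x)" using Z i by (intro powr_mono2) auto
            also have "\<dots> \<le> Z1" unfolding Z1_def using ib by (intro powr_mono) auto
            finally show "Z powr (1 / iq x) \<le> Z1" .
            show "K powr 1 \<le> K powr (1 / iq x)" using K ib by (intro powr_mono) auto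
          qed (use T1[of x] Z1 K in auto)
          finally have "(\<Phi> x / K) powr (1 / iq x) \<le> Z1 / K * T x" using K by simp
          then have "ennreal ((\<Phi> x / K) powr (1 / iq x)) \<le> ennreal (Z1 / K * T x)" by (rule ennreal_leI)
          also have "\<dots> = ennreal (Z1 / K) * (indicator S x + ennreal (Gm x powr (1 / m.iq x)) + ennreal (Gq x powr (1 / q.iq x)))"
            using Z1 K elim T1[of x] by (subst ennreal_mult) (auto simp: T_def)
          finally show ?case by (simp add: iq_def)
        qed
      qed
      also have "\<dots> = ennreal (Z1 / K) * (\<integral>\<^sup>+x. indicator S x + ennreal (Gm x powr (1 / m.iq x)) + ennreal (Gq x powr (1 / q.iq x)) \<partial>?M)"
      proof (rule nn_integral_cmult)
        have [measurable]: "S \<in> sets ?M" using m.Rd(1) by (auto simp: sets_restrict_space_iff)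
        show "(\<lambda>x. indicator S x + ennreal (Gm x powr (1 / m.iq x)) + ennreal (Gq x powr (1 / q.iq x))) \<in> borel_measurable ?M"
          by measurable
      qed
      also have "(\<integral>\<^sup>+x. indicator S x + ennreal (Gm x powr (1 / m.iq x)) + ennreal (Gq x powr (1 / q.iq x)) \<partial>?M)
        = ennreal \<mu> + (\<integral>\<^sup>+x. ennreal (Gm x powr (1 / m.iq x)) \<partial>?M) + (\<integral>\<^sup>+x. ennreal (Gq x powr (1 / q.iq x)) \<partial>?M)"
      proof -
        have [measurable]: "S \<in> sets ?M" using m.Rd(1) by (auto simp: sets_restrict_space_iff)
        have "(\<integral>\<^sup>+x. indicator S x + ennreal (Gm x powr (1 / m.iq x)) + ennreal (Gq x powr (1 / q.iq x)) \<partial>?M)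
          = (\<integral>\<^sup>+x. indicator S x + ennreal (Gm x powr (1 / m.iq x)) \<partial>?M) + (\<integral>\<^sup>+x. ennreal (Gq x powr (1 / q.iq x)) \<partial>?M)"
          by (rule nn_integral_add) measurable
        also have "(\<integral>\<^sup>+x. indicator S x + ennreal (Gm x powr (1 / m.iq x)) \<partial>?M)
          = (\<integral>\<^sup>+x. indicator S x \<partial>?M) + (\<integral>\<^sup>+x. ennreal (Gm x powr (1 / m.iq x)) \<partial>?M)"
          by (rule nn_integral_add) measurable
        also have "(\<integral>\<^sup>+x. indicator S x \<partial>?M) = ennreal \<mu>"
          unfolding mu(1)[symmetric] by (rule nn_integral_indicator) measurable
        finally show ?thesis .
      qed
      also have "\<dots> \<le> ennreal \<mu> + ennreal Km + ennreal Kq" by (intro add_mono Gm Gq) auto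
      also have "\<dots> = ennreal (\<mu> + Km + Kq)" using mu Km Kq by simp
      finally have "(\<integral>\<^sup>+x. ennreal ((\<Phi> x / K) powr (1 / (1 / p x - \<alpha> / ?n))) \<partial>?M) \<le> ennreal (Z1 / K) * ennreal (\<mu> + Km + Kq)"
        by (simp add: mult_left_mono)
      also have "\<dots> = ennreal (Z1 * (\<mu> + Km + Kq) / K)"
        using Z1 K mu Km Kq by (subst ennreal_mult[symmetric]) auto
      also have "\<dots> \<le> ennreal 1" using K by (intro ennreal_leI) (simp add: divide_le_eq)
      finally show ?thesis by simp
    qed
    moreover have "\<forall>x. 0 \<le> \<Phi> x" using Z by (simp add: \<Phi>_def)
    ultimately show "\<exists>\<Phi>. (\<forall>x. 0 \<le> \<Phi> x) \<and>
        (AE x in ?M. ennreal (W x) * (\<integral>\<^sup>+y. ennreal (\<bar>f y\<bar> * norm (x - y) powr (\<alpha> - ?n)) \<partial>?M) \<le> ennreal (\<Phi> x)) \<and>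
        (\<integral>\<^sup>+x. ennreal ((\<Phi> x / K) powr (1 / (1 / p x - \<alpha> / ?n))) \<partial>?M) \<le> 1" by blast
  qed
qed

text \<open>
  Passage from the modular to the norm by homogeneity: the modular estimate is applied to \<open>f / t\<close> for
  every admissible \<open>t\<close> in the definition of the norm of \<open>W f\<close>.
\<close>

lemma norm_inequality_from_modular:
  fixes Q0 :: "(real ^ 'n) set"
  assumes Q: "Q0 \<in> sets lebesgue" and K: "0 < K"
    and W: "W \<in> borel_measurable (lebesgue_on Q0)" "AE x in lebesgue_on Q0. 0 < W x"
    and q: "\<And>x. x \<in> Q0 \<Longrightarrow> 0 < q x"
    and core: "\<And>f. f \<in> borel_measurable (lebesgue_on Q0) \<Longrightarrow> (\<integral>\<^sup>+x. ennreal (\<bar>W x * f x\<bar> powr p x) \<partial>lebesgue_on Q0) \<le> 1 \<Longrightarrow>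
      \<exists>\<Phi>. (\<forall>x. 0 \<le> \<Phi> x) \<and>
        (AE x in lebesgue_on Q0. ennreal (W x) *
          (\<integral>\<^sup>+y. ennreal (\<bar>f y\<bar> * norm (x - y) powr (\<alpha> - real CARD('n))) \<partial>lebesgue_on Q0) \<le> ennreal (\<Phi> x)) \<and>
        (\<integral>\<^sup>+x. ennreal ((\<Phi> x / K) powr q x) \<partial>lebesgue_on Q0) \<le> 1"
    and f: "(\<lambda>x. W x * f x) \<in> Lp_space p Q0"
  shows "frac_int_defined \<alpha> Q0 f \<and>
    Lp_norm q Q0 (\<lambda>x. W x * frac_int \<alpha> Q0 f x) \<le> ennreal K * Lp_norm p Q0 (\<lambda>x. W x * f x)"
proof -
  let ?M = "lebesgue_on Q0"
  note W(1)[measurable]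
  have Wf[measurable]: "(\<lambda>x. W x * f x) \<in> borel_measurable ?M" and fin: "Lp_norm p Q0 (\<lambda>x. W x * f x) < \<infinity>"
    using f by (auto simp: Lp_space_def)
  have fm[measurable]: "f \<in> borel_measurable ?M"
  proof (rule borel_measurable_lebesgue_on_AE[OF Q])
    show "(\<lambda>x. W x * f x / W x) \<in> borel_measurable ?M" by measurable
    show "AE x in ?M. W x * f x / W x = f x" using W(2) by eventually_elim auto
  qed
  have km: "(\<lambda>y. frac_kernel \<alpha> x y) \<in> borel_measurable ?M" for x
  proof -
    have [measurable]: "(\<lambda>y. norm (x - y)) \<in> borel_measurable ?M"
      by (intro measurable_restrict_space1) (simp add: measurable_completion)
    show ?thesis unfolding frac_kernel_bounds(3) by measurable
  qed
  have step: "(AE x in ?M. integrable ?M (\<lambda>y. f y * frac_kernel \<alpha> x y)) \<and>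
      modular q Q0 (\<lambda>x. W x * frac_int \<alpha> Q0 f x / (K * t)) \<le> 1"
    if t: "0 < t" "modular p Q0 (\<lambda>x. W x * f x / t) \<le> 1" for t
  proof -
    have "(\<lambda>x. f x / t) \<in> borel_measurable ?M" by measurable
    moreover have "(\<integral>\<^sup>+x. ennreal (\<bar>W x * (f x / t)\<bar> powr p x) \<partial>?M) \<le> 1" using t by (simp add: modular_def)
    ultimately obtain \<Phi> where \<Phi>: "\<And>x. 0 \<le> \<Phi> x"
      "AE x in ?M. ennreal (W x) * (\<integral>\<^sup>+y. ennreal (\<bar>f y / t\<bar> * norm (x - y) powr (\<alpha> - real CARD('n))) \<partial>?M) \<le> ennreal (\<Phi> x)"
      "(\<integral>\<^sup>+x. ennreal ((\<Phi> x / K) powr q x) \<partial>?M) \<le> 1"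
      using core[of "\<lambda>x. f x / t"] by blast
    have main: "AE x in ?M. integrable ?M (\<lambda>y. f y * frac_kernel \<alpha> x y) \<and> \<bar>W x * frac_int \<alpha> Q0 f x / t\<bar> \<le> \<Phi> x"
      using \<Phi>(2) W(2)
    proof eventually_elim
      case (elim x)
      let ?J = "\<integral>\<^sup>+y. ennreal (\<bar>f y / t\<bar> * norm (x - y) powr (\<alpha> - real CARD('n))) \<partial>?M"
      let ?h = "\<lambda>y. f y / t * frac_kernel \<alpha> x y"
      have hm: "?h \<in> borel_measurable ?M" using km[of x] by measurable
      have "ennreal (W x) * ?J < \<infinity>" using elim(1) by (rule le_less_trans) simp
      then have Jfin: "?J < \<infinity>" using elim(2) by (auto simp: ennreal_mult_less_top)
      have hJ: "(\<integral>\<^sup>+y. ennreal (norm (?h y)) \<partial>?M) \<le> ?J"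
      proof (intro nn_integral_mono ennreal_leI)
        fix y
        have "norm (?h y) = \<bar>f y / t\<bar> * frac_kernel \<alpha> x y" using frac_kernel_bounds(1)[of \<alpha> x y] by (simp add: abs_mult)
        also have "\<dots> \<le> \<bar>f y / t\<bar> * norm (x - y) powr (\<alpha> - real CARD('n))"
          by (intro mult_left_mono frac_kernel_bounds) auto
        finally show "norm (?h y) \<le> \<bar>f y / t\<bar> * norm (x - y) powr (\<alpha> - real CARD('n))" .
      qed
      have int: "integrable ?M ?h" using hm hJ Jfin by (intro integrableI_bounded) auto
      have "integrable ?M (\<lambda>y. t * ?h y)" using int by (rule integrable_mult_right)
      then have i2: "integrable ?M (\<lambda>y. f y * frac_kernel \<alpha> x y)" using t by (simp add: field_simps)
      have eq: "frac_int \<alpha> Q0 f x / t = (LINT y|?M. ?h y)"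
      proof -
        have "?h = (\<lambda>y. f y * frac_kernel \<alpha> x y / t)" by (rule ext) simp
        then show ?thesis unfolding frac_int_def by (simp only: integral_divide_zero)
      qed
      have "ennreal \<bar>W x * frac_int \<alpha> Q0 f x / t\<bar> = ennreal (W x) * ennreal (norm (LINT y|?M. ?h y))"
        unfolding eq[symmetric] using elim(2) t by (simp add: ennreal_mult[symmetric] abs_mult)
      also have "\<dots> \<le> ennreal (W x) * ?J"
        using integral_norm_bound_ennreal[OF int] hJ by (intro mult_left_mono) auto
      also have "\<dots> \<le> ennreal (\<Phi> x)" by (rule elim)
      finally have "\<bar>W x * frac_int \<alpha> Q0 f x / t\<bar> \<le> \<Phi> x" using \<Phi>(1)[of x] by (subst (asm) ennreal_le_iff) auto
      then show ?case using i2 by blast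
    qed
    have "modular q Q0 (\<lambda>x. W x * frac_int \<alpha> Q0 f x / (K * t)) \<le> (\<integral>\<^sup>+x. ennreal ((\<Phi> x / K) powr q x) \<partial>?M)"
      unfolding modular_def
    proof (intro nn_integral_mono_AE)
      show "AE x in ?M. ennreal (\<bar>W x * frac_int \<alpha> Q0 f x / (K * t)\<bar> powr q x) \<le> ennreal ((\<Phi> x / K) powr q x)"
        using main AE_space
      proof eventually_elim
        case (elim x)
        have "0 < q x" using elim(2) Q q by (auto simp: space_restrict_space)
        moreover have "\<bar>W x * frac_int \<alpha> Q0 f x / (K * t)\<bar> = \<bar>W x * frac_int \<alpha> Q0 f x / t\<bar> / K"
          using K t by (simp add: abs_mult field_simps)
        then have "\<bar>W x * frac_int \<alpha> Q0 f x / (K * t)\<bar> \<le> \<Phi> x / K"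
          using elim(1) K by (simp only: divide_right_mono less_imp_le)
        ultimately show ?case by (intro ennreal_leI powr_mono2) auto
      qed
    qed
    then have "modular q Q0 (\<lambda>x. W x * frac_int \<alpha> Q0 f x / (K * t)) \<le> 1" using \<Phi>(3) by order
    moreover have "AE x in ?M. integrable ?M (\<lambda>y. f y * frac_kernel \<alpha> x y)" using main by eventually_elim auto
    ultimately show ?thesis by blast
  qed
  let ?T = "{ennreal t | t. 0 < t \<and> modular p Q0 (\<lambda>x. W x * f x / t) \<le> 1}"
  have "?T \<noteq> {}" using fin unfolding Lp_norm_def by (metis Inf_empty infinity_ennreal_def less_irrefl)
  then obtain t0 where t0: "0 < t0" "modular p Q0 (\<lambda>x. W x * f x / t0) \<le> 1" by auto
  have def: "frac_int_defined \<alpha> Q0 f" unfolding frac_int_defined_def using step[OF t0] by blast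
  let ?X = "Lp_norm q Q0 (\<lambda>x. W x * frac_int \<alpha> Q0 f x)"
  have Kne: "ennreal K \<noteq> 0" "ennreal K \<noteq> \<infinity>" using K by auto
  have "?X / ennreal K \<le> Inf ?T"
  proof (rule Inf_greatest)
    fix s assume "s \<in> ?T"
    then obtain t where t: "s = ennreal t" "0 < t" "modular p Q0 (\<lambda>x. W x * f x / t) \<le> 1" by auto
    have "?X \<le> ennreal (K * t)"
      unfolding Lp_norm_def using step[OF t(2,3)] K t(2) by (intro Inf_lower) (auto intro!: exI[of _ "K * t"])
    then have "?X / ennreal K \<le> ennreal (K * t) / ennreal K" by (rule divide_right_mono_ennreal)
    also have "\<dots> = s" using K t by (simp add: divide_ennreal)
    finally show "?X / ennreal K \<le> s" .
  qed
  then have "ennreal K * (?X / ennreal K) \<le> ennreal K * Lp_norm p Q0 (\<lambda>x. W x * f x)"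
    unfolding Lp_norm_def by (rule mult_left_mono) auto
  moreover have "ennreal K * (?X / ennreal K) = ?X"
    unfolding ennreal_times_divide mult.commute[of "ennreal K" ?X] using Kne
    by (intro ennreal_mult_divide_eq) auto
  ultimately show ?thesis using def by simp
qed

section \<open>The theorem\<close>

lemma linear_fractional_difference:
  fixes x y b :: real
  assumes "x \<noteq> 1" "y \<noteq> 1"
  shows "(x - b) / (1 - x) - (y - b) / (1 - y) = (1 - b) * (x - y) / ((1 - x) * (1 - y))"
proof -
  have "1 - x \<noteq> 0" "1 - y \<noteq> 0" using assms by auto
  then have "(x - b) / (1 - x) - (y - b) / (1 - y) = ((x - b) * (1 - y) - (y - b) * (1 - x)) / ((1 - x) * (1 - y))"
    by (rule diff_frac_eq)
  also have "(x - b) * (1 - y) - (y - b) * (1 - x) = (1 - b) * (x - y)" by (simp add: algebra_simps)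
  finally show ?thesis .
qed

theorem corollary1p13:
  fixes Q0 :: "(real ^ 'n) set"
    and \<alpha> :: real
    and p q w1 w2 :: "real ^ 'n \<Rightarrow> real"
  assumes "is_cube Q0"
    and "0 < \<alpha>" and "\<alpha> < real CARD('n)"
    and "exponent Q0 p" and "log_Holder Q0 p"
    and "1 < lower Q0 p"
    and "\<forall>x\<in>Q0. lower Q0 p \<le> p x \<and> p x \<le> upper Q0 p"
    and "upper Q0 p < real CARD('n) / \<alpha>"
    and "\<forall>x\<in>Q0. 1 / q x = 1 / p x - \<alpha> / real CARD('n)"
    and "w1 \<in> A1 Q0" and "admissible Q0 w1"
    and "w2 \<in> A1 Q0" and "admissible Q0 w2"
  shows "\<exists>\<epsilon>0>0. \<forall>\<epsilon>. 0 < \<epsilon> \<and> \<epsilon> < \<epsilon>0 \<and>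
      \<epsilon> < Min {\<alpha>, real CARD('n) - \<alpha>, real CARD('n) / upper Q0 q,
               real CARD('n) * (1 / upper Q0 p - 1 / lower Q0 q)} \<longrightarrow>
      (let w = product_weight (\<alpha> - \<epsilon>) p Q0 w1 w2 in
        \<exists>C::real>0. \<forall>f. (\<lambda>x. w x * f x) \<in> Lp_space p Q0 \<longrightarrow>
          frac_int_defined \<alpha> Q0 f \<and>
          Lp_norm q Q0 (\<lambda>x. w x * frac_int \<alpha> Q0 f x)
            \<le> ennreal C * Lp_norm p Q0 (\<lambda>x. w x * f x))"
proof -
  let ?n = "real CARD('n)"
  let ?M = "lebesgue_on Q0"
  have n: "0 < ?n" using zero_less_card_finite[where 'a='n] by simp
  have dim: "DIM(real ^ 'n) = CARD('n)" by simp
  obtain c D where R: "regular_set Q0 c D" using is_cube_regular[OF assms(1)] by metis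
  note Rd = regular_setD[OF R]
  define \<kappa> where "\<kappa> = lower Q0 p"
  define P where "P = upper Q0 p"
  have p_range: "\<kappa> \<le> p x \<and> p x \<le> P" if "x \<in> Q0" for x using assms(7) that by (auto simp: \<kappa>_def P_def)
  have kap: "1 < \<kappa>" using assms(6) by (simp add: \<kappa>_def)
  have p1: "1 < p x" if "x \<in> Q0" for x using p_range[OF that] kap by linarith
  have P0: "0 < P" using Rd(2) p1 p_range by (metis all_not_in_conv less_le_trans less_trans zero_less_one)
  have p_meas[measurable]: "p \<in> borel_measurable ?M" using assms(4) by (simp add: exponent_def)
  define \<eta> where "\<eta> = 1 / P - \<alpha> / ?n"
  have eta: "0 < \<eta>" using assms(2,8) P0 n by (simp add: \<eta>_def P_def[symmetric] field_simps)
  obtain L where L: "0 \<le> L" "\<And>x y. x \<in> Q0 \<Longrightarrow> y \<in> Q0 \<Longrightarrow> \<bar>p x - p y\<bar> * ln (1 / norm (x - y)) \<le> L"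
    using log_Holder_bound[OF assms(5), of P] p_range p1 P0 by (metis less_imp_le less_trans zero_less_one)
  have recip: "\<bar>1 / p x - 1 / p y\<bar> * ln (1 / norm (x - y)) \<le> L" if "x \<in> Q0" "y \<in> Q0" for x y
  proof -
    have xy: "1 \<le> p x * p y" using mult_mono[of 1 "p x" 1 "p y"] p1[OF that(1)] p1[OF that(2)] by simp
    have "\<bar>1 / p x - 1 / p y\<bar> = \<bar>p x - p y\<bar> / (p x * p y)"
      using p1[OF that(1)] p1[OF that(2)] by (simp add: divide_simps abs_mult abs_minus_commute)
    also have "\<dots> \<le> \<bar>p x - p y\<bar> / 1" using xy by (intro divide_left_mono) auto
    finally have "\<bar>1 / p x - 1 / p y\<bar> \<le> 1 * \<bar>p x - p y\<bar>" by simp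
    then have "\<bar>1 / p x - 1 / p y\<bar> * ln (1 / norm (x - y)) \<le> 1 * L"
      by (rule log_modulus_transfer[OF _ L(2)[OF that] L(1)]) simp
    then show ?thesis by simp
  qed
  obtain d1 where d1: "0 < d1" and w1: "\<forall>t L. t \<in> borel_measurable ?M \<and> (\<forall>x\<in>Q0. 0 \<le> t x \<and> t x \<le> 1 + d1) \<and> 0 \<le> L \<and>
       (\<forall>x\<in>Q0. \<forall>y\<in>Q0. \<bar>t x - t y\<bar> * ln (1 / norm (x - y)) \<le> L) \<longrightarrow>
       (\<exists>C. A1_on Q0 C (\<lambda>x. w1 x powr t x))"
    by (rule admissible_variable_powr[OF assms(1,10,11)])
  obtain d2 where d2: "0 < d2" and w2: "\<forall>t L. t \<in> borel_measurable ?M \<and> (\<forall>x\<in>Q0. 0 \<le> t x \<and> t x \<le> 1 + d2) \<and> 0 \<le> L \<and>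
       (\<forall>x\<in>Q0. \<forall>y\<in>Q0. \<bar>t x - t y\<bar> * ln (1 / norm (x - y)) \<le> L) \<longrightarrow>
       (\<exists>C. A1_on Q0 C (\<lambda>x. w2 x powr t x))"
    by (rule admissible_variable_powr[OF assms(1,12,13)])
  have w12_meas[measurable]: "w1 \<in> borel_measurable ?M" "w2 \<in> borel_measurable ?M"
    using assms(10,12) by (auto simp: A1_def weight_def)
  \<comment> \<open>The first bound keeps \<open>1 / p - (\<alpha> + \<epsilon>) / n\<close> above \<open>\<eta> / 2\<close>; with the second one, the power of \<open>w1\<close>
    needed for the order \<open>\<alpha> + \<epsilon>\<close> is at most \<open>1 + d1\<close>.\<close>
  define \<epsilon>0 where "\<epsilon>0 = min (?n * \<eta> / 2) (?n * \<eta> * d1 / 4)"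
  have e0: "0 < \<epsilon>0" using n eta d1 by (simp add: \<epsilon>0_def)
  show ?thesis
  proof (intro exI[of _ \<epsilon>0] conjI allI impI e0)
    fix \<epsilon> assume e: "0 < \<epsilon> \<and> \<epsilon> < \<epsilon>0 \<and> \<epsilon> < Min {\<alpha>, ?n - \<alpha>, ?n / upper Q0 q, ?n * (1 / upper Q0 p - 1 / lower Q0 q)}"
    have eps: "0 < \<epsilon>" "\<epsilon> < \<alpha>" "\<epsilon> < ?n - \<alpha>" "\<epsilon> < ?n * \<eta> / 2" "\<epsilon> < ?n * \<eta> * d1 / 4"
      using e by (auto simp: \<epsilon>0_def)
    define a where "a x = 1 / p x - (\<alpha> - \<epsilon>) / ?n" for x
    define b where "b x = 1 / p x - (\<alpha> + \<epsilon>) / ?n" for x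
    have recipP: "1 / P \<le> 1 / p x" if "x \<in> Q0" for x
      using p_range[OF that] p1[OF that] by (intro divide_left_mono) auto
    have a_ge: "\<eta> \<le> a x" if "x \<in> Q0" for x
      using recipP[OF that] eps(1) n by (simp add: a_def \<eta>_def diff_divide_distrib add_increasing2)
    have e2: "\<epsilon> / ?n < \<eta> / 2" using eps(4) n by (simp add: field_simps)
    have b_ge: "\<eta> / 2 \<le> b x" if "x \<in> Q0" for x
    proof -
      have "b x = 1 / p x - \<alpha> / ?n - \<epsilon> / ?n" by (simp add: b_def add_divide_distrib)
      moreover have "\<eta> + \<alpha> / ?n \<le> 1 / p x" using recipP[OF that] by (simp add: \<eta>_def)
      ultimately show ?thesis using e2 by linarith
    qed
    have am[measurable]: "a \<in> borel_measurable ?M" "b \<in> borel_measurable ?M" unfolding a_def b_def by measurable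
    have sob: "1 / sobolev_exp (\<alpha> - \<epsilon>) p x = a x" for x by (simp add: sobolev_exp_def a_def)
    define s0 where "s0 = lower Q0 (s_exp (\<alpha> - \<epsilon>) p)"
    have s_eq: "s_exp (\<alpha> - \<epsilon>) p x = 1 + (1 - 1 / p x) / a x" for x
      by (simp add: s_exp_def sobolev_exp_def conj_exp_def a_def)
    have s_ge: "1 \<le> s_exp (\<alpha> - \<epsilon>) p x" if "x \<in> Q0" for x
      using a_ge[OF that] eta p1[OF that] by (simp add: s_eq)
    have s0: "1 \<le> s0" unfolding s0_def lower_def using Rd(2) s_ge by (intro cINF_greatest) auto
    have s0_le: "s0 - 1 \<le> (1 - 1 / p x) / a x" if "x \<in> Q0" for x
    proof -
      have "s0 \<le> s_exp (\<alpha> - \<epsilon>) p x"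
        unfolding s0_def lower_def using s_ge that by (intro cINF_lower bdd_belowI2[where m=1]) auto
      then show ?thesis by (simp add: s_eq)
    qed
    \<comment> \<open>The exponents are determined by \<open>\<tau> (1 - 1 / p) = (s0 - 1) a\<close> and \<open>t b = a\<close>, so that the powers of
      \<open>w2 powr \<tau>\<close> and of \<open>w1\<close>, \<open>w1 powr t\<close> in the two-weight problems recover the given weight.\<close>
    define \<tau> where "\<tau> x = (s0 - 1) * a x / (1 - 1 / p x)" for x
    define t where "t x = a x / b x" for x
    define W where "W = product_weight (\<alpha> - \<epsilon>) p Q0 w1 w2"
    have W_eq: "W x = w1 x powr a x * w2 x powr (a x * (1 - s0))" for x
      by (simp add: W_def product_weight_def sob s0_def)
    define k where "k = 1 - 1 / \<kappa>"
    have k: "0 < k" using kap by (simp add: k_def)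
    have pk: "k \<le> 1 - 1 / p x" if "x \<in> Q0" for x
      using p_range[OF that] kap by (auto simp: k_def intro!: divide_left_mono)
    obtain Cs where As: "A1_on Q0 Cs (\<lambda>x. w2 x powr \<tau> x)"
    proof -
      have "\<tau> \<in> borel_measurable ?M" unfolding \<tau>_def by measurable
      moreover have "0 \<le> \<tau> x \<and> \<tau> x \<le> 1 + d2" if "x \<in> Q0" for x
      proof
        have ap: "0 < a x" using a_ge[OF that] eta by linarith
        have pp: "0 < 1 - 1 / p x" using pk[OF that] k by linarith
        show "0 \<le> \<tau> x" using s0 ap pp by (simp add: \<tau>_def)
        have "(s0 - 1) * a x \<le> 1 - 1 / p x" using s0_le[OF that] ap by (simp add: pos_le_divide_eq)
        then have "\<tau> x \<le> 1" using pp by (simp add: \<tau>_def divide_le_eq)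
        then show "\<tau> x \<le> 1 + d2" using d2 by linarith
      qed
      moreover have "0 \<le> (s0 - 1) / k\<^sup>2 * L" using s0 L by simp
      moreover have "\<bar>\<tau> x - \<tau> y\<bar> * ln (1 / norm (x - y)) \<le> (s0 - 1) / k\<^sup>2 * L" if "x \<in> Q0" "y \<in> Q0" for x y
      proof (rule log_modulus_transfer[OF _ recip[OF that] L(1)])
        let ?\<xi> = "1 / p x" and ?\<zeta> = "1 / p y" and ?b = "(\<alpha> - \<epsilon>) / ?n"
        have xi: "0 < 1 - ?\<xi>" "0 < 1 - ?\<zeta>" using pk[OF that(1)] pk[OF that(2)] k by linarith+
        have b1: "0 \<le> ?b" "?b \<le> 1" using eps assms(3) n by auto
        have "a x / (1 - ?\<xi>) - a y / (1 - ?\<zeta>) = (1 - ?b) * (?\<xi> - ?\<zeta>) / ((1 - ?\<xi>) * (1 - ?\<zeta>))"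
          unfolding a_def using xi by (intro linear_fractional_difference) auto
        then have "\<tau> x - \<tau> y = (s0 - 1) * ((1 - ?b) * (?\<xi> - ?\<zeta>) / ((1 - ?\<xi>) * (1 - ?\<zeta>)))"
          unfolding \<tau>_def by (metis right_diff_distrib times_divide_eq_right)
        then have "\<bar>\<tau> x - \<tau> y\<bar> = (s0 - 1) * ((1 - ?b) * \<bar>?\<xi> - ?\<zeta>\<bar> / ((1 - ?\<xi>) * (1 - ?\<zeta>)))"
          using s0 b1 xi by (simp only: abs_mult abs_divide abs_of_nonneg abs_of_pos)
        also have "\<dots> \<le> (s0 - 1) * (1 * \<bar>?\<xi> - ?\<zeta>\<bar> / (k * k))"
          using s0 b1 k pk[OF that(1)] pk[OF that(2)]
          by (intro mult_left_mono frac_le mult_mono mult_right_mono mult_pos_pos) auto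
        finally show "\<bar>\<tau> x - \<tau> y\<bar> \<le> (s0 - 1) / k\<^sup>2 * \<bar>?\<xi> - ?\<zeta>\<bar>" by (simp add: power2_eq_square)
      qed (use s0 in simp)
      ultimately show ?thesis using w2 that by blast
    qed
    obtain Cm where Am: "A1_on Q0 Cm (\<lambda>x. w1 x powr 1)"
      using w1[THEN spec, THEN spec, of "\<lambda>_. 1" 0] d1 by auto
    obtain Cp where Ap: "A1_on Q0 Cp (\<lambda>x. w1 x powr t x)"
    proof -
      have tb: "t x = 1 + 2 * \<epsilon> / ?n / b x" if "x \<in> Q0" for x
      proof -
        have "0 < b x" using b_ge[OF that] eta by linarith
        moreover have "a x = b x + 2 * \<epsilon> / ?n" by (simp add: a_def b_def diff_divide_distrib add_divide_distrib)
        ultimately show ?thesis by (simp add: t_def add_divide_distrib)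
      qed
      have "t \<in> borel_measurable ?M" unfolding t_def by measurable
      moreover have "0 \<le> t x \<and> t x \<le> 1 + d1" if "x \<in> Q0" for x
      proof
        have bp: "0 < b x" using b_ge[OF that] eta by linarith
        show "0 \<le> t x" using tb[OF that] bp eps n by simp
        have "2 * \<epsilon> / ?n / b x \<le> 2 * \<epsilon> / ?n / (\<eta> / 2)" using b_ge[OF that] bp eta eps n by (intro divide_left_mono) auto
        also have "\<dots> \<le> d1" using eps(5) n eta by (simp add: field_simps)
        finally show "t x \<le> 1 + d1" using tb[OF that] by simp
      qed
      moreover have "0 \<le> 2 * \<epsilon> / ?n / (\<eta> / 2)\<^sup>2 * L" using eps n L by simp
      moreover have "\<bar>t x - t y\<bar> * ln (1 / norm (x - y)) \<le> 2 * \<epsilon> / ?n / (\<eta> / 2)\<^sup>2 * L" if "x \<in> Q0" "y \<in> Q0" for x y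
      proof (rule log_modulus_transfer[OF _ recip[OF that] L(1)])
        have bp: "0 < b x" "0 < b y" using b_ge[OF that(1)] b_ge[OF that(2)] eta by linarith+
        have eq: "1 / b x - 1 / b y = (1 / p y - 1 / p x) / (b x * b y)"
        proof -
          have "1 / b x - 1 / b y = (b y - b x) / (b x * b y)" using bp by (simp add: diff_frac_eq)
          also have "b y - b x = 1 / p y - 1 / p x" by (simp add: b_def)
          finally show ?thesis .
        qed
        have "t x - t y = 2 * \<epsilon> / ?n * ((1 / p y - 1 / p x) / (b x * b y))"
          unfolding tb[OF that(1)] tb[OF that(2)] eq[symmetric] by (simp add: right_diff_distrib)
        then have "\<bar>t x - t y\<bar> = 2 * \<epsilon> / ?n * (\<bar>1 / p x - 1 / p y\<bar> / (b x * b y))"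
          using eps n bp by (simp only: abs_mult abs_divide abs_of_pos abs_minus_commute)
        also have "\<dots> \<le> 2 * \<epsilon> / ?n * (\<bar>1 / p x - 1 / p y\<bar> / (\<eta> / 2 * (\<eta> / 2)))"
          using eps n eta b_ge[OF that(1)] b_ge[OF that(2)]
          by (intro mult_left_mono frac_le mult_mono mult_pos_pos) auto
        finally show "\<bar>t x - t y\<bar> \<le> 2 * \<epsilon> / ?n / (\<eta> / 2)\<^sup>2 * \<bar>1 / p x - 1 / p y\<bar>"
          by (simp add: power2_eq_square)
      qed (use eps n in simp)
      ultimately show ?thesis using w1 that by blast
    qed
    obtain Ts where Ts: "0 < Ts" "(\<integral>\<^sup>+x. ennreal (w2 x powr \<tau> x) \<partial>?M) = ennreal Ts" using A1_on_total[OF R As] by metis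
    obtain Tm where Tm: "(\<integral>\<^sup>+x. ennreal (w1 x powr 1) \<partial>?M) = ennreal Tm" using A1_on_total[OF R Am] by metis
    obtain Tp where Tp: "(\<integral>\<^sup>+x. ennreal (w1 x powr t x) \<partial>?M) = ennreal Tp" using A1_on_total[OF R Ap] by metis
    have aP: "(\<alpha> + \<epsilon>) / ?n < 1 / P"
    proof -
      have "\<epsilon> / ?n < \<eta>" using e2 eta by linarith
      then show ?thesis by (simp add: \<eta>_def add_divide_distrib)
    qed
    have aM: "(\<alpha> - \<epsilon>) / ?n < 1 / P"
    proof -
      have "(\<alpha> - \<epsilon>) / ?n \<le> (\<alpha> + \<epsilon>) / ?n" using eps n by (intro divide_right_mono) auto
      then show ?thesis using aP by linarith
    qed
    have tm: "two_weights Q0 c D p \<kappa> P (\<alpha> - \<epsilon>) L (\<lambda>x. w1 x powr 1) (\<lambda>x. w2 x powr \<tau> x) Cm Cs Tm Ts"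
      by unfold_locales (use R p_range kap L eps assms(3) aM Am As Tm Ts in \<open>auto simp: dim\<close>)
    have tp: "two_weights Q0 c D p \<kappa> P (\<alpha> + \<epsilon>) L (\<lambda>x. w1 x powr t x) (\<lambda>x. w2 x powr \<tau> x) Cp Cs Tp Ts"
      by unfold_locales (use R p_range kap L eps assms(2) aP Ap As Tp Ts in \<open>auto simp: dim\<close>)
    have sig: "(w2 x powr \<tau> x) powr (- (1 - 1 / p x)) = w2 x powr (a x * (1 - s0))" if "x \<in> Q0" for x
    proof -
      define e where "e = 1 - 1 / p x"
      have "0 < e" using pk[OF that] k unfolding e_def by linarith
      then have "\<tau> x * e = (s0 - 1) * a x" by (simp add: \<tau>_def e_def[symmetric])
      then have "\<tau> x * (- (1 - 1 / p x)) = a x * (1 - s0)" unfolding e_def[symmetric] by (simp add: algebra_simps)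
      then show ?thesis by (simp only: powr_powr)
    qed
    have Wm: "W x = (w1 x powr 1) powr (1 / p x - (\<alpha> - \<epsilon>) / real DIM(real ^ 'n)) * (w2 x powr \<tau> x) powr (- (1 - 1 / p x))"
      if "x \<in> Q0" for x
      unfolding sig[OF that] W_eq by (simp only: powr_powr dim mult_1_left a_def)
    have Wp: "W x = (w1 x powr t x) powr (1 / p x - (\<alpha> + \<epsilon>) / real DIM(real ^ 'n)) * (w2 x powr \<tau> x) powr (- (1 - 1 / p x))"
      if "x \<in> Q0" for x
    proof -
      have "t x * b x = a x" using b_ge[OF that] eta by (simp add: t_def)
      then show ?thesis unfolding sig[OF that] W_eq by (simp only: powr_powr dim b_def)
    qed
    have W_meas: "W \<in> borel_measurable ?M"
    proof -
      have "(\<lambda>x. w1 x powr a x * w2 x powr (a x * (1 - s0))) \<in> borel_measurable ?M" by measurable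
      then show ?thesis by (simp add: W_eq[abs_def])
    qed
    have "AE x in ?M. 1 \<le> w1 x" "AE x in ?M. 1 \<le> w2 x" using assms(11,13) by (auto simp: admissible_def)
    then have W_pos: "AE x in ?M. 0 < W x" by eventually_elim (simp add: W_eq)
    obtain K where K: "0 < K" and core: "\<And>f. f \<in> borel_measurable ?M \<Longrightarrow> (\<integral>\<^sup>+x. ennreal (\<bar>W x * f x\<bar> powr p x) \<partial>?M) \<le> 1 \<Longrightarrow>
      \<exists>\<Phi>. (\<forall>x. 0 \<le> \<Phi> x) \<and>
        (AE x in ?M. ennreal (W x) *
          (\<integral>\<^sup>+y. ennreal (\<bar>f y\<bar> * norm (x - y) powr (\<alpha> - real DIM(real ^ 'n))) \<partial>?M) \<le> ennreal (\<Phi> x)) \<and>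
        (\<integral>\<^sup>+x. ennreal ((\<Phi> x / K) powr (1 / (1 / p x - \<alpha> / real DIM(real ^ 'n)))) \<partial>?M) \<le> 1"
      using weighted_fractional_integral[OF tm tp eps(1) Wm Wp W_meas W_pos] by blast
    have q_eq: "1 / (1 / p x - \<alpha> / ?n) = q x" if "x \<in> Q0" for x
      using assms(9) that by (metis divide_divide_eq_right div_by_1 mult_1)
    have q_pos: "0 < q x" if "x \<in> Q0" for x
    proof -
      have "0 < 1 / p x - \<alpha> / ?n" using recipP[OF that] eta by (simp add: \<eta>_def)
      then show ?thesis using q_eq[OF that] by (metis zero_less_divide_1_iff)
    qed
    have core': "\<exists>\<Phi>. (\<forall>x. 0 \<le> \<Phi> x) \<and>
        (AE x in ?M. ennreal (W x) *
          (\<integral>\<^sup>+y. ennreal (\<bar>f y\<bar> * norm (x - y) powr (\<alpha> - ?n)) \<partial>?M) \<le> ennreal (\<Phi> x)) \<and>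
        (\<integral>\<^sup>+x. ennreal ((\<Phi> x / K) powr q x) \<partial>?M) \<le> 1"
      if "f \<in> borel_measurable ?M" "(\<integral>\<^sup>+x. ennreal (\<bar>W x * f x\<bar> powr p x) \<partial>?M) \<le> 1" for f
    proof -
      have eq: "(\<integral>\<^sup>+x. ennreal ((\<Phi> x / K) powr (1 / (1 / p x - \<alpha> / ?n))) \<partial>?M) = (\<integral>\<^sup>+x. ennreal ((\<Phi> x / K) powr q x) \<partial>?M)" for \<Phi>
        by (intro nn_integral_cong) (simp add: q_eq space_restrict_space)
      show ?thesis using core[OF that] unfolding dim eq .
    qed
    have "frac_int_defined \<alpha> Q0 f \<and> Lp_norm q Q0 (\<lambda>x. W x * frac_int \<alpha> Q0 f x) \<le> ennreal K * Lp_norm p Q0 (\<lambda>x. W x * f x)"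
      if "(\<lambda>x. W x * f x) \<in> Lp_space p Q0" for f
      by (rule norm_inequality_from_modular[OF Rd(1) K W_meas W_pos q_pos core' that])
    then show "let w = product_weight (\<alpha> - \<epsilon>) p Q0 w1 w2 in
        \<exists>C::real>0. \<forall>f. (\<lambda>x. w x * f x) \<in> Lp_space p Q0 \<longrightarrow>
          frac_int_defined \<alpha> Q0 f \<and>
          Lp_norm q Q0 (\<lambda>x. w x * frac_int \<alpha> Q0 f x)
            \<le> ennreal C * Lp_norm p Q0 (\<lambda>x. w x * f x)"
      unfolding Let_def W_def[symmetric] using K by blast
  qed
qed

end
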